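(* Let $n\in\mathbb{N}$, $\alpha\in(0,1)$ and $p\in\left[1,\frac{n}{n-\alpha}\right)$. If $f\in BV^{\alpha,p}(\mathbb{R}^n)$, then there exists a sequence $(f_k)_{k\in\mathbb{N}}\subset C^\infty_c(\mathbb{R}^n)$ such that $f_k\to f$ in $L^p(\mathbb{R}^n)$ and $|D^\alpha f_k|(\mathbb{R}^n)\to|D^\alpha f|(\mathbb{R}^n)$ as $k\to+\infty$.
   Context: For $\alpha\in(0,1)$ let $\mu_{n,\alpha}=2^{\alpha}\pi^{-n/2}\Gamma\left(\frac{n+\alpha+1}{2}\right)/\Gamma\left(\frac{1-\alpha}{2}\right)$ and, for $\varphi\in C^\infty_c(\mathbb{R}^n;\mathbb{R}^n)$, $\operatorname{div}^\alpha\varphi(x)=\mu_{n,\alpha}\int_{\mathbb{R}^n}\frac{(y-x)\cdot(\varphi(y)-\varphi(x))}{|y-x|^{n+\alpha+1}}\,dy$. For $p\in[1,+\infty]$, $BV^{\alpha,p}(\mathbb{R}^n)$ is the set of $f\in L^p(\mathbb{R}^n)$ with $|D^\alpha f|(\mathbb{R}^n):=\sup\{\int_{\mathbb{R}^n} f\operatorname{div}^\alpha\varphi\,dx:\varphi\in C^\infty_c(\mathbb{R}^n;\mathbb{R}^n),\ \|\varphi\|_{L^\infty}\le1\}<+\infty$. *)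

theory Defs
  imports "HOL-Analysis.Analysis"
begin

primrec iter_dderiv :: "'a::euclidean_space list \<Rightarrow> ('a \<Rightarrow> real) \<Rightarrow> 'a \<Rightarrow> real" where
  "iter_dderiv [] g = g"
| "iter_dderiv (e # es) g = (\<lambda>x. frechet_derivative (iter_dderiv es g) (at x) e)"

definition smooth_real :: "('a::euclidean_space \<Rightarrow> real) \<Rightarrow> bool" where
  "smooth_real g \<longleftrightarrow> (\<forall>es x. iter_dderiv es g differentiable (at x))"

definition compact_support :: "('a::euclidean_space \<Rightarrow> 'b::zero) \<Rightarrow> bool" where
  "compact_support g \<longleftrightarrow> compact (closure {x. g x \<noteq> 0})"

definition Cc_inf :: "('a::euclidean_space \<Rightarrow> real) set" where
  "Cc_inf = {g. smooth_real g \<and> compact_support g}"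

definition Cc_inf_vec :: "(real^'n \<Rightarrow> real^'n) set" where
  "Cc_inf_vec = {\<phi>. (\<forall>i. smooth_real (\<lambda>x. \<phi> x $ i)) \<and> compact_support \<phi>}"

definition mu_const :: "nat \<Rightarrow> real \<Rightarrow> real" where
  "mu_const n \<alpha> = 2 powr \<alpha> * pi powr (- (real n / 2)) * Gamma ((real n + \<alpha> + 1) / 2)
      / Gamma ((1 - \<alpha>) / 2)"

definition frac_div :: "real \<Rightarrow> (real^'n \<Rightarrow> real^'n) \<Rightarrow> real^'n \<Rightarrow> real" where
  "frac_div \<alpha> \<phi> x = mu_const CARD('n) \<alpha> *
     (LINT y|lebesgue. ((y - x) \<bullet> (\<phi> y - \<phi> x)) / norm (y - x) powr (real CARD('n) + \<alpha> + 1))"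

definition frac_var :: "real \<Rightarrow> (real^'n \<Rightarrow> real) \<Rightarrow> ereal" where
  "frac_var \<alpha> f = (SUP \<phi>\<in>{\<phi>\<in>Cc_inf_vec. \<forall>x. norm (\<phi> x) \<le> 1}.
       ereal (LINT x|lebesgue. f x * frac_div \<alpha> \<phi> x))"

definition Lp :: "real \<Rightarrow> ('a::euclidean_space \<Rightarrow> real) set" where
  "Lp p = {f. f \<in> borel_measurable lebesgue \<and> integrable lebesgue (\<lambda>x. \<bar>f x\<bar> powr p)}"

definition BV_frac :: "real \<Rightarrow> real \<Rightarrow> (real^'n \<Rightarrow> real) set" where
  "BV_frac \<alpha> p = {f. f \<in> Lp p \<and> frac_var \<alpha> f < \<infinity>}"

end

theory Submission
  imports Defs
begin

text \<open>
  Take \<open>f\<^sub>k = (\<eta>\<^sub>R f) * \<rho>\<close> with \<open>\<eta>\<^sub>R(x) = \<eta>(x / R)\<close> a cutoff and \<open>\<rho>\<close> an even mollifier. Mollification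
  does not increase the variation, since \<open>\<integral> (u * \<rho>) div\<^sup>\<alpha> \<phi> = \<integral> u div\<^sup>\<alpha> (\<rho> * \<phi>)\<close>. For the cutoff,
  \<open>\<eta>\<^sub>R div\<^sup>\<alpha> \<phi>\<close> differs from \<open>div\<^sup>\<alpha> (\<eta>\<^sub>R \<phi>)\<close> by at most a multiple of
  \<open>D\<^sub>R(x) = \<integral> \<bar>\<eta>\<^sub>R(y) - \<eta>\<^sub>R(x)\<bar> / \<bar>y - x\<bar>\<^bsup>n+\<alpha>\<^esup> dy = R\<^bsup>-\<alpha>\<^esup> D\<^sub>1(x / R)\<close>, where \<open>D\<^sub>1\<close> is bounded and
  integrable. Hence \<open>\<integral> \<bar>f\<bar> D\<^sub>R\<close> is of order \<open>R\<^bsup>n - n/p - \<alpha>\<^esup>\<close>, which tends to \<open>0\<close> exactly because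
  \<open>p < n / (n - \<alpha>)\<close>. This bounds the upper limit of the variations by that of \<open>f\<close>; the lower limit is
  controlled by lower semicontinuity under \<open>L\<^sup>p\<close> convergence.
\<close>

text \<open>The obstacle is nonlocality: the fractional divergence of a compactly supported field is
  in general not compactly supported. A large cutoff therefore disturbs the pairing with every test
  field, and limits against a fixed field need global control. What replaces locality is that these
  divergences are bounded and integrable, hence pair with every L^p function. Both facts come from
  the majorant min(1,|h|) / |h|^(n+\<alpha>), which is integrable near 0 because \<alpha> < 1 and
  near infinity because \<alpha> > 0. By scaling, D_R has supremum of order R^(-\<alpha>) and
  integral of order R^(n-\<alpha>). Splitting \<open>f\<close> at height R^(-n/p) balances the two
  contributions, and this is the origin of the exponent. Cutting off comes first because
  \<open>f\<close> is only in L^p: the truncated function is integrable with compact support, as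
  differentiation under the integral and Fubini require. The kernel is even so that mollification is
  its own adjoint.\<close>

section \<open>Smooth functions\<close>

text \<open>The recursion adds derivatives on the outside. Passing from \<open>g\<close> to one of
  its derivatives adds one on the inside, hence at the end of the list.\<close>

lemma iter_dderiv_snoc:
  "iter_dderiv (es @ [e]) g = iter_dderiv es (\<lambda>x. frechet_derivative g (at x) e)"
  by (induction es) simp_all

text \<open>Every iterated derivative stays in \<open>S\<close>, by induction on the list of
  directions. Later smoothness proofs only exhibit a class of differentiable functions closed under
  one derivative and never compute higher ones.\<close>

lemma smooth_real_coinduct:
  assumes "g \<in> S"
    and diff: "\<And>g x. g \<in> S \<Longrightarrow> g differentiable (at x)"
    and closed: "\<And>g e. g \<in> S \<Longrightarrow> (\<lambda>x. frechet_derivative g (at x) e) \<in> S"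
  shows "smooth_real g"
proof -
  have "iter_dderiv es g \<in> S" for es
    by (induction es) (auto intro: assms)
  then show ?thesis
    by (simp add: smooth_real_def diff)
qed

lemma smooth_real_differentiable: "smooth_real g \<Longrightarrow> g differentiable (at x)"
  unfolding smooth_real_def by (drule spec[of _ "[]"]) simp

lemma smooth_real_frechet_derivative:
  "smooth_real g \<Longrightarrow> smooth_real (\<lambda>x. frechet_derivative g (at x) e)"
  unfolding smooth_real_def by (simp flip: iter_dderiv_snoc)

lemma smooth_real_has_derivative:
  "smooth_real g \<Longrightarrow> (g has_derivative frechet_derivative g (at x)) (at x)"
  using smooth_real_differentiable[of g x] unfolding frechet_derivative_works .

lemma smooth_real_continuous_on: "smooth_real g \<Longrightarrow> continuous_on S g"
  by (meson continuous_at_imp_continuous_on differentiable_imp_continuous_within smooth_real_differentiable)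

section \<open>Smoothness of polynomial expressions in given functions\<close>

inductive_set gen_alg :: "('a::euclidean_space \<Rightarrow> real) set \<Rightarrow> ('a \<Rightarrow> real) set"
  for G :: "('a \<Rightarrow> real) set" where
  gen: "g \<in> G \<Longrightarrow> g \<in> gen_alg G"
| add: "g \<in> gen_alg G \<Longrightarrow> h \<in> gen_alg G \<Longrightarrow> (\<lambda>x. g x + h x) \<in> gen_alg G"
| mult: "g \<in> gen_alg G \<Longrightarrow> h \<in> gen_alg G \<Longrightarrow> (\<lambda>x. g x * h x) \<in> gen_alg G"

text \<open>The sum and product rules express derivatives of sums and products through members of
  the algebra, so it suffices to check the generators. Their derivatives may lie anywhere in the
  algebra, not just in \<open>G\<close>.\<close>

lemma smooth_real_gen_alg:
  assumes "g \<in> gen_alg G"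
    and G: "\<And>g x. g \<in> G \<Longrightarrow> g differentiable (at x)"
           "\<And>g e. g \<in> G \<Longrightarrow> (\<lambda>x. frechet_derivative g (at x) e) \<in> gen_alg G"
  shows "smooth_real g"
proof -
  have *: "(\<forall>x. g differentiable (at x)) \<and>
        (\<forall>e. (\<lambda>x. frechet_derivative g (at x) e) \<in> gen_alg G)" if "g \<in> gen_alg G" for g
    using that
  proof induction
    case (gen g)
    then show ?case using G by blast
  next
    case (add g h)
    have "frechet_derivative (\<lambda>x. g x + h x) (at x) =
        (\<lambda>e. frechet_derivative g (at x) e + frechet_derivative h (at x) e)" for x
      using add.IH
      by (intro frechet_derivative_at[symmetric] has_derivative_add) (auto simp: frechet_derivative_works)
    then show ?case
      using add by (auto intro: gen_alg.add)
  next
    case (mult g h)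
    have "frechet_derivative (\<lambda>x. g x * h x) (at x) =
        (\<lambda>e. g x * frechet_derivative h (at x) e + frechet_derivative g (at x) e * h x)" for x
      using mult.IH
      by (intro frechet_derivative_at[symmetric] has_derivative_mult) (auto simp: frechet_derivative_works)
    moreover have "(\<lambda>x. g x * frechet_derivative h (at x) e + frechet_derivative g (at x) e * h x)
        \<in> gen_alg G" for e
      using mult by (intro gen_alg.add gen_alg.mult) auto
    ultimately show ?case
      using mult.IH by auto
  qed
  show ?thesis
    by (rule smooth_real_coinduct[where S = "gen_alg G"]) (use * assms(1) in auto)
qed

lemma smooth_real_mult:
  assumes "smooth_real g" "smooth_real h"
  shows "smooth_real (\<lambda>x. g x * h x)"
  by (rule smooth_real_gen_alg[where G = "Collect smooth_real"])
    (use assms in \<open>auto intro: gen_alg.intros smooth_real_differentiable smooth_real_frechet_derivative\<close>)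

lemma smooth_real_scale:
  assumes "smooth_real g"
  shows "smooth_real (\<lambda>x. a * g (c *\<^sub>R x))"
\<comment> \<open>The factor \<open>a\<close> ranges over all reals because each differentiation
  brings out a factor \<open>c\<close>.\<close>
proof (rule smooth_real_coinduct[where S = "{\<lambda>x. a * g (c *\<^sub>R x) | a g. smooth_real g}"])
  fix h :: "'a \<Rightarrow> real" and x e
  assume "h \<in> {\<lambda>x. a * g (c *\<^sub>R x) | a g. smooth_real g}"
  then obtain a g where h: "h = (\<lambda>x. a * g (c *\<^sub>R x))" and g: "smooth_real g" by blast
  have *: "(h has_derivative (\<lambda>e. a * frechet_derivative g (at (c *\<^sub>R x)) (c *\<^sub>R e))) (at x)" for x
    unfolding h
    by (intro has_derivative_mult_right has_derivative_compose[of "\<lambda>x. c *\<^sub>R x" "\<lambda>e. c *\<^sub>R e" x UNIV g]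
        smooth_real_has_derivative g derivative_eq_intros) auto
  then show "h differentiable at x"
    by (rule differentiableI)
  have "frechet_derivative h (at x) e = (a * c) * frechet_derivative g (at (c *\<^sub>R x)) e" for x
    by (simp flip: frechet_derivative_at[OF *[of x]]
        add: linear_cmul[OF linear_frechet_derivative[OF smooth_real_differentiable[OF g]]])
  then have "(\<lambda>x. frechet_derivative h (at x) e) =
      (\<lambda>x. (a * c) * (\<lambda>x. frechet_derivative g (at x) e) (c *\<^sub>R x))"
    by simp
  then show "(\<lambda>x. frechet_derivative h (at x) e) \<in> {\<lambda>x. a * g (c *\<^sub>R x) | a g. smooth_real g}"
    using smooth_real_frechet_derivative[OF g, of e]
    by (intro CollectI exI[of _ "a * c"] exI[of _ "\<lambda>x. frechet_derivative g (at x) e"] conjI)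
qed (use assms in blast)

section \<open>Global bounds for compactly supported smooth functions\<close>

lemma compact_support_iff:
  "compact_support g \<longleftrightarrow> (\<exists>R>0. \<forall>x. g x \<noteq> 0 \<longrightarrow> norm x \<le> R)"
  unfolding compact_support_def compact_closure bounded_pos by blast

text \<open>Off the closed support \<open>g\<close> vanishes in a whole neighbourhood, so its
  derivative vanishes there as well.\<close>

lemma Cc_inf_frechet_derivative:
  assumes "g \<in> Cc_inf"
  shows "(\<lambda>x. frechet_derivative g (at x) e) \<in> Cc_inf"
proof -
  have "frechet_derivative g (at x) e = 0" if x: "x \<in> - closure {x. g x \<noteq> 0}" for x
  proof -
    have "(g has_derivative (\<lambda>_. 0)) (at x)"
      by (rule has_derivative_transform_within_open[of "\<lambda>_. 0" _ _ _ "- closure {x. g x \<noteq> 0}"])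
        (use x closure_subset[of "{x. g x \<noteq> 0}"] in auto)
    then show ?thesis
      using frechet_derivative_at[of g "\<lambda>_. 0" x] by (simp add: fun_eq_iff)
  qed
  then have "{x. frechet_derivative g (at x) e \<noteq> 0} \<subseteq> closure {x. g x \<noteq> 0}"
    by blast
  then have "compact_support (\<lambda>x. frechet_derivative g (at x) e)"
    using assms bounded_subset[of "closure {x. g x \<noteq> 0}" "{x. frechet_derivative g (at x) e \<noteq> 0}"]
    by (simp add: Cc_inf_def compact_support_def compact_imp_bounded)
  then show ?thesis
    using assms by (simp add: Cc_inf_def smooth_real_frechet_derivative)
qed

lemma compact_support_bounded_range:
  fixes g :: "'a::euclidean_space \<Rightarrow> 'b::real_normed_vector"
  assumes "continuous_on UNIV g" "compact_support g"
  obtains M where "M > 0" "\<And>x. norm (g x) \<le> M"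
proof -
  have "compact (g ` closure {x. g x \<noteq> 0})"
    using assms unfolding compact_support_def
    by (meson compact_continuous_image continuous_on_subset subset_UNIV)
  then obtain M where "M > 0" and M: "\<And>y. y \<in> g ` closure {x. g x \<noteq> 0} \<Longrightarrow> norm y \<le> M"
    by (meson bounded_pos compact_imp_bounded)
  have "norm (g x) \<le> M" for x
  proof (cases "g x = 0")
    case False
    then show ?thesis using M closure_subset[of "{x. g x \<noteq> 0}"] by blast
  qed (use \<open>M > 0\<close> in simp)
  then show ?thesis using that \<open>M > 0\<close> by blast
qed

lemma linear_Basis_expand:
  fixes l :: "'a::euclidean_space \<Rightarrow> real"
  assumes "linear l"
  shows "l h = (\<Sum>b\<in>Basis. (h \<bullet> b) * l b)"
proof -
  have "l h = l (\<Sum>b\<in>Basis. (h \<bullet> b) *\<^sub>R b)" by (simp add: euclidean_representation)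
  then show ?thesis by (simp add: linear_sum[OF assms] linear_cmul[OF assms])
qed

text \<open>The partial derivatives are again in \<open>Cc_inf\<close>, hence bounded. Their bounds
  add up to a bound for the operator norm, and the mean value inequality applies on the whole
  space.\<close>

lemma Cc_inf_Lipschitz:
  fixes g :: "'a::euclidean_space \<Rightarrow> real"
  assumes g: "g \<in> Cc_inf"
  obtains L where "L > 0" "\<And>x y. \<bar>g x - g y\<bar> \<le> L * norm (x - y)"
proof -
  have sm: "smooth_real g" using g by (simp add: Cc_inf_def)
  have "\<exists>M. \<forall>x. \<bar>frechet_derivative g (at x) b\<bar> \<le> M" for b
  proof -
    have "(\<lambda>x. frechet_derivative g (at x) b) \<in> Cc_inf"
      by (rule Cc_inf_frechet_derivative[OF g])
    then have "continuous_on UNIV (\<lambda>x. frechet_derivative g (at x) b)"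
      "compact_support (\<lambda>x. frechet_derivative g (at x) b)"
      by (auto simp: Cc_inf_def intro: smooth_real_continuous_on)
    then obtain M where "M > 0" "\<And>x. norm (frechet_derivative g (at x) b) \<le> M"
      by (rule compact_support_bounded_range) blast
    then show ?thesis by auto
  qed
  then obtain M where M: "\<And>x b. \<bar>frechet_derivative g (at x) b\<bar> \<le> M b" by metis
  define L where "L = (\<Sum>b\<in>Basis. \<bar>M b\<bar>) + 1"
  have "L > 0" unfolding L_def by (simp add: add_nonneg_pos sum_nonneg)
  have "onorm (frechet_derivative g (at x)) \<le> L" for x
  proof (rule onorm_le)
    fix h
    have lin: "linear (frechet_derivative g (at x))"
      using linear_frechet_derivative smooth_real_differentiable[OF sm] by blast
    have "norm (frechet_derivative g (at x) h) = \<bar>\<Sum>b\<in>Basis. (h \<bullet> b) * frechet_derivative g (at x) b\<bar>"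
      using linear_Basis_expand[OF lin, of h] by simp
    also have "\<dots> \<le> (\<Sum>b\<in>Basis. norm h * \<bar>M b\<bar>)"
      by (intro order.trans[OF sum_abs] sum_mono)
        (auto simp: abs_mult intro!: mult_mono Basis_le_norm order.trans[OF M])
    also have "\<dots> \<le> L * norm h"
      by (simp add: L_def sum_distrib_left algebra_simps)
    finally show "norm (frechet_derivative g (at x) h) \<le> L * norm h" .
  qed
  then have "\<bar>g x - g y\<bar> \<le> L * norm (x - y)" for x y
    using differentiable_bound[of UNIV g "\<lambda>x. frechet_derivative g (at x)" L x y]
      smooth_real_has_derivative[OF sm] by auto
  then show ?thesis using that \<open>L > 0\<close> by blast
qed

text \<open>The mean value theorem on the segment replaces the increment by a derivative at an
  intermediate point, and the partial derivatives are Lipschitz. What matters later is that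
  \<open>C\<close> does not depend on \<open>x\<close>: the remainder can then be integrated in a
  convolution.\<close>

lemma Cc_inf_Taylor:
  fixes g :: "'a::euclidean_space \<Rightarrow> real"
  assumes g: "g \<in> Cc_inf"
  obtains C where "C > 0"
    "\<And>x h. \<bar>g (x + h) - g x - frechet_derivative g (at x) h\<bar> \<le> C * (norm h)\<^sup>2"
proof -
  have sm: "smooth_real g" using g by (simp add: Cc_inf_def)
  have "\<exists>L. L > 0 \<and> (\<forall>x y. \<bar>frechet_derivative g (at x) b - frechet_derivative g (at y) b\<bar> \<le> L * norm (x - y))" for b
    by (rule Cc_inf_Lipschitz[OF Cc_inf_frechet_derivative[OF g, of b]]) blast
  then obtain L where L: "\<And>b. L b > 0"
    "\<And>b x y. \<bar>frechet_derivative g (at x) b - frechet_derivative g (at y) b\<bar> \<le> L b * norm (x - y)"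
    by metis
  define C where "C = (\<Sum>b\<in>Basis. L b)"
  have C: "C > 0" unfolding C_def using L(1) by (intro sum_pos) auto
  have lin: "linear (frechet_derivative g (at x))" for x
    using linear_frechet_derivative smooth_real_differentiable[OF sm] by blast
  have "\<bar>g (x + h) - g x - frechet_derivative g (at x) h\<bar> \<le> C * (norm h)\<^sup>2" for x h
  proof -
    have "((\<lambda>t. g (x + t *\<^sub>R h)) has_derivative (\<lambda>s. frechet_derivative g (at (x + t *\<^sub>R h)) (s *\<^sub>R h))) (at t)" for t
      by (intro has_derivative_compose[of "\<lambda>t. x + t *\<^sub>R h" "\<lambda>s. s *\<^sub>R h" t UNIV g]
          smooth_real_has_derivative sm derivative_eq_intros) auto
    then have "DERIV (\<lambda>t. g (x + t *\<^sub>R h)) t :> frechet_derivative g (at (x + t *\<^sub>R h)) h" for t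
      unfolding has_field_derivative_def
      by (simp add: linear_cmul[OF lin] mult.commute[of _ "frechet_derivative g _ _"])
    then obtain t where t: "0 < t" "t < 1"
      "g (x + 1 *\<^sub>R h) - g (x + 0 *\<^sub>R h) = (1 - 0) * frechet_derivative g (at (x + t *\<^sub>R h)) h"
      using MVT2[of 0 1 "\<lambda>t. g (x + t *\<^sub>R h)" "\<lambda>t. frechet_derivative g (at (x + t *\<^sub>R h)) h"] by auto
    have "\<bar>g (x + h) - g x - frechet_derivative g (at x) h\<bar>
        = \<bar>\<Sum>b\<in>Basis. (h \<bullet> b) * (frechet_derivative g (at (x + t *\<^sub>R h)) b - frechet_derivative g (at x) b)\<bar>"
      using t(3) linear_Basis_expand[OF lin, of "x + t *\<^sub>R h" h] linear_Basis_expand[OF lin, of x h]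
      by (simp add: right_diff_distrib sum_subtractf)
    also have "\<dots> \<le> (\<Sum>b\<in>Basis. norm h * (L b * norm h))"
    proof (intro order.trans[OF sum_abs] sum_mono)
      fix b :: 'a assume b: "b \<in> Basis"
      have "\<bar>frechet_derivative g (at (x + t *\<^sub>R h)) b - frechet_derivative g (at x) b\<bar> \<le> L b * norm (t *\<^sub>R h)"
        using L(2)[of "x + t *\<^sub>R h" b x] by simp
      also have "\<dots> \<le> L b * norm h"
        using t L(1)[of b] by (intro mult_left_mono) (auto simp: mult_left_le_one_le)
      finally show "\<bar>(h \<bullet> b) * (frechet_derivative g (at (x + t *\<^sub>R h)) b - frechet_derivative g (at x) b)\<bar>
          \<le> norm h * (L b * norm h)"
        unfolding abs_mult using b by (intro mult_mono Basis_le_norm) auto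
    qed
    also have "\<dots> = C * (norm h)\<^sup>2"
      by (simp add: C_def sum_distrib_left sum_distrib_right power2_eq_square algebra_simps)
    finally show ?thesis .
  qed
  then show ?thesis using that C by blast
qed

section \<open>A bump function\<close>

text \<open>The powers of \<open>inverse t\<close> make the family closed under differentiation up
  to linear combinations: the derivative of member \<open>k\<close> involves members
  \<open>k + 1\<close> and \<open>k + 2\<close>.\<close>

definition flat_exp :: "nat \<Rightarrow> real \<Rightarrow> real" where
  "flat_exp k t = (if t > 0 then inverse t ^ k * exp (- inverse t) else 0)"

text \<open>This is the limit of the difference quotient at 0. From the right, exp(1/t) outgrows
  every power of 1/t; from the left the quotient is 0.\<close>

lemma flat_exp_div_tendsto_0: "((\<lambda>t. flat_exp k t / t) \<longlongrightarrow> 0) (at 0)"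
proof -
  have "((\<lambda>t. inverse t ^ Suc k / exp (inverse t)) \<longlongrightarrow> (0::real)) (at_right 0)"
    using filterlim_compose[OF tendsto_power_div_exp_0 filterlim_inverse_at_top_right] .
  then have "((\<lambda>t. flat_exp k t / t) \<longlongrightarrow> 0) (at_right 0)"
    by (rule Lim_transform_eventually)
      (auto simp: eventually_at_filter flat_exp_def exp_minus field_simps)
  moreover have "((\<lambda>t. flat_exp k t / t) \<longlongrightarrow> 0) (at_left 0)"
    by (rule Lim_transform_eventually[OF tendsto_const])
      (auto simp: eventually_at_filter flat_exp_def)
  ultimately show ?thesis
    by (simp add: filterlim_at_split)
qed

lemma flat_exp_has_derivative:
  "(flat_exp k has_real_derivative (flat_exp (k + 2) t - real k * flat_exp (k + 1) t)) (at t)"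
proof -
  consider "t > 0" | "t < 0" | "t = 0" by linarith
  then show ?thesis
  proof cases
    case 1
    have *: "((\<lambda>t. inverse t ^ k * exp (- inverse t)) has_real_derivative
        (flat_exp (k + 2) t - real k * flat_exp (k + 1) t)) (at t)"
    proof -
      \<comment> \<open>The subtraction \<open>k - 1\<close> is truncated; for \<open>k = 0\<close>
        the factor \<open>real k\<close> makes both sides 0.\<close>
      have e: "real k * inverse t ^ (k - 1) * inverse t = real k * inverse t ^ k"
        by (cases k) auto
      have "((\<lambda>t. inverse t ^ k * exp (- inverse t)) has_real_derivative
          inverse t ^ k * (exp (- inverse t) * (inverse t * inverse t))
          + (real k * inverse t ^ (k - 1) * - (inverse t * inverse t)) * exp (- inverse t)) (at t)"
        using 1 by (auto intro!: derivative_eq_intros simp: algebra_simps)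
      also have "inverse t ^ k * (exp (- inverse t) * (inverse t * inverse t))
          + (real k * inverse t ^ (k - 1) * - (inverse t * inverse t)) * exp (- inverse t)
          = exp (- inverse t) * (inverse t ^ k * (inverse t * inverse t)
            - (real k * inverse t ^ (k - 1) * inverse t) * inverse t)"
        by (simp add: algebra_simps)
      also have "\<dots> = flat_exp (k + 2) t - real k * flat_exp (k + 1) t"
        unfolding e using 1 by (simp add: flat_exp_def algebra_simps power2_eq_square)
      finally show ?thesis .
    qed
    show ?thesis
      by (rule has_field_derivative_transform_within_open[OF *, of "{0<..}"])
        (use 1 in \<open>auto simp: flat_exp_def\<close>)
  next
    case 2
    have "((\<lambda>t. 0) has_real_derivative (flat_exp (k + 2) t - real k * flat_exp (k + 1) t)) (at t)"
      using 2 by (simp add: flat_exp_def)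
    then show ?thesis
      by (rule has_field_derivative_transform_within_open[of _ _ _ "{..<0}"])
        (use 2 in \<open>auto simp: flat_exp_def\<close>)
  next
    case 3
    then show ?thesis
      using flat_exp_div_tendsto_0[of k] by (simp add: DERIV_def flat_exp_def)
  qed
qed

text \<open>The factor \<open>exp 1\<close> normalises the value at the origin to 1. Dependence on
  \<open>x \<bullet> x\<close> alone makes the function even, so that it can serve both as the
  cutoff and, rescaled and normalised, as the mollifying kernel.\<close>

definition bump :: "'a::euclidean_space \<Rightarrow> real" where
  "bump x = exp 1 * flat_exp 0 (1 - x \<bullet> x)"

lemma flat_exp_sphere_has_derivative:
  "((\<lambda>x::'a::euclidean_space. flat_exp k (1 - x \<bullet> x)) has_derivative
     (\<lambda>e. (flat_exp (k + 2) (1 - x \<bullet> x) - real k * flat_exp (k + 1) (1 - x \<bullet> x)) * (- 2 * (x \<bullet> e)))) (at x)"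
proof -
  have "((\<lambda>x::'a. 1 - x \<bullet> x) has_derivative (\<lambda>e. - 2 * (x \<bullet> e))) (at x)"
    by (auto intro!: derivative_eq_intros simp: inner_commute)
  then show ?thesis
    using flat_exp_has_derivative[of k "1 - x \<bullet> x", unfolded has_field_derivative_def]
    by (rule has_derivative_compose)
qed

lemma smooth_real_bump: "smooth_real (bump :: 'a::euclidean_space \<Rightarrow> real)"
proof -
  \<comment> \<open>All derivatives of the bump are polynomials in the flat functions and linear
    functionals. Constants must be listed too, since \<open>gen_alg\<close> has no scalar
    multiplication of its own.\<close>
  define G :: "('a \<Rightarrow> real) set" where
    "G = range (\<lambda>k x. flat_exp k (1 - x \<bullet> x)) \<union> range (\<lambda>v x. x \<bullet> v) \<union> range (\<lambda>c x. c)"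
  have gen: "(\<lambda>x. flat_exp k (1 - x \<bullet> x)) \<in> gen_alg G" "(\<lambda>x. x \<bullet> v) \<in> gen_alg G"
    "(\<lambda>x. c) \<in> gen_alg G" for k v c
    by (auto simp: G_def intro!: gen_alg.gen)
  have d1: "frechet_derivative (\<lambda>x::'a. flat_exp k (1 - x \<bullet> x)) (at x) e =
     (flat_exp (k + 2) (1 - x \<bullet> x) + (- real k) * flat_exp (k + 1) (1 - x \<bullet> x)) * ((- 2) * (x \<bullet> e))" for k x e
    using frechet_derivative_at[OF flat_exp_sphere_has_derivative[of k x], symmetric] by simp
  have d2: "frechet_derivative (\<lambda>x::'a. x \<bullet> v) (at x) e = e \<bullet> v" for v x e
    by (subst frechet_derivative_at[of "\<lambda>x. x \<bullet> v" "\<lambda>x. x \<bullet> v", symmetric]) (auto intro!: derivative_eq_intros)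
  have "smooth_real (\<lambda>x::'a. exp 1 * flat_exp 0 (1 - x \<bullet> x))"
  proof (rule smooth_real_gen_alg[of _ G])
    show "(\<lambda>x. exp 1 * flat_exp 0 (1 - x \<bullet> x)) \<in> gen_alg G"
      by (intro gen_alg.mult gen)
  next
    fix g x assume "g \<in> G"
    then show "g differentiable at x"
      using differentiableI[OF flat_exp_sphere_has_derivative] by (auto simp: G_def)
  next
    fix g e assume "g \<in> G"
    then consider k where "g = (\<lambda>x. flat_exp k (1 - x \<bullet> x))" | v where "g = (\<lambda>x. x \<bullet> v)" | c where "g = (\<lambda>x. c)"
      by (auto simp: G_def)
    then show "(\<lambda>x. frechet_derivative g (at x) e) \<in> gen_alg G"
    proof cases
      case (1 k)
      show ?thesis unfolding 1 d1 by (intro gen_alg.add gen_alg.mult gen)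
    next
      case (2 v)
      show ?thesis unfolding 2 d2 by (rule gen)
    next
      case (3 c)
      show ?thesis unfolding 3 by (simp add: gen)
    qed
  qed
  then show ?thesis unfolding bump_def[abs_def] .
qed

lemma bump_0: "bump 0 = 1"
  by (simp add: bump_def flat_exp_def flip: exp_add)

lemma bump_nonneg: "bump x \<ge> 0"
  by (simp add: bump_def flat_exp_def)

lemma bump_le_1: "bump x \<le> 1"
proof -
  have "exp 1 * exp (- inverse (1 - x \<bullet> x)) \<le> 1" if "1 - x \<bullet> x > 0"
  proof -
    have "1 - x \<bullet> x \<le> 1" by simp
    then have "1 \<le> inverse (1 - x \<bullet> x)" using that by (simp add: one_le_inverse)
    then show ?thesis by (simp flip: exp_add)
  qed
  then show ?thesis
    by (simp add: bump_def flat_exp_def)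
qed

lemma bump_minus: "bump (- x) = bump x"
  by (simp add: bump_def)

lemma bump_eq_0: "norm x \<ge> 1 \<Longrightarrow> bump x = 0"
  using one_le_power[of "norm x" 2] by (simp add: bump_def flat_exp_def dot_square_norm not_less)

lemma Cc_inf_bump_scale:
  assumes "c > 0"
  shows "(\<lambda>x::'a::euclidean_space. a * bump (c *\<^sub>R x)) \<in> Cc_inf"
proof -
  have "norm x \<le> 1 / c" if "a * bump (c *\<^sub>R x) \<noteq> 0" for x :: 'a
    using bump_eq_0[of "c *\<^sub>R x"] that assms by (force simp: field_simps)
  then have "compact_support (\<lambda>x::'a. a * bump (c *\<^sub>R x))"
    unfolding compact_support_iff using assms by (intro exI[of _ "1 / c"]) auto
  then show ?thesis
    by (simp add: Cc_inf_def smooth_real_scale smooth_real_bump)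
qed

section \<open>Affine changes of variables\<close>

lemma nn_integral_lborel_affine:
  fixes f :: "'a::euclidean_space \<Rightarrow> ennreal"
  assumes [measurable]: "f \<in> borel_measurable borel" and c: "c \<noteq> 0"
  shows "(\<integral>\<^sup>+x. f x \<partial>lborel) = ennreal (\<bar>c\<bar> ^ DIM('a)) * (\<integral>\<^sup>+x. f (t + c *\<^sub>R x) \<partial>lborel)"
  by (subst lborel_affine[OF c, of t]) (simp add: nn_integral_density nn_integral_distr nn_integral_cmult)

lemma integrable_lborel_affine:
  fixes f :: "'a::euclidean_space \<Rightarrow> 'b::{banach, second_countable_topology}"
  assumes f: "integrable lborel f" and c: "c \<noteq> 0"
  shows "integrable lborel (\<lambda>x. f (t + c *\<^sub>R x))"
proof -
  have [measurable]: "f \<in> borel_measurable borel"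
    using borel_measurable_integrable[OF f] by simp
  have "ennreal (\<bar>c\<bar> ^ DIM('a)) * (\<integral>\<^sup>+x. norm (f (t + c *\<^sub>R x)) \<partial>lborel) < \<infinity>"
    using f unfolding integrable_iff_bounded
    by (subst (asm) nn_integral_lborel_affine[OF _ c, of _ t]) auto
  then show ?thesis
    using c by (auto simp: integrable_iff_bounded ennreal_mult_less_top)
qed

lemma integral_lborel_affine:
  fixes f :: "'a::euclidean_space \<Rightarrow> 'b::{banach, second_countable_topology}"
  assumes [measurable]: "f \<in> borel_measurable borel" and c: "c \<noteq> 0"
  shows "(LINT x|lborel. f x) = \<bar>c\<bar> ^ DIM('a) *\<^sub>R (LINT x|lborel. f (t + c *\<^sub>R x))"
  by (subst lborel_affine[OF c, of t]) (simp add: integral_density integral_distr)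

lemma integral_lborel_translate:
  fixes f :: "'a::euclidean_space \<Rightarrow> 'b::{banach, second_countable_topology}"
  assumes "f \<in> borel_measurable borel"
  shows "(LINT x|lborel. f (t + x)) = (LINT x|lborel. f x)"
  using integral_lborel_affine[OF assms, of 1 t] by simp

lemma integral_lborel_reflect:
  fixes f :: "'a::euclidean_space \<Rightarrow> 'b::{banach, second_countable_topology}"
  assumes "f \<in> borel_measurable borel"
  shows "(LINT x|lborel. f (t - x)) = (LINT x|lborel. f x)"
  using integral_lborel_affine[OF assms, of "-1" t] by simp

lemma integrable_lborel_translate:
  fixes f :: "'a::euclidean_space \<Rightarrow> 'b::{banach, second_countable_topology}"
  shows "integrable lborel f \<Longrightarrow> integrable lborel (\<lambda>x. f (t + x))"
  using integrable_lborel_affine[of f 1 t] by simp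

lemma integrable_lborel_reflect:
  fixes f :: "'a::euclidean_space \<Rightarrow> 'b::{banach, second_countable_topology}"
  shows "integrable lborel f \<Longrightarrow> integrable lborel (\<lambda>x. f (t - x))"
  using integrable_lborel_affine[of f "-1" t] by simp

lemma nn_integral_lborel_translate:
  fixes f :: "'a::euclidean_space \<Rightarrow> ennreal"
  assumes "f \<in> borel_measurable borel"
  shows "(\<integral>\<^sup>+x. f (t + x) \<partial>lborel) = (\<integral>\<^sup>+x. f x \<partial>lborel)"
  using nn_integral_lborel_affine[OF assms, of 1 t] by simp

section \<open>The fractional kernel\<close>

text \<open>Up to a constant, this majorises |\<phi>(x+h) - \<phi>(x)| / |h|^(n+\<alpha>) for every
  bounded Lipschitz \<phi>: the increment is at most a multiple of |h| for small \<open>h\<close>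
  and of 1 for large \<open>h\<close>.\<close>

definition frac_ker :: "real \<Rightarrow> 'a::euclidean_space \<Rightarrow> real" where
  "frac_ker \<alpha> h = min 1 (norm h) / norm h powr (real DIM('a) + \<alpha>)"

lemma frac_ker_nonneg: "frac_ker \<alpha> h \<ge> 0"
  by (simp add: frac_ker_def)

lemma borel_measurable_frac_ker [measurable]: "frac_ker \<alpha> \<in> borel_measurable borel"
  unfolding frac_ker_def by measurable

lemma sets_borel_cball [measurable]: "cball x r \<in> sets borel"
  by (rule borel_closed) simp

lemma ex_dyadic_interval:
  fixes r :: real
  assumes "r \<ge> 1"
  obtains k :: nat where "2 ^ k \<le> r" "r < 2 ^ (k + 1)"
proof -
  define k where "k = nat \<lfloor>log 2 r\<rfloor>"
  have "0 \<le> log 2 r" using assms by simp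
  then have k: "real k \<le> log 2 r" "log 2 r < real k + 1"
    unfolding k_def by linarith+
  have "2 powr real k \<le> r" using k assms by (simp add: le_log_iff)
  moreover have "r < 2 powr (real (k + 1))" using k assms by (simp add: log_less_iff add.commute)
  ultimately show ?thesis
    using that[of k] by (simp only: powr_realpow)
qed

lemma ennreal_le_suminf: "f k \<le> (\<Sum>k. f k :: ennreal)"
  using sum_le_suminf[of f "{k}"] by (simp add: summableI)

text \<open>The sum integrates termwise and the volume of a ball is proportional to the n-th power
  of its radius. Dominating a radial function by such a step function takes the place of polar
  coordinates.\<close>

lemma nn_integral_dyadic_sum_finite:
  fixes a :: "nat \<Rightarrow> real" and r :: "nat \<Rightarrow> real"
  assumes a: "\<And>k. a k \<ge> 0" and r: "\<And>k. r k \<ge> 0"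
    and s: "summable (\<lambda>k. a k * r k ^ DIM('a::euclidean_space))"
  shows "(\<integral>\<^sup>+h. (\<Sum>k. ennreal (a k) * indicator (cball (0::'a) (r k)) h) \<partial>lborel) < \<infinity>"
proof -
  have "(\<integral>\<^sup>+h. (\<Sum>k. ennreal (a k) * indicator (cball (0::'a) (r k)) h) \<partial>lborel)
      = (\<Sum>k. \<integral>\<^sup>+h. ennreal (a k) * indicator (cball (0::'a) (r k)) h \<partial>lborel)"
    by (intro nn_integral_suminf) measurable
  also have "\<dots> = (\<Sum>k. ennreal (unit_ball_vol DIM('a) * (a k * r k ^ DIM('a))))"
    by (intro suminf_cong)
      (simp add: nn_integral_cmult_indicator emeasure_cball r a mult_ac flip: ennreal_mult)
  also have "\<dots> = ennreal (\<Sum>k. unit_ball_vol DIM('a) * (a k * r k ^ DIM('a)))"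
    by (intro suminf_ennreal2 summable_mult s) (auto intro!: mult_nonneg_nonneg a zero_le_power r)
  finally show ?thesis by simp
qed

text \<open>The kernel is compared with its bounds on dyadic shells. The shells outside the unit
  ball contribute multiples of 2^(-\<alpha> k), those inside multiples of 2^((\<alpha>-1) k); the
  two geometric series converge because \<alpha> > 0 and \<alpha> < 1.\<close>

lemma integrable_frac_ker:
  assumes "0 < \<alpha>" "\<alpha> < 1"
  shows "integrable lborel (frac_ker \<alpha> :: 'a::euclidean_space \<Rightarrow> real)"
proof -
  define n where "n = real DIM('a)"
  have n: "n \<ge> 1" unfolding n_def by (simp add: Suc_leI)
  \<comment> \<open>On the shell 2^k <= |h| < 2^(k+1) the kernel is at most \<open>a1 k\<close>, and
    \<open>r1 k\<close> is the outer radius. On the shell 2^(-k-1) < |h| <= 2^(-k) the corresponding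
    numbers are \<open>a2 k\<close> and \<open>r2 k\<close>.\<close>
  define a1 r1 a2 r2 :: "nat \<Rightarrow> real" where
    "a1 = (\<lambda>k. (2 ^ k) powr - (n + \<alpha>))" and "r1 = (\<lambda>k. 2 ^ (k + 1))" and
    "a2 = (\<lambda>k. (2 ^ (k + 1)) powr (n + \<alpha> - 1))" and "r2 = (\<lambda>k. 1 / 2 ^ k)"
  have e1: "a1 k * r1 k ^ DIM('a) = 2 powr n * (2 powr - \<alpha>) ^ k" for k
  proof -
    have "a1 k * r1 k ^ DIM('a) = (2 powr k) powr - (n + \<alpha>) * (2 powr (k + 1)) powr n"
      unfolding n_def a1_def r1_def by (simp only: powr_realpow powr_gt_zero zero_less_power zero_less_numeral of_nat_1 flip: of_nat_Suc of_nat_add)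
    also have "\<dots> = 2 powr (n + (- \<alpha>) * k)"
      unfolding powr_powr powr_add[symmetric] by (simp add: algebra_simps)
    also have "\<dots> = 2 powr n * (2 powr - \<alpha>) powr k"
      by (simp only: powr_add powr_powr)
    finally show ?thesis by (simp add: powr_realpow)
  qed
  have e2: "a2 k * r2 k ^ DIM('a) = 2 powr (n + \<alpha> - 1) * (2 powr (\<alpha> - 1)) ^ k" for k
  proof -
    have "a2 k * r2 k ^ DIM('a) = (2 powr (k + 1)) powr (n + \<alpha> - 1) * (2 powr - real k) powr n"
      unfolding n_def a2_def r2_def by (simp only: powr_realpow powr_minus divide_inverse mult_1 powr_gt_zero zero_less_power positive_imp_inverse_positive zero_less_numeral of_nat_1 flip: of_nat_Suc of_nat_add)
    also have "\<dots> = 2 powr ((n + \<alpha> - 1) + (\<alpha> - 1) * k)"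
      unfolding powr_powr powr_add[symmetric] by (simp add: algebra_simps)
    also have "\<dots> = 2 powr (n + \<alpha> - 1) * (2 powr (\<alpha> - 1)) powr k"
      by (simp only: powr_add powr_powr)
    finally show ?thesis by (simp add: powr_realpow)
  qed
  have nonneg: "a1 k \<ge> 0" "r1 k \<ge> 0" "a2 k \<ge> 0" "r2 k \<ge> 0" for k
    by (simp_all add: a1_def r1_def a2_def r2_def)
  have s1: "summable (\<lambda>k. a1 k * r1 k ^ DIM('a))"
    unfolding e1 using assms by (intro summable_mult summable_geometric) (simp add: powr_less_one)
  have s2: "summable (\<lambda>k. a2 k * r2 k ^ DIM('a))"
    unfolding e2 using assms by (intro summable_mult summable_geometric) (simp add: powr_less_one)
  define S1 S2 :: "'a \<Rightarrow> ennreal" where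
    "S1 h = (\<Sum>k. ennreal (a1 k) * indicator (cball (0::'a) (r1 k)) h)" and
    "S2 h = (\<Sum>k. ennreal (a2 k) * indicator (cball (0::'a) (r2 k)) h)" for h
  have le1: "ennreal (a1 k) * indicator (cball (0::'a) (r1 k)) h \<le> S1 h" for k h
    unfolding S1_def by (rule ennreal_le_suminf)
  have le2: "ennreal (a2 k) * indicator (cball (0::'a) (r2 k)) h \<le> S2 h" for k h
    unfolding S2_def by (rule ennreal_le_suminf)
  have bound: "ennreal (frac_ker \<alpha> h) \<le> S1 h + S2 h" for h :: 'a
  proof -
    consider "h = 0" | "norm h \<ge> 1" | "h \<noteq> 0" "norm h < 1" by fastforce
    then show ?thesis
    proof cases
      case 1
      then show ?thesis by (simp add: frac_ker_def)
    next
      case 2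
      then obtain k :: nat where k: "2 ^ k \<le> norm h" "norm h < 2 ^ (k + 1)"
        by (rule ex_dyadic_interval)
      have "frac_ker \<alpha> h = norm h powr - (n + \<alpha>)"
        using 2 by (simp add: frac_ker_def n_def powr_minus_divide del: minus_add_distrib)
      also have "\<dots> \<le> a1 k"
        unfolding a1_def using k n assms by (intro powr_mono2') auto
      finally have "ennreal (frac_ker \<alpha> h) \<le> ennreal (a1 k) * indicator (cball (0::'a) (r1 k)) h"
        using k by (simp add: r1_def ennreal_leI)
      also have "\<dots> \<le> S1 h + S2 h"
        using le1[of k h] by (metis add_increasing2 zero_le)
      finally show ?thesis .
    next
      case 3
      then have "1 / norm h \<ge> 1" by simp
      then obtain k :: nat where k: "2 ^ k \<le> 1 / norm h" "1 / norm h < 2 ^ (k + 1)"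
        by (rule ex_dyadic_interval)
      have pos: "norm h > 0" using 3 by simp
      have "frac_ker \<alpha> h = norm h powr (1 - (n + \<alpha>))"
        using 3 by (simp add: frac_ker_def n_def powr_diff)
      also have "\<dots> = (1 / norm h) powr (n + \<alpha> - 1)"
        using pos by (simp add: powr_divide powr_minus_divide[symmetric])
      \<comment> \<open>Since n >= 1, the exponent \<open>n + \<alpha> - 1\<close> is positive, so
        the upper bound for \<open>1 / norm h\<close> gives the larger power.\<close>
      also have "\<dots> \<le> a2 k"
        unfolding a2_def using k n assms pos by (intro powr_mono2) auto
      finally have "frac_ker \<alpha> h \<le> a2 k" .
      moreover have "norm h \<le> r2 k"
        using k(1) pos by (simp add: r2_def field_simps)
      ultimately have "ennreal (frac_ker \<alpha> h) \<le> ennreal (a2 k) * indicator (cball (0::'a) (r2 k)) h"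
        by (simp add: ennreal_leI)
      also have "\<dots> \<le> S1 h + S2 h"
        using le2[of k h] by (metis add_increasing zero_le)
      finally show ?thesis .
    qed
  qed
  have [measurable]: "S1 \<in> borel_measurable borel" "S2 \<in> borel_measurable borel"
    unfolding S1_def S2_def by measurable
  have "(\<integral>\<^sup>+h. ennreal (norm (frac_ker \<alpha> (h::'a))) \<partial>lborel) \<le> (\<integral>\<^sup>+h. S1 h + S2 h \<partial>lborel)"
    using bound by (intro nn_integral_mono) (simp add: frac_ker_nonneg)
  also have "\<dots> = (\<integral>\<^sup>+h. S1 h \<partial>lborel) + (\<integral>\<^sup>+h. S2 h \<partial>lborel)"
    by (intro nn_integral_add) auto
  also have "\<dots> < \<infinity>"
    using nn_integral_dyadic_sum_finite[OF nonneg(1,2) s1] nn_integral_dyadic_sum_finite[OF nonneg(3,4) s2]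
    by (simp add: S1_def S2_def)
  finally show ?thesis
    by (intro integrableI_bounded) auto
qed

section \<open>Compactly supported Lipschitz functions\<close>

text \<open>A common home for cutoffs and vector fields, hence the general codomain. This regularity
  already makes all fractional integrals below absolutely convergent.\<close>

definition lip_cs :: "('a::euclidean_space \<Rightarrow> 'b::euclidean_space) \<Rightarrow> bool" where
  "lip_cs \<phi> \<longleftrightarrow> compact_support \<phi> \<and> (\<exists>L. \<forall>x y. norm (\<phi> x - \<phi> y) \<le> L * norm (x - y))"

lemma lip_cs_continuous: "lip_cs \<phi> \<Longrightarrow> continuous_on UNIV \<phi>"
proof -
  assume "lip_cs \<phi>"
  then obtain L where L: "\<And>x y. norm (\<phi> x - \<phi> y) \<le> L * norm (x - y)"
    unfolding lip_cs_def by blast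
  \<comment> \<open>The constant in \<open>lip_cs\<close> may be negative, which
    \<open>lipschitz_on\<close> forbids.\<close>
  have "\<bar>L\<bar>-lipschitz_on UNIV \<phi>"
  proof (rule lipschitz_onI)
    show "dist (\<phi> x) (\<phi> y) \<le> \<bar>L\<bar> * dist x y" for x y
      using L[of x y] abs_ge_self[of L] mult_right_mono[of L "\<bar>L\<bar>" "norm (x - y)"] by (simp add: dist_norm)
  qed simp
  then show ?thesis by (rule lipschitz_on_continuous_on)
qed

lemma lip_cs_measurable: "lip_cs \<phi> \<Longrightarrow> \<phi> \<in> borel_measurable borel"
  by (intro borel_measurable_continuous_onI lip_cs_continuous)

lemma lip_cs_bounded:
  assumes "lip_cs \<phi>"
  obtains M where "M > 0" "\<And>x. norm (\<phi> x) \<le> M"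
  using assms compact_support_bounded_range lip_cs_continuous lip_cs_def by metis

text \<open>The increment vanishes unless \<open>x\<close> or \<open>x + h\<close> lies in the
  support. The two indicators record this and later give integrability in \<open>x\<close>, while
  \<open>min 1 (norm h)\<close> gives integrability in \<open>h\<close>.\<close>

lemma lip_cs_increment_bound:
  assumes "lip_cs \<phi>"
  obtains C R where "C > 0" "\<And>x h. norm (\<phi> (x + h) - \<phi> x) \<le>
    C * min 1 (norm h) * (indicator (cball 0 R) (x + h) + indicator (cball 0 R) x)"
proof -
  obtain L where L: "\<And>x y. norm (\<phi> x - \<phi> y) \<le> L * norm (x - y)"
    using assms unfolding lip_cs_def by blast
  obtain M where M: "M > 0" "\<And>x. norm (\<phi> x) \<le> M"
    by (rule lip_cs_bounded[OF assms]) blast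
  obtain R where R: "R > 0" "\<And>x. \<phi> x \<noteq> 0 \<Longrightarrow> norm x \<le> R"
    using assms unfolding lip_cs_def compact_support_iff by blast
  \<comment> \<open>\<open>\<bar>L\<bar>\<close> serves for short increments, \<open>2 * M\<close>
    for long ones.\<close>
  define C where "C = max \<bar>L\<bar> (2 * M)"
  have C: "C > 0" using M by (simp add: C_def)
  have "norm (\<phi> (x + h) - \<phi> x) \<le> C * min 1 (norm h) * (indicator (cball 0 R) (x + h) + indicator (cball 0 R) x)" for x h
  proof -
    have "norm (\<phi> (x + h) - \<phi> x) \<le> L * norm h"
      using L[of "x + h" x] by simp
    also have "\<dots> \<le> C * norm h"
      by (intro mult_right_mono) (auto simp: C_def)
    finally have 1: "norm (\<phi> (x + h) - \<phi> x) \<le> C * norm h" .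
    have "norm (\<phi> (x + h) - \<phi> x) \<le> M + M"
      using norm_triangle_ineq4[of "\<phi> (x + h)" "\<phi> x"] M(2)[of x] M(2)[of "x + h"] by linarith
    also have "\<dots> \<le> C" by (simp add: C_def)
    finally have 2: "norm (\<phi> (x + h) - \<phi> x) \<le> C * min 1 (norm h)"
      using 1 by (simp add: min_def)
    show ?thesis
    proof (cases "norm (x + h) \<le> R \<or> norm x \<le> R")
      case True
      then have "1 \<le> indicator (cball 0 R) (x + h) + (indicator (cball 0 R) x :: real)"
        by (auto simp: indicator_def)
      then have "C * min 1 (norm h) * 1 \<le> C * min 1 (norm h) * (indicator (cball 0 R) (x + h) + indicator (cball 0 R) x)"
        using C by (intro mult_left_mono) auto
      then show ?thesis using 2 by linarith
    next
      case False
      then have "\<phi> (x + h) = 0" "\<phi> x = 0" using R(2) by blast+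
      then show ?thesis using C by simp
    qed
  qed
  then show ?thesis using that C by blast
qed

text \<open>For a scalar cutoff this is the function D of the overview. For a vector field it
  dominates the fractional divergence pointwise, up to the normalising constant.\<close>

definition frac_abs :: "real \<Rightarrow> ('a::euclidean_space \<Rightarrow> 'b::euclidean_space) \<Rightarrow> 'a \<Rightarrow> real" where
  "frac_abs \<alpha> \<phi> x = (LINT h|lborel. norm (\<phi> (x + h) - \<phi> x) / norm h powr (real DIM('a) + \<alpha>))"

lemma frac_abs_nonneg: "frac_abs \<alpha> \<phi> x \<ge> 0"
  unfolding frac_abs_def by (intro Bochner_Integration.integral_nonneg) auto

section \<open>Boundedness, integrability and homogeneity of the absolute fractional
  integral\<close>

context
  fixes \<alpha> :: real and \<phi> :: "'a::euclidean_space \<Rightarrow> 'b::euclidean_space"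
  assumes \<alpha>: "0 < \<alpha>" "\<alpha> < 1" and \<phi>: "lip_cs \<phi>"
begin

text \<open>Both indicators of the increment bound are estimated by 1, which doubles the constant
  and makes the bound uniform in \<open>x\<close>.\<close>

lemma lip_cs_ker_bound:
  obtains C where "C > 0" "\<And>x h. norm (\<phi> (x + h) - \<phi> x) / norm h powr (real DIM('a) + \<alpha>) \<le> C * frac_ker \<alpha> h"
proof -
  obtain C R where C: "C > 0" "\<And>x h. norm (\<phi> (x + h) - \<phi> x) \<le>
    C * min 1 (norm h) * (indicator (cball 0 R) (x + h) + indicator (cball 0 R) x)"
    using lip_cs_increment_bound[OF \<phi>] by metis
  have "norm (\<phi> (x + h) - \<phi> x) / norm h powr (real DIM('a) + \<alpha>) \<le> (2 * C) * frac_ker \<alpha> h" for x h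
  proof -
    have "norm (\<phi> (x + h) - \<phi> x) \<le> C * min 1 (norm h) * 2"
      using C(1) by (intro order.trans[OF C(2)] mult_left_mono) (auto simp: indicator_def)
    then show ?thesis
      by (simp add: frac_ker_def divide_right_mono mult_ac)
  qed
  then show ?thesis using that[of "2 * C"] C(1) by simp
qed

lemma frac_abs_integrand_integrable:
  "integrable lborel (\<lambda>h. norm (\<phi> (x + h) - \<phi> x) / norm h powr (real DIM('a) + \<alpha>))"
proof -
  note [measurable] = lip_cs_measurable[OF \<phi>]
  obtain C where C: "C > 0" "\<And>x h. norm (\<phi> (x + h) - \<phi> x) / norm h powr (real DIM('a) + \<alpha>) \<le> C * frac_ker \<alpha> h"
    by (rule lip_cs_ker_bound) blast
  show ?thesis
    by (rule Bochner_Integration.integrable_bound[OF integrable_mult_right[OF integrable_frac_ker[OF \<alpha>], of C]])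
      (auto intro!: AE_I2 order.trans[OF C(2)])
qed

lemma frac_abs_bounded:
  obtains M where "M > 0" "\<And>x. frac_abs \<alpha> \<phi> x \<le> M"
proof -
  obtain C where C: "C > 0" "\<And>x h. norm (\<phi> (x + h) - \<phi> x) / norm h powr (real DIM('a) + \<alpha>) \<le> C * frac_ker \<alpha> h"
    by (rule lip_cs_ker_bound) blast
  define M where "M = C * (LINT h|lborel. frac_ker \<alpha> (h::'a))"
  have "frac_abs \<alpha> \<phi> x \<le> M" for x
    unfolding frac_abs_def M_def integral_mult_right_zero[symmetric]
    by (intro integral_mono frac_abs_integrand_integrable integrable_mult_right integrable_frac_ker \<alpha> C)
  then have "max M 1 > 0" "\<And>x. frac_abs \<alpha> \<phi> x \<le> max M 1"
    by (auto simp: le_max_iff_disj)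
  then show ?thesis using that by blast
qed

text \<open>By Tonelli the integral over \<open>x\<close> may be taken first. For each
  \<open>h\<close> the two indicators then contribute twice the volume of one ball, by translation
  invariance, and the kernel is left to be integrated in \<open>h\<close>.\<close>

lemma frac_abs_pair_integrable:
  "integrable (lborel \<Otimes>\<^sub>M lborel) (\<lambda>(x, h). norm (\<phi> (x + h) - \<phi> x) / norm h powr (real DIM('a) + \<alpha>))"
proof (rule integrableI_bounded)
  note [measurable] = lip_cs_measurable[OF \<phi>]
  show "(\<lambda>(x, h). norm (\<phi> (x + h) - \<phi> x) / norm h powr (real DIM('a) + \<alpha>)) \<in> borel_measurable (lborel \<Otimes>\<^sub>M lborel)"
    by measurable
  obtain C R where C: "C > 0" "\<And>x h. norm (\<phi> (x + h) - \<phi> x) \<le>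
    C * min 1 (norm h) * (indicator (cball 0 R) (x + h) + indicator (cball 0 R) x)"
    using lip_cs_increment_bound[OF \<phi>] by metis
  define V where "V = emeasure lborel (cball (0::'a) R)"
  have V: "V < \<infinity>" unfolding V_def using emeasure_bounded_finite[of "cball (0::'a) R"] by simp
  have bd: "ennreal (norm (norm (\<phi> (x + h) - \<phi> x) / norm h powr (real DIM('a) + \<alpha>)))
      \<le> ennreal (C * frac_ker \<alpha> h) * (indicator (cball 0 R) (h + x) + indicator (cball 0 R) x)" for x h
  proof -
    have "norm (norm (\<phi> (x + h) - \<phi> x) / norm h powr (real DIM('a) + \<alpha>))
        \<le> C * frac_ker \<alpha> h * (indicator (cball 0 R) (x + h) + indicator (cball 0 R) x)"
      using divide_right_mono[OF C(2)[of x h], of "norm h powr (real DIM('a) + \<alpha>)"]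
      by (simp add: frac_ker_def mult_ac)
    then have "ennreal (norm (norm (\<phi> (x + h) - \<phi> x) / norm h powr (real DIM('a) + \<alpha>)))
        \<le> ennreal (C * frac_ker \<alpha> h * (indicator (cball 0 R) (x + h) + indicator (cball 0 R) x))"
      by (rule ennreal_leI)
    also have "\<dots> = ennreal (C * frac_ker \<alpha> h) * (indicator (cball 0 R) (h + x) + indicator (cball 0 R) x)"
      using C(1) frac_ker_nonneg[of \<alpha> h]
      by (subst ennreal_mult) (auto simp: add.commute[of x h] ennreal_plus ennreal_indicator simp del: mem_cball)
    finally show ?thesis .
  qed
  have "(\<integral>\<^sup>+p. ennreal (norm (case p of (x, h) \<Rightarrow> norm (\<phi> (x + h) - \<phi> x) / norm h powr (real DIM('a) + \<alpha>))) \<partial>(lborel \<Otimes>\<^sub>M lborel))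
     = (\<integral>\<^sup>+h. \<integral>\<^sup>+x. ennreal (norm (norm (\<phi> (x + h) - \<phi> x) / norm h powr (real DIM('a) + \<alpha>))) \<partial>lborel \<partial>lborel)"
    by (subst lborel_pair.nn_integral_snd[symmetric]) (auto simp: case_prod_beta)
  also have "\<dots> \<le> (\<integral>\<^sup>+h. \<integral>\<^sup>+x. ennreal (C * frac_ker \<alpha> (h::'a)) * (indicator (cball 0 R) (h + x) + indicator (cball 0 R) x) \<partial>lborel \<partial>lborel)"
    by (intro nn_integral_mono bd)
  also have "\<dots> = (\<integral>\<^sup>+h. ennreal (C * frac_ker \<alpha> (h::'a)) * (V + V) \<partial>lborel)"
  proof (intro nn_integral_cong)
    fix h :: 'a
    have "(\<integral>\<^sup>+x. ennreal (C * frac_ker \<alpha> h) * (indicator (cball 0 R) (h + x) + indicator (cball 0 R) x) \<partial>lborel)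
       = ennreal (C * frac_ker \<alpha> h) * (\<integral>\<^sup>+x. indicator (cball 0 R) (h + x) + indicator (cball 0 R) x \<partial>lborel)"
      by (intro nn_integral_cmult) measurable
    also have "(\<integral>\<^sup>+x. indicator (cball 0 R) (h + x) + indicator (cball 0 R) x \<partial>lborel)
       = (\<integral>\<^sup>+x. indicator (cball 0 R) (h + x) \<partial>lborel) + (\<integral>\<^sup>+x. indicator (cball (0::'a) R) x \<partial>lborel)"
      by (intro nn_integral_add) measurable
    also have "(\<integral>\<^sup>+x. indicator (cball 0 R) (h + x) \<partial>lborel) = (\<integral>\<^sup>+x. indicator (cball (0::'a) R) x \<partial>lborel)"
      by (intro nn_integral_lborel_translate) measurable
    finally show "(\<integral>\<^sup>+x. ennreal (C * frac_ker \<alpha> h) * (indicator (cball 0 R) (h + x) + indicator (cball 0 R) x) \<partial>lborel)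
       = ennreal (C * frac_ker \<alpha> h) * (V + V)"
      by (simp add: V_def)
  qed
  also have "\<dots> = (\<integral>\<^sup>+h. ennreal (norm (C * frac_ker \<alpha> (h::'a))) \<partial>lborel) * (V + V)"
    using C(1) by (subst nn_integral_multc) (auto simp: frac_ker_nonneg)
  also have "\<dots> < \<infinity>"
  proof -
    have "(\<integral>\<^sup>+h. ennreal (norm (C * frac_ker \<alpha> (h::'a))) \<partial>lborel) < \<infinity>"
      using integrable_mult_right[OF integrable_frac_ker[OF \<alpha>, where 'a = 'a], of C]
      unfolding integrable_iff_bounded by blast
    then show ?thesis
      using V by (auto simp: ennreal_mult_less_top)
  qed
  finally show "(\<integral>\<^sup>+p. ennreal (norm (case p of (x, h) \<Rightarrow> norm (\<phi> (x + h) - \<phi> x) / norm h powr (real DIM('a) + \<alpha>))) \<partial>(lborel \<Otimes>\<^sub>M lborel)) < \<infinity>" .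
qed

lemma frac_abs_integrable: "integrable lborel (frac_abs \<alpha> \<phi>)"
  unfolding frac_abs_def[abs_def]
  by (rule lborel_pair.integrable_fst[OF frac_abs_pair_integrable])

text \<open>Substituting \<open>c *\<^sub>R h\<close> for the increment produces the Jacobian c^n,
  which cancels against n of the n + \<alpha> powers of \<open>c\<close> in the denominator.\<close>

lemma frac_abs_scale:
  assumes c: "c > 0"
  shows "frac_abs \<alpha> (\<lambda>x. \<phi> (c *\<^sub>R x)) x = c powr \<alpha> * frac_abs \<alpha> \<phi> (c *\<^sub>R x)"
proof -
  note [measurable] = lip_cs_measurable[OF \<phi>]
  let ?n = "real DIM('a)"
  have "frac_abs \<alpha> \<phi> (c *\<^sub>R x) = c ^ DIM('a) *
      (LINT h|lborel. norm (\<phi> (c *\<^sub>R x + c *\<^sub>R h) - \<phi> (c *\<^sub>R x)) / norm (c *\<^sub>R h) powr (?n + \<alpha>))"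
    unfolding frac_abs_def
    using c by (subst integral_lborel_affine[of _ c 0]) auto
  also have "\<dots> = c ^ DIM('a) * (LINT h|lborel. c powr - (?n + \<alpha>) *
      (norm (\<phi> (c *\<^sub>R (x + h)) - \<phi> (c *\<^sub>R x)) / norm h powr (?n + \<alpha>)))"
    using c by (simp add: powr_mult scaleR_add_right powr_minus_divide del: minus_add_distrib)
  also have "\<dots> = (c powr ?n * c powr - (?n + \<alpha>)) * frac_abs \<alpha> (\<lambda>x. \<phi> (c *\<^sub>R x)) x"
    using c by (simp only: frac_abs_def powr_realpow mult.assoc integral_mult_right_zero)
  also have "c powr ?n * c powr - (?n + \<alpha>) = c powr - \<alpha>"
    using c by (simp flip: powr_add)
  finally show ?thesis
    using c by (simp add: powr_minus)
qed

end

lemma Cc_inf_lip_cs: "g \<in> Cc_inf \<Longrightarrow> lip_cs g"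
  unfolding lip_cs_def real_norm_def by (rule Cc_inf_Lipschitz) (auto simp: Cc_inf_def)

lemma Cc_inf_vec_lip_cs:
  fixes \<phi> :: "real^'n \<Rightarrow> real^'n"
  assumes "\<phi> \<in> Cc_inf_vec"
  shows "lip_cs \<phi>"
proof -
  have cs: "compact_support \<phi>" using assms by (simp add: Cc_inf_vec_def)
  then have "compact_support (\<lambda>x. \<phi> x $ i)" for i
    unfolding compact_support_iff by (metis zero_index)
  then have "(\<lambda>x. \<phi> x $ i) \<in> Cc_inf" for i
    using assms by (simp add: Cc_inf_def Cc_inf_vec_def)
  then have "\<exists>L. \<forall>x y. \<bar>\<phi> x $ i - \<phi> y $ i\<bar> \<le> L * norm (x - y)" for i
    using Cc_inf_Lipschitz[of "\<lambda>x. \<phi> x $ i"] by metis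
  then obtain L where L: "\<And>i x y. \<bar>\<phi> x $ i - \<phi> y $ i\<bar> \<le> L i * norm (x - y)" by metis
  have "norm (\<phi> x - \<phi> y) \<le> (\<Sum>i\<in>UNIV. L i) * norm (x - y)" for x y
  proof -
    have "norm (\<phi> x - \<phi> y) \<le> (\<Sum>i\<in>UNIV. \<bar>(\<phi> x - \<phi> y) $ i\<bar>)" by (rule norm_le_l1_cart)
    also have "\<dots> \<le> (\<Sum>i\<in>UNIV. L i * norm (x - y))" using L by (intro sum_mono) simp
    finally show ?thesis by (simp add: sum_distrib_right)
  qed
  then show ?thesis unfolding lip_cs_def using cs by blast
qed

section \<open>The fractional divergence\<close>

text \<open>Cauchy-Schwarz cancels one power of |h|. At \<open>h = 0\<close> both sides are 0, since
  \<open>0 powr s = 0\<close> and division by 0 gives 0.\<close>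

lemma abs_inner_div_powr_le:
  fixes h v :: "'a::real_inner"
  shows "\<bar>h \<bullet> v\<bar> / norm h powr (s + 1) \<le> norm v / norm h powr s"
proof (cases "h = 0")
  case False
  have "\<bar>h \<bullet> v\<bar> / norm h powr (s + 1) \<le> (norm h * norm v) / norm h powr (s + 1)"
    by (intro divide_right_mono Cauchy_Schwarz_ineq2) simp
  also have "\<dots> = norm v / norm h powr s"
    using False by (simp add: powr_add)
  finally show ?thesis .
qed simp

text \<open>In the variable h = y - x the singularity no longer moves with \<open>x\<close>, and
  over the Borel measure the integrand is jointly measurable, as Fubini requires.\<close>

lemma frac_div_lborel:
  fixes \<phi> :: "real^'n \<Rightarrow> real^'n"
  assumes [measurable]: "\<phi> \<in> borel_measurable borel"
  shows "frac_div \<alpha> \<phi> x = mu_const CARD('n) \<alpha> *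
    (LINT h|lborel. (h \<bullet> (\<phi> (x + h) - \<phi> x)) / norm h powr (real CARD('n) + \<alpha> + 1))"
proof -
  let ?F = "\<lambda>y. ((y - x) \<bullet> (\<phi> y - \<phi> x)) / norm (y - x) powr (real CARD('n) + \<alpha> + 1)"
  have [measurable]: "?F \<in> borel_measurable borel" by measurable
  have "(LINT y|lebesgue. ?F y) = (LINT y|lborel. ?F y)"
    by (rule integral_completion) simp
  also have "\<dots> = (LINT h|lborel. ?F (x + h))"
    by (rule integral_lborel_translate[symmetric]) simp
  finally show ?thesis
    by (simp add: frac_div_def)
qed

context
  fixes \<alpha> :: real and \<phi> :: "real^'n \<Rightarrow> real^'n"
  assumes \<alpha>: "0 < \<alpha>" "\<alpha> < 1" and \<phi>: "lip_cs \<phi>"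
begin

lemma frac_div_integrand_integrable:
  "integrable lborel (\<lambda>h. (h \<bullet> (\<phi> (x + h) - \<phi> x)) / norm h powr (real CARD('n) + \<alpha> + 1))"
proof -
  note [measurable] = lip_cs_measurable[OF \<phi>]
  show ?thesis
    using frac_abs_integrand_integrable[OF \<alpha> \<phi>, of x]
    by (rule Bochner_Integration.integrable_bound)
      (use abs_inner_div_powr_le[of _ _ "real CARD('n) + \<alpha>"] in auto)
qed

text \<open>This transfers boundedness and integrability from \<open>frac_abs\<close> to the
  divergence.\<close>

lemma abs_frac_div_le: "\<bar>frac_div \<alpha> \<phi> x\<bar> \<le> \<bar>mu_const CARD('n) \<alpha>\<bar> * frac_abs \<alpha> \<phi> x"
proof -
  have "\<bar>LINT h|lborel. (h \<bullet> (\<phi> (x + h) - \<phi> x)) / norm h powr (real CARD('n) + \<alpha> + 1)\<bar>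
      \<le> (LINT h|lborel. \<bar>(h \<bullet> (\<phi> (x + h) - \<phi> x)) / norm h powr (real CARD('n) + \<alpha> + 1)\<bar>)"
    by (rule integral_abs_bound)
  also have "\<dots> \<le> frac_abs \<alpha> \<phi> x"
    unfolding frac_abs_def
    using frac_abs_integrand_integrable[OF \<alpha> \<phi>, of x] frac_div_integrand_integrable[of x]
    by (intro integral_mono integrable_abs)
      (use abs_inner_div_powr_le[of _ _ "real CARD('n) + \<alpha>"] in auto)
  finally show ?thesis
    by (simp add: frac_div_lborel[OF lip_cs_measurable[OF \<phi>]] abs_mult mult_left_mono)
qed

lemma frac_div_measurable: "frac_div \<alpha> \<phi> \<in> borel_measurable borel"
proof -
  note [measurable] = lip_cs_measurable[OF \<phi>]
  have "(\<lambda>x. LINT h|lborel. (h \<bullet> (\<phi> (x + h) - \<phi> x)) / norm h powr (real CARD('n) + \<alpha> + 1)) \<in> borel_measurable borel"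
    by (rule lborel.borel_measurable_lebesgue_integral) measurable
  then show ?thesis
    unfolding frac_div_lborel[OF lip_cs_measurable[OF \<phi>], abs_def] by measurable
qed

lemma frac_div_integrable: "integrable lborel (frac_div \<alpha> \<phi>)"
  by (rule Bochner_Integration.integrable_bound
      [OF integrable_mult_right[OF frac_abs_integrable[OF \<alpha> \<phi>], of "\<bar>mu_const CARD('n) \<alpha>\<bar>"]])
    (auto simp: frac_div_measurable frac_abs_nonneg abs_mult intro: abs_frac_div_le)

lemma frac_div_bounded:
  obtains M where "M > 0" "\<And>x. \<bar>frac_div \<alpha> \<phi> x\<bar> \<le> M"
proof -
  obtain M where M: "M > 0" "\<And>x. frac_abs \<alpha> \<phi> x \<le> M"
    by (rule frac_abs_bounded[OF \<alpha> \<phi>]) blast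
  have "\<bar>frac_div \<alpha> \<phi> x\<bar> \<le> \<bar>mu_const CARD('n) \<alpha>\<bar> * M + 1" for x
    using abs_frac_div_le[of x] mult_left_mono[OF M(2)[of x], of "\<bar>mu_const CARD('n) \<alpha>\<bar>"] by simp
  moreover have "\<bar>mu_const CARD('n) \<alpha>\<bar> * M + 1 > 0"
    using M(1) by (simp add: add_nonneg_pos)
  ultimately show ?thesis using that by blast
qed

end

lemma Cc_inf_vec_scaleR:
  assumes "\<eta> \<in> Cc_inf" "\<phi> \<in> Cc_inf_vec"
  shows "(\<lambda>x. \<eta> x *\<^sub>R \<phi> x) \<in> Cc_inf_vec"
proof -
  have "compact_support (\<lambda>x. \<eta> x *\<^sub>R \<phi> x)"
    using assms unfolding Cc_inf_def compact_support_iff by auto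
  then show ?thesis
    using assms by (simp add: Cc_inf_vec_def Cc_inf_def smooth_real_mult)
qed

text \<open>Since \<open>\<eta>(x) (\<phi>(y) - \<phi>(x)) = (\<eta>\<phi>)(y) - (\<eta>\<phi>)(x) - (\<eta>(y) - \<eta>(x)) \<phi>(y)\<close>, one remainder term
  is enough in the Leibniz rule.\<close>

lemma frac_div_Leibniz:
  fixes \<phi> :: "real^'n \<Rightarrow> real^'n"
  assumes \<alpha>: "0 < \<alpha>" "\<alpha> < 1" and \<eta>: "\<eta> \<in> Cc_inf" and \<phi>: "\<phi> \<in> Cc_inf_vec" "\<And>x. norm (\<phi> x) \<le> 1"
  shows "\<bar>\<eta> x * frac_div \<alpha> \<phi> x - frac_div \<alpha> (\<lambda>x. \<eta> x *\<^sub>R \<phi> x) x\<bar>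
    \<le> \<bar>mu_const CARD('n) \<alpha>\<bar> * frac_abs \<alpha> \<eta> x"
proof -
  note l\<phi> = Cc_inf_vec_lip_cs[OF \<phi>(1)] and l\<eta> = Cc_inf_lip_cs[OF \<eta>]
  note l\<eta>\<phi> = Cc_inf_vec_lip_cs[OF Cc_inf_vec_scaleR[OF \<eta> \<phi>(1)]]
  let ?s = "real CARD('n) + \<alpha>" and ?\<mu> = "mu_const CARD('n) \<alpha>"
  let ?A = "\<lambda>h. (h \<bullet> (\<phi> (x + h) - \<phi> x)) / norm h powr (?s + 1)"
  let ?B = "\<lambda>h. (h \<bullet> (\<eta> (x + h) *\<^sub>R \<phi> (x + h) - \<eta> x *\<^sub>R \<phi> x)) / norm h powr (?s + 1)"
  have A: "integrable lborel ?A" and B: "integrable lborel ?B"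
    using frac_div_integrand_integrable[OF \<alpha> l\<phi>, of x] frac_div_integrand_integrable[OF \<alpha> l\<eta>\<phi>, of x]
    by simp_all
  have "\<eta> x * frac_div \<alpha> \<phi> x - frac_div \<alpha> (\<lambda>x. \<eta> x *\<^sub>R \<phi> x) x
      = ?\<mu> * (LINT h|lborel. \<eta> x * ?A h - ?B h)"
    unfolding frac_div_lborel[OF lip_cs_measurable[OF l\<phi>]] frac_div_lborel[OF lip_cs_measurable[OF l\<eta>\<phi>]]
    by (subst Bochner_Integration.integral_diff[OF integrable_mult_right[OF A] B])
      (simp only: integral_mult_right_zero right_diff_distrib mult.left_commute)
  moreover have "\<bar>LINT h|lborel. \<eta> x * ?A h - ?B h\<bar> \<le> frac_abs \<alpha> \<eta> x"
  proof -
    have "\<bar>\<eta> x * ?A h - ?B h\<bar> \<le> norm (\<eta> (x + h) - \<eta> x) / norm h powr (real DIM(real^'n) + \<alpha>)" for h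
    proof -
      have "\<eta> x * ?A h - ?B h = (h \<bullet> ((\<eta> x - \<eta> (x + h)) *\<^sub>R \<phi> (x + h))) / norm h powr (?s + 1)"
        by (simp add: inner_diff_right algebra_simps flip: diff_divide_distrib)
      then have "\<bar>\<eta> x * ?A h - ?B h\<bar> \<le> norm ((\<eta> x - \<eta> (x + h)) *\<^sub>R \<phi> (x + h)) / norm h powr ?s"
        using abs_inner_div_powr_le[of h "(\<eta> x - \<eta> (x + h)) *\<^sub>R \<phi> (x + h)" ?s] by simp
      also have "\<dots> \<le> norm (\<eta> (x + h) - \<eta> x) / norm h powr ?s"
        using mult_left_mono[OF \<phi>(2)[of "x + h"], of "\<bar>\<eta> x - \<eta> (x + h)\<bar>"]
        by (intro divide_right_mono) (auto simp: abs_minus_commute)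
      finally show ?thesis by simp
    qed
    then have "(LINT h|lborel. \<bar>\<eta> x * ?A h - ?B h\<bar>) \<le> frac_abs \<alpha> \<eta> x"
      unfolding frac_abs_def
      using A B frac_abs_integrand_integrable[OF \<alpha> l\<eta>, of x]
      by (intro integral_mono integrable_abs Bochner_Integration.integrable_diff integrable_mult_right) auto
    then show ?thesis
      using integral_abs_bound[of lborel "\<lambda>h. \<eta> x * ?A h - ?B h"] by linarith
  qed
  ultimately show ?thesis
    by (simp add: abs_mult mult_left_mono)
qed

section \<open>Pairing with bounded integrable functions\<close>

text \<open>Splitting at the level \<open>\<bar>f\<bar> = l\<close> replaces Hoelder's inequality for functions in
  \<open>L\<^sup>1 \<inter> L\<^sup>\<infinity>\<close> and treats \<open>p = 1\<close> and \<open>p > 1\<close> alike.\<close>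

lemma mult_le_powr_split:
  fixes a d l p M :: real
  assumes "0 \<le> a" "0 \<le> d" "d \<le> M" "l > 0" "1 \<le> p"
  shows "a * d \<le> M * l powr (1 - p) * a powr p + l * d"
proof (cases "a \<le> l")
  case True
  then have "a * d \<le> l * d" using assms by (intro mult_right_mono)
  moreover have "0 \<le> M * l powr (1 - p) * a powr p" using assms by simp
  ultimately show ?thesis by linarith
next
  case False
  then have a: "a > 0" using assms by linarith
  have "a * d \<le> M * (a powr (1 - p) * a powr p)"
    using a assms by (simp add: mult.commute mult_right_mono flip: powr_add)
  \<comment> \<open>The exponent \<open>1 - p\<close> is at most 0, so replacing \<open>a\<close> by
    the smaller \<open>l\<close> increases the power.\<close>
  also have "\<dots> \<le> M * (l powr (1 - p) * a powr p)"
    using False assms by (intro mult_left_mono mult_right_mono powr_mono2') auto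
  finally show ?thesis
    using assms by (simp add: mult.assoc add_increasing2)
qed

context
  fixes f g :: "'a \<Rightarrow> real" and p K :: real and M :: "'a measure"
  assumes f[measurable]: "f \<in> borel_measurable M" and fp: "integrable M (\<lambda>x. \<bar>f x\<bar> powr p)"
    and g: "integrable M g" "\<And>x. \<bar>g x\<bar> \<le> K" and p: "1 \<le> p"
begin

lemma integrable_mult_Lp: "integrable M (\<lambda>x. f x * g x)"
proof -
  have [measurable]: "g \<in> borel_measurable M" using g by simp
  \<comment> \<open>For integrability any level will do; this is the split at level 1.\<close>
  have "integrable M (\<lambda>x. K * 1 powr (1 - p) * \<bar>f x\<bar> powr p + 1 * \<bar>g x\<bar>)"
    using fp g by simp
  then show ?thesis
  proof (rule Bochner_Integration.integrable_bound)
    have "\<bar>f x\<bar> * \<bar>g x\<bar> \<le> K * 1 powr (1 - p) * \<bar>f x\<bar> powr p + 1 * \<bar>g x\<bar>" for x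
      using p g(2)[of x] by (intro mult_le_powr_split) auto
    then show "AE x in M. norm (f x * g x) \<le> norm (K * 1 powr (1 - p) * \<bar>f x\<bar> powr p + 1 * \<bar>g x\<bar>)"
      by (intro AE_I2) (simp add: abs_mult order.trans[OF _ abs_ge_self])
  qed measurable
qed

text \<open>The level is left free because it is tuned later: to the cutoff radius in the error
  estimate, and to the tolerance in the passage to the limit.\<close>

lemma integral_mult_Lp_le:
  assumes "l > 0"
  shows "(LINT x|M. \<bar>f x\<bar> * \<bar>g x\<bar>) \<le> K * l powr (1 - p) * (LINT x|M. \<bar>f x\<bar> powr p) + l * (LINT x|M. \<bar>g x\<bar>)"
proof -
  have "(LINT x|M. \<bar>f x\<bar> * \<bar>g x\<bar>) \<le> (LINT x|M. K * l powr (1 - p) * \<bar>f x\<bar> powr p + l * \<bar>g x\<bar>)"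
  proof (rule integral_mono)
    show "integrable M (\<lambda>x. \<bar>f x\<bar> * \<bar>g x\<bar>)"
      using integrable_abs[OF integrable_mult_Lp] by (simp add: abs_mult)
    show "integrable M (\<lambda>x. K * l powr (1 - p) * \<bar>f x\<bar> powr p + l * \<bar>g x\<bar>)"
      using fp g(1) by simp
    show "\<bar>f x\<bar> * \<bar>g x\<bar> \<le> K * l powr (1 - p) * \<bar>f x\<bar> powr p + l * \<bar>g x\<bar>" for x
      using p assms g(2)[of x] by (intro mult_le_powr_split) auto
  qed
  also have "\<dots> = K * l powr (1 - p) * (LINT x|M. \<bar>f x\<bar> powr p) + l * (LINT x|M. \<bar>g x\<bar>)"
    using fp g by simp
  finally show ?thesis .
qed

end

section \<open>The variation of a truncated function\<close>

lemma frac_var_lborel: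
  fixes f :: "real^'n \<Rightarrow> real"
  assumes "0 < \<alpha>" "\<alpha> < 1" and [measurable]: "f \<in> borel_measurable borel"
  shows "frac_var \<alpha> f = (SUP \<phi>\<in>{\<phi>\<in>Cc_inf_vec. \<forall>x. norm (\<phi> x) \<le> 1}.
       ereal (LINT x|lborel. f x * frac_div \<alpha> \<phi> x))"
  unfolding frac_var_def
proof (intro SUP_cong refl)
  fix \<phi> :: "real^'n \<Rightarrow> real^'n"
  assume "\<phi> \<in> {\<phi>\<in>Cc_inf_vec. \<forall>x. norm (\<phi> x) \<le> 1}"
  then have [measurable]: "frac_div \<alpha> \<phi> \<in> borel_measurable borel"
    using assms by (intro frac_div_measurable Cc_inf_vec_lip_cs) auto
  show "ereal (LINT x|lebesgue. f x * frac_div \<alpha> \<phi> x) = ereal (LINT x|lborel. f x * frac_div \<alpha> \<phi> x)"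
    by (subst integral_completion) auto
qed

lemma frac_var_ge:
  fixes f :: "real^'n \<Rightarrow> real"
  assumes "0 < \<alpha>" "\<alpha> < 1" "f \<in> borel_measurable borel"
    and "\<phi> \<in> Cc_inf_vec" "\<And>x. norm (\<phi> x) \<le> 1"
  shows "ereal (LINT x|lborel. f x * frac_div \<alpha> \<phi> x) \<le> frac_var \<alpha> f"
  unfolding frac_var_lborel[OF assms(1-3)] using assms by (intro SUP_upper) auto

text \<open>As 0 <= \<eta> <= 1, the field \<eta>\<phi> is again an admissible competitor for
  \<open>f\<close>, so its pairing with \<open>f\<close> is at most the variation of
  \<open>f\<close>. The Leibniz remainder is bounded independently of \<phi> and therefore survives
  the supremum.\<close>

lemma frac_var_cutoff:
  fixes f :: "real^'n \<Rightarrow> real"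
  assumes \<alpha>: "0 < \<alpha>" "\<alpha> < 1" and p: "1 \<le> p"
    and f[measurable]: "f \<in> borel_measurable borel" and fp: "integrable lborel (\<lambda>x. \<bar>f x\<bar> powr p)"
    and \<eta>: "\<eta> \<in> Cc_inf" "\<And>x. 0 \<le> \<eta> x" "\<And>x. \<eta> x \<le> 1"
  shows "frac_var \<alpha> (\<lambda>x. \<eta> x * f x) \<le>
    frac_var \<alpha> f + ereal (\<bar>mu_const CARD('n) \<alpha>\<bar> * (LINT x|lborel. \<bar>f x\<bar> * frac_abs \<alpha> \<eta> x))"
proof -
  note l\<eta> = Cc_inf_lip_cs[OF \<eta>(1)]
  have [measurable]: "\<eta> \<in> borel_measurable borel" by (rule lip_cs_measurable[OF l\<eta>])
  let ?\<mu> = "\<bar>mu_const CARD('n) \<alpha>\<bar>"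
  have i\<eta>: "integrable lborel (\<lambda>x. \<bar>f x\<bar> * frac_abs \<alpha> \<eta> x)"
  proof -
    obtain M where M: "M > 0" "\<And>x. frac_abs \<alpha> \<eta> x \<le> M"
      by (rule frac_abs_bounded[OF \<alpha> l\<eta>]) blast
    show ?thesis
      by (rule integrable_mult_Lp[where p = p and K = M])
        (use fp frac_abs_integrable[OF \<alpha> l\<eta>] M p in \<open>auto simp: frac_abs_nonneg\<close>)
  qed
  have \<eta>f: "(\<lambda>x. \<eta> x * f x) \<in> borel_measurable borel" by measurable
  show ?thesis
    unfolding frac_var_lborel[OF \<alpha> \<eta>f]
  proof (rule SUP_least)
    fix \<phi> :: "real^'n \<Rightarrow> real^'n"
    assume "\<phi> \<in> {\<phi>\<in>Cc_inf_vec. \<forall>x. norm (\<phi> x) \<le> 1}"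
    then have \<phi>: "\<phi> \<in> Cc_inf_vec" "\<And>x. norm (\<phi> x) \<le> 1" by auto
    have \<eta>\<phi>: "(\<lambda>x. \<eta> x *\<^sub>R \<phi> x) \<in> Cc_inf_vec" by (rule Cc_inf_vec_scaleR[OF \<eta>(1) \<phi>(1)])
    have ifd: "integrable lborel (\<lambda>x. f x * frac_div \<alpha> \<psi> x)" if "\<psi> \<in> Cc_inf_vec" for \<psi>
    proof -
      note l = Cc_inf_vec_lip_cs[OF that]
      obtain M where M: "M > 0" "\<And>x. \<bar>frac_div \<alpha> \<psi> x\<bar> \<le> M"
        by (rule frac_div_bounded[OF \<alpha> l]) blast
      show ?thesis
        by (rule integrable_mult_Lp[where p = p and K = M])
          (use fp frac_div_integrable[OF \<alpha> l] M p in auto)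
    qed
    have int1: "integrable lborel (\<lambda>x. \<eta> x * f x * frac_div \<alpha> \<phi> x)"
    proof (rule Bochner_Integration.integrable_bound[OF ifd[OF \<phi>(1)]])
      have [measurable]: "frac_div \<alpha> \<phi> \<in> borel_measurable borel"
        by (rule frac_div_measurable[OF \<alpha> Cc_inf_vec_lip_cs[OF \<phi>(1)]])
      show "(\<lambda>x. \<eta> x * f x * frac_div \<alpha> \<phi> x) \<in> borel_measurable lborel" by measurable
      show "AE x in lborel. norm (\<eta> x * f x * frac_div \<alpha> \<phi> x) \<le> norm (f x * frac_div \<alpha> \<phi> x)"
        using \<eta>(2,3) by (auto simp: abs_mult mult.assoc intro!: mult_left_le_one_le)
    qed
    have "(LINT x|lborel. \<eta> x * f x * frac_div \<alpha> \<phi> x)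
      \<le> (LINT x|lborel. f x * frac_div \<alpha> (\<lambda>x. \<eta> x *\<^sub>R \<phi> x) x + ?\<mu> * (\<bar>f x\<bar> * frac_abs \<alpha> \<eta> x))"
    proof (intro integral_mono int1 Bochner_Integration.integrable_add ifd[OF \<eta>\<phi>] integrable_mult_right i\<eta>)
      fix x
      have "f x * (\<eta> x * frac_div \<alpha> \<phi> x - frac_div \<alpha> (\<lambda>x. \<eta> x *\<^sub>R \<phi> x) x) \<le> \<bar>f x\<bar> * (?\<mu> * frac_abs \<alpha> \<eta> x)"
        using mult_left_mono[OF frac_div_Leibniz[OF \<alpha> \<eta>(1) \<phi>, of x], of "\<bar>f x\<bar>"]
          abs_ge_self[of "f x * (\<eta> x * frac_div \<alpha> \<phi> x - frac_div \<alpha> (\<lambda>x. \<eta> x *\<^sub>R \<phi> x) x)"]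
        unfolding abs_mult by linarith
      then show "\<eta> x * f x * frac_div \<alpha> \<phi> x
         \<le> f x * frac_div \<alpha> (\<lambda>x. \<eta> x *\<^sub>R \<phi> x) x + ?\<mu> * (\<bar>f x\<bar> * frac_abs \<alpha> \<eta> x)"
        by (simp add: algebra_simps)
    qed
    also have "\<dots> = (LINT x|lborel. f x * frac_div \<alpha> (\<lambda>x. \<eta> x *\<^sub>R \<phi> x) x)
        + ?\<mu> * (LINT x|lborel. \<bar>f x\<bar> * frac_abs \<alpha> \<eta> x)"
      by (subst Bochner_Integration.integral_add[OF ifd[OF \<eta>\<phi>] integrable_mult_right[OF i\<eta>]]) simp
    finally have "ereal (LINT x|lborel. \<eta> x * f x * frac_div \<alpha> \<phi> x)
      \<le> ereal (LINT x|lborel. f x * frac_div \<alpha> (\<lambda>x. \<eta> x *\<^sub>R \<phi> x) x)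
        + ereal (?\<mu> * (LINT x|lborel. \<bar>f x\<bar> * frac_abs \<alpha> \<eta> x))"
      by simp
    also have "\<dots> \<le> frac_var \<alpha> f + ereal (?\<mu> * (LINT x|lborel. \<bar>f x\<bar> * frac_abs \<alpha> \<eta> x))"
    proof (intro add_right_mono frac_var_ge \<alpha> f \<eta>\<phi>)
      show "norm (\<eta> x *\<^sub>R \<phi> x) \<le> 1" for x
        using \<eta>(2,3)[of x] \<phi>(2)[of x] mult_mono[of "\<eta> x" 1 "norm (\<phi> x)" 1] by simp
    qed
    finally show "ereal (LINT x|lborel. \<eta> x * f x * frac_div \<alpha> \<phi> x)
      \<le> frac_var \<alpha> f + ereal (?\<mu> * (LINT x|lborel. \<bar>f x\<bar> * frac_abs \<alpha> \<eta> x))" .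
  qed
qed

section \<open>Mollification\<close>

text \<open>The codomain is general because functions and test fields are both convolved with the
  same kernel.\<close>

definition mollify :: "('a::euclidean_space \<Rightarrow> real) \<Rightarrow> ('a \<Rightarrow> 'b::euclidean_space) \<Rightarrow> 'a \<Rightarrow> 'b" where
  "mollify \<rho> u x = (LINT y|lborel. \<rho> (x - y) *\<^sub>R u y)"

lemma integrable_mollify:
  fixes u :: "'a::euclidean_space \<Rightarrow> 'b::euclidean_space"
  assumes \<rho>: "lip_cs \<rho>" and u: "integrable lborel u"
  shows "integrable lborel (\<lambda>y. \<rho> (x - y) *\<^sub>R u y)"
proof -
  note [measurable] = lip_cs_measurable[OF \<rho>]
  have [measurable]: "u \<in> borel_measurable borel" using borel_measurable_integrable[OF u] by simp
  obtain M where M: "M > 0" "\<And>x. norm (\<rho> x) \<le> M"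
    by (rule lip_cs_bounded[OF \<rho>]) blast
  have "integrable lborel (\<lambda>y. M *\<^sub>R u y)" using u by simp
  then show ?thesis
  proof (rule Bochner_Integration.integrable_bound)
    show "AE y in lborel. norm (\<rho> (x - y) *\<^sub>R u y) \<le> norm (M *\<^sub>R u y)"
      using M by (intro AE_I2) (auto intro!: mult_right_mono)
  qed measurable
qed

text \<open>Differentiation under the integral: the Taylor remainder of the kernel is quadratic
  uniformly in the base point, and integrating it against |u| costs only the L^1 norm of
  \<open>u\<close>.\<close>

lemma mollify_has_derivative:
  fixes u :: "'a::euclidean_space \<Rightarrow> real"
  assumes \<rho>: "\<rho> \<in> Cc_inf" and u: "integrable lborel u"
  shows "(mollify \<rho> u has_derivative (\<lambda>e. mollify (\<lambda>z. frechet_derivative \<rho> (at z) e) u x)) (at x)"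
proof -
  have sm: "smooth_real \<rho>" using \<rho> by (simp add: Cc_inf_def)
  have lin: "linear (frechet_derivative \<rho> (at z))" for z
    using linear_frechet_derivative smooth_real_differentiable[OF sm] by blast
  have int: "integrable lborel (\<lambda>y. \<rho> (x - y) * u y)" for x
    using integrable_mollify[OF Cc_inf_lip_cs[OF \<rho>] u] by simp
  have intD: "integrable lborel (\<lambda>y. frechet_derivative \<rho> (at (x - y)) e * u y)" for x e
    using integrable_mollify[OF Cc_inf_lip_cs[OF Cc_inf_frechet_derivative[OF \<rho>]] u] by simp
  obtain C where C: "C > 0"
    "\<And>x h. \<bar>\<rho> (x + h) - \<rho> x - frechet_derivative \<rho> (at x) h\<bar> \<le> C * (norm h)\<^sup>2"
    by (rule Cc_inf_Taylor[OF \<rho>]) blast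
  define U where "U = (LINT y|lborel. \<bar>u y\<bar>)"
  have U: "U \<ge> 0" unfolding U_def by (intro Bochner_Integration.integral_nonneg) auto
  have est: "\<bar>mollify \<rho> u y - mollify \<rho> u x - mollify (\<lambda>z. frechet_derivative \<rho> (at z) (y - x)) u x\<bar>
      \<le> C * (norm (y - x))\<^sup>2 * U" for y
  proof -
    let ?R = "\<lambda>z. (\<rho> (y - z) - \<rho> (x - z) - frechet_derivative \<rho> (at (x - z)) (y - x)) * u z"
    have R: "integrable lborel ?R"
      using int[of y] int[of x] intD[of x "y - x"] by (simp add: left_diff_distrib)
    have "\<bar>mollify \<rho> u y - mollify \<rho> u x - mollify (\<lambda>z. frechet_derivative \<rho> (at z) (y - x)) u x\<bar>
        = \<bar>LINT z|lborel. ?R z\<bar>"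
      unfolding mollify_def using int[of y] int[of x] intD[of x "y - x"]
      by (simp add: left_diff_distrib)
    also have "\<dots> \<le> (LINT z|lborel. \<bar>?R z\<bar>)"
      by (rule integral_abs_bound)
    also have "\<dots> \<le> (LINT z|lborel. C * (norm (y - x))\<^sup>2 * \<bar>u z\<bar>)"
    proof (intro integral_mono integrable_abs[OF R] integrable_mult_right)
      show "\<bar>?R z\<bar> \<le> C * (norm (y - x))\<^sup>2 * \<bar>u z\<bar>" for z
        using mult_right_mono[OF C(2)[of "x - z" "y - x"], of "\<bar>u z\<bar>"] by (simp add: abs_mult)
    qed (use u in auto)
    also have "\<dots> = C * (norm (y - x))\<^sup>2 * U"
      by (simp add: U_def)
    finally show ?thesis .
  qed
  show ?thesis
    unfolding has_derivative_at_alt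
  proof (intro conjI allI impI)
    have "linear (\<lambda>e. mollify (\<lambda>z. frechet_derivative \<rho> (at z) e) u x)"
    proof (rule linearI)
      show "mollify (\<lambda>z. frechet_derivative \<rho> (at z) (e1 + e2)) u x =
        mollify (\<lambda>z. frechet_derivative \<rho> (at z) e1) u x + mollify (\<lambda>z. frechet_derivative \<rho> (at z) e2) u x" for e1 e2
        unfolding mollify_def using intD[of x e1] intD[of x e2]
        by (simp add: linear_add[OF lin] distrib_right)
      show "mollify (\<lambda>z. frechet_derivative \<rho> (at z) (r *\<^sub>R e)) u x =
        r *\<^sub>R mollify (\<lambda>z. frechet_derivative \<rho> (at z) e) u x" for r e
        unfolding mollify_def by (simp add: linear_cmul[OF lin] mult.assoc)
    qed
    then show "bounded_linear (\<lambda>e. mollify (\<lambda>z. frechet_derivative \<rho> (at z) e) u x)"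
      by (simp add: linear_conv_bounded_linear)
  next
    fix e :: real assume e: "e > 0"
    \<comment> \<open>With this choice \<open>(C * U + 1) * d = e\<close>; the summand 1 guards
      against \<open>U = 0\<close>.\<close>
    define d where "d = e / (C * U + 1)"
    have CU: "C * U + 1 > 0" using C(1) U by (simp add: add_nonneg_pos)
    have d: "d > 0" using e CU by (simp add: d_def)
    have "norm (mollify \<rho> u y - mollify \<rho> u x - mollify (\<lambda>z. frechet_derivative \<rho> (at z) (y - x)) u x) \<le> e * norm (y - x)"
      if "norm (y - x) < d" for y
    proof -
      have "C * (norm (y - x))\<^sup>2 * U = (C * U) * norm (y - x) * norm (y - x)"
        by (simp add: power2_eq_square)
      also have "\<dots> \<le> (C * U + 1) * d * norm (y - x)"
        using that C(1) U d by (intro mult_right_mono mult_mono) auto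
      also have "\<dots> = e * norm (y - x)"
        using CU by (simp add: d_def)
      finally show ?thesis using est[of y] by simp
    qed
    then show "\<exists>d>0. \<forall>y. norm (y - x) < d \<longrightarrow>
      norm (mollify \<rho> u y - mollify \<rho> u x - mollify (\<lambda>z. frechet_derivative \<rho> (at z) (y - x)) u x) \<le> e * norm (y - x)"
      using d by blast
  qed
qed

text \<open>Each derivative falls on the kernel, so the class of all convolutions of
  \<open>u\<close> with kernels in \<open>Cc_inf\<close> is closed under differentiation.\<close>

lemma smooth_real_mollify:
  fixes u :: "'a::euclidean_space \<Rightarrow> real"
  assumes \<rho>: "\<rho> \<in> Cc_inf" and u: "integrable lborel u"
  shows "smooth_real (mollify \<rho> u)"
proof (rule smooth_real_coinduct[where S = "(\<lambda>\<rho>. mollify \<rho> u) ` Cc_inf"])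
  show "mollify \<rho> u \<in> (\<lambda>\<rho>. mollify \<rho> u) ` Cc_inf" using \<rho> by blast
next
  fix g x assume "g \<in> (\<lambda>\<rho>. mollify \<rho> u) ` Cc_inf"
  then show "g differentiable at x"
    using differentiableI[OF mollify_has_derivative[OF _ u]] by blast
next
  fix g e assume "g \<in> (\<lambda>\<rho>. mollify \<rho> u) ` Cc_inf"
  then obtain r where r: "r \<in> Cc_inf" "g = mollify r u" by blast
  have "frechet_derivative g (at x) e = mollify (\<lambda>z. frechet_derivative r (at z) e) u x" for x
    unfolding r(2) by (simp flip: frechet_derivative_at[OF mollify_has_derivative[OF r(1) u]])
  then have "(\<lambda>x. frechet_derivative g (at x) e) = mollify (\<lambda>z. frechet_derivative r (at z) e) u"
    by (rule ext)
  then show "(\<lambda>x. frechet_derivative g (at x) e) \<in> (\<lambda>\<rho>. mollify \<rho> u) ` Cc_inf"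
    using Cc_inf_frechet_derivative[OF r(1)] by simp
qed

lemma mollify_eq_0:
  assumes "\<And>x. \<rho> x \<noteq> 0 \<Longrightarrow> norm x \<le> r" "\<And>x. u x \<noteq> 0 \<Longrightarrow> norm x \<le> R" "norm x > R + r"
  shows "mollify \<rho> u x = 0"
proof -
  have "\<rho> (x - y) *\<^sub>R u y = 0" for y
  proof (rule ccontr)
    assume "\<rho> (x - y) *\<^sub>R u y \<noteq> 0"
    then have "norm (x - y) \<le> r" "norm y \<le> R" using assms by auto
    then show False using assms(3) norm_triangle_sub[of x y] by linarith
  qed
  then show ?thesis by (simp only: mollify_def integral_zero)
qed

lemma compact_support_mollify:
  assumes "compact_support \<rho>" "compact_support u"
  shows "compact_support (mollify \<rho> u)"
proof -
  obtain r R where r: "r > 0" "\<And>x. \<rho> x \<noteq> 0 \<Longrightarrow> norm x \<le> r" and R: "R > 0" "\<And>x. u x \<noteq> 0 \<Longrightarrow> norm x \<le> R"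
    using assms unfolding compact_support_iff by blast
  show ?thesis
    unfolding compact_support_iff
    using mollify_eq_0[OF r(2) R(2)] r(1) R(1) by (intro exI[of _ "R + r"]) (auto simp: not_less[symmetric])
qed

lemma Cc_inf_mollify:
  fixes u :: "'a::euclidean_space \<Rightarrow> real"
  assumes "\<rho> \<in> Cc_inf" "integrable lborel u" "compact_support u"
  shows "mollify \<rho> u \<in> Cc_inf"
  using assms smooth_real_mollify[OF assms(1,2)] compact_support_mollify[of \<rho> u]
  by (simp add: Cc_inf_def)

lemma lip_cs_integrable:
  fixes \<phi> :: "'a::euclidean_space \<Rightarrow> 'b::euclidean_space"
  assumes "lip_cs \<phi>"
  shows "integrable lborel \<phi>"
proof -
  note [measurable] = lip_cs_measurable[OF assms]
  obtain M where M: "M > 0" "\<And>x. norm (\<phi> x) \<le> M"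
    by (rule lip_cs_bounded[OF assms]) blast
  obtain R where R: "R > 0" "\<And>x. \<phi> x \<noteq> 0 \<Longrightarrow> norm x \<le> R"
    using assms unfolding lip_cs_def compact_support_iff by blast
  have "integrable lborel (\<lambda>x. M * indicator (cball (0::'a) R) x)"
    using emeasure_bounded_finite[of "cball (0::'a) R"] by simp
  then show ?thesis
  proof (rule Bochner_Integration.integrable_bound)
    have "norm (\<phi> x) \<le> norm (M * indicator (cball (0::'a) R) x)" for x
      using M R(2)[of x] by (cases "\<phi> x = 0") (auto simp: indicator_def)
    then show "AE x in lborel. norm (\<phi> x) \<le> norm (M * indicator (cball (0::'a) R) x)" by simp
  qed measurable
qed

text \<open>Nonnegativity and unit mass keep the pointwise bound 1 on test fields; evenness makes
  mollification its own adjoint.\<close>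

definition mollifier :: "('a::euclidean_space \<Rightarrow> real) \<Rightarrow> bool" where
  "mollifier \<rho> \<longleftrightarrow> \<rho> \<in> Cc_inf \<and> (\<forall>x. \<rho> x \<ge> 0) \<and> (\<forall>x. \<rho> (- x) = \<rho> x) \<and> (LINT x|lborel. \<rho> x) = 1"

context
  fixes \<rho> :: "'a::euclidean_space \<Rightarrow> real"
  assumes \<rho>: "mollifier \<rho>"
begin

lemma mollifier_Cc_inf: "\<rho> \<in> Cc_inf"
  using \<rho> by (simp add: mollifier_def)

lemma mollifier_lip_cs: "lip_cs \<rho>"
  by (rule Cc_inf_lip_cs[OF mollifier_Cc_inf])

lemma mollifier_measurable: "\<rho> \<in> borel_measurable borel"
  by (rule lip_cs_measurable[OF mollifier_lip_cs])

lemma mollifier_integrable: "integrable lborel \<rho>"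
  by (rule lip_cs_integrable[OF mollifier_lip_cs])

lemma mollifier_nonneg: "\<rho> x \<ge> 0"
  using \<rho> by (simp add: mollifier_def)

lemma mollifier_minus_commute: "\<rho> (x - y) = \<rho> (y - x)"
  using \<rho> by (metis minus_diff_eq mollifier_def)

lemma mollifier_integral_reflect: "(LINT y|lborel. \<rho> (x - y)) = 1"
  using \<rho> integral_lborel_reflect[OF mollifier_measurable] by (simp add: mollifier_def)

lemma mollifier_integral_translate: "(LINT x|lborel. \<rho> (x - y)) = 1"
  using mollifier_integral_reflect[of y] mollifier_minus_commute by simp

lemma mollifier_integrable_reflect: "integrable lborel (\<lambda>y. \<rho> (x - y))"
  by (rule integrable_lborel_reflect[OF mollifier_integrable])

text \<open>By evenness the convolution is an average of the translates \<open>u (x + z)\<close>, a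
  form on which translation invariant operators can act.\<close>

lemma mollify_alt:
  fixes u :: "'a \<Rightarrow> 'b::euclidean_space"
  assumes [measurable]: "u \<in> borel_measurable borel"
  shows "mollify \<rho> u x = (LINT z|lborel. \<rho> z *\<^sub>R u (x + z))"
proof -
  note [measurable] = mollifier_measurable
  have "mollify \<rho> u x = (LINT y|lborel. \<rho> (y - x) *\<^sub>R u y)"
    unfolding mollify_def using mollifier_minus_commute by simp
  also have "\<dots> = (LINT z|lborel. \<rho> ((x + z) - x) *\<^sub>R u (x + z))"
    by (rule integral_lborel_translate[symmetric]) measurable
  finally show ?thesis by simp
qed

text \<open>The kernel has mass 1 in \<open>x\<close> for every \<open>y\<close>, which leaves
  \<open>K * \<bar>u y\<bar>\<close>. The weight \<open>d\<close> is the constant 1 when integrals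
  are shown to be preserved, and a fractional divergence when mollification is moved to the test
  field.\<close>

lemma mollify_pair_integrable:
  fixes u d :: "'a \<Rightarrow> real"
  assumes u: "integrable lborel u" and [measurable]: "d \<in> borel_measurable borel" and K: "\<And>x. \<bar>d x\<bar> \<le> K"
  shows "integrable (lborel \<Otimes>\<^sub>M lborel) (\<lambda>(y, x). \<rho> (x - y) * u y * d x)"
proof (rule lborel_pair.Fubini_integrable)
  note [measurable] = mollifier_measurable
  have [measurable]: "u \<in> borel_measurable borel" using borel_measurable_integrable[OF u] by simp
  show "(\<lambda>(y, x). \<rho> (x - y) * u y * d x) \<in> borel_measurable (lborel \<Otimes>\<^sub>M lborel)" by measurable
  have int: "integrable lborel (\<lambda>x. \<rho> (x - y) * u y * d x)" for y
  proof -
    have "integrable lborel (\<lambda>x. \<rho> (x - y) * (u y * K))"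
      using mollifier_integrable_reflect[of y] mollifier_minus_commute[of y]
      by (intro integrable_mult_left) simp
    then show ?thesis
    proof (rule Bochner_Integration.integrable_bound)
      show "AE x in lborel. norm (\<rho> (x - y) * u y * d x) \<le> norm (\<rho> (x - y) * (u y * K))"
        using K order.trans[OF K abs_ge_self] by (auto simp: abs_mult mult.assoc intro!: mult_left_mono)
    qed measurable
  qed
  then show "AE y in lborel. integrable lborel (\<lambda>x. case (y, x) of (y, x) \<Rightarrow> \<rho> (x - y) * u y * d x)"
    by simp
  have "integrable lborel (\<lambda>y. K * \<bar>u y\<bar>)" using u by simp
  then show "integrable lborel (\<lambda>y. LINT x|lborel. norm (case (y, x) of (y, x) \<Rightarrow> \<rho> (x - y) * u y * d x))"
  proof (rule Bochner_Integration.integrable_bound)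
    show "(\<lambda>y. LINT x|lborel. norm (case (y, x) of (y, x) \<Rightarrow> \<rho> (x - y) * u y * d x)) \<in> borel_measurable lborel"
      by (rule lborel.borel_measurable_lebesgue_integral) measurable
    have "norm (LINT x|lborel. norm (\<rho> (x - y) * u y * d x)) \<le> norm (K * \<bar>u y\<bar>)" for y
    proof -
      have "norm (LINT x|lborel. norm (\<rho> (x - y) * u y * d x)) = (LINT x|lborel. norm (\<rho> (x - y) * u y * d x))"
        by (simp add: Bochner_Integration.integral_nonneg)
      also have "\<dots> \<le> (LINT x|lborel. \<rho> (x - y) * (\<bar>u y\<bar> * K))"
      proof (intro integral_mono integrable_norm[OF int])
        show "integrable lborel (\<lambda>x. \<rho> (x - y) * (\<bar>u y\<bar> * K))"
          using mollifier_integrable_reflect[of y] mollifier_minus_commute[of y]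
          by (intro integrable_mult_left) simp
        show "norm (\<rho> (x - y) * u y * d x) \<le> \<rho> (x - y) * (\<bar>u y\<bar> * K)" for x
          using K by (auto simp: abs_mult mult.assoc mollifier_nonneg intro!: mult_left_mono)
      qed
      also have "\<dots> = \<bar>u y\<bar> * K"
        by (simp add: mollifier_integral_translate)
      finally show ?thesis by (simp add: mult.commute)
    qed
    then show "AE y in lborel. norm (LINT x|lborel. norm (case (y, x) of (y, x) \<Rightarrow> \<rho> (x - y) * u y * d x)) \<le> norm (K * \<bar>u y\<bar>)"
      by simp
  qed
qed

lemma mollify_integrable_lborel:
  fixes u :: "'a \<Rightarrow> real"
  assumes u: "integrable lborel u"
  shows "integrable lborel (mollify \<rho> u)" "(LINT x|lborel. mollify \<rho> u x) = (LINT x|lborel. u x)"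
proof -
  have P: "integrable (lborel \<Otimes>\<^sub>M lborel) (\<lambda>(y, x). \<rho> (x - y) * u y)"
    using mollify_pair_integrable[OF u, of "\<lambda>_. 1" 1] by simp
  show "integrable lborel (mollify \<rho> u)"
    using lborel_pair.integrable_snd[OF P] by (simp add: mollify_def[abs_def])
  show "(LINT x|lborel. mollify \<rho> u x) = (LINT x|lborel. u x)"
    using lborel_pair.Fubini_integral[OF P] by (simp add: mollify_def mollifier_integral_translate)
qed

end

lemma integrable_product_mult:
  fixes f :: "'a::euclidean_space \<Rightarrow> real" and g :: "'b::euclidean_space \<Rightarrow> real"
  assumes f: "integrable lborel f" and g: "integrable lborel g"
  shows "integrable (lborel \<Otimes>\<^sub>M lborel) (\<lambda>(x, y). f x * g y)"
proof (rule lborel_pair.Fubini_integrable)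
  have [measurable]: "f \<in> borel_measurable borel" "g \<in> borel_measurable borel"
    using borel_measurable_integrable[OF f] borel_measurable_integrable[OF g] by simp_all
  show "(\<lambda>(x, y). f x * g y) \<in> borel_measurable (lborel \<Otimes>\<^sub>M lborel)" by measurable
qed (use f g in \<open>simp_all add: abs_mult\<close>)

section \<open>Mollification and the fractional divergence\<close>

context
  fixes \<alpha> :: real and \<rho> :: "real^'n \<Rightarrow> real"
  assumes \<alpha>: "0 < \<alpha>" "\<alpha> < 1" and \<rho>: "mollifier \<rho>"
begin

lemma Cc_inf_vec_mollify:
  fixes \<phi> :: "real^'n \<Rightarrow> real^'n"
  assumes \<phi>: "\<phi> \<in> Cc_inf_vec"
  shows "mollify \<rho> \<phi> \<in> Cc_inf_vec"
proof -
  note l\<phi> = Cc_inf_vec_lip_cs[OF \<phi>]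
  have i: "integrable lborel \<phi>" by (rule lip_cs_integrable[OF l\<phi>])
  have "(\<lambda>x. mollify \<rho> \<phi> x $ i) = mollify \<rho> (\<lambda>x. \<phi> x $ i)" for i
  proof
    fix x
    show "mollify \<rho> \<phi> x $ i = mollify \<rho> (\<lambda>x. \<phi> x $ i) x"
      unfolding mollify_def
      using integral_bounded_linear[OF bounded_linear_vec_nth[of i]
          integrable_mollify[OF mollifier_lip_cs[OF \<rho>] i, of x]]
      by simp
  qed
  moreover have "integrable lborel (\<lambda>x. \<phi> x $ i)" for i
    using integrable_bounded_linear[OF bounded_linear_vec_nth[of i] i] .
  ultimately have "smooth_real (\<lambda>x. mollify \<rho> \<phi> x $ i)" for i
    using smooth_real_mollify[OF mollifier_Cc_inf[OF \<rho>]] by simp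
  then show ?thesis
    using \<phi> compact_support_mollify[of \<rho> \<phi>] mollifier_Cc_inf[OF \<rho>]
    by (simp add: Cc_inf_vec_def Cc_inf_def)
qed

text \<open>Averages of vectors of the unit ball stay in it; this makes mollified fields admissible
  in the supremum.\<close>

lemma norm_mollify_le_1:
  fixes \<phi> :: "real^'n \<Rightarrow> real^'n"
  assumes \<phi>: "lip_cs \<phi>" "\<And>x. norm (\<phi> x) \<le> 1"
  shows "norm (mollify \<rho> \<phi> x) \<le> 1"
proof -
  have "norm (mollify \<rho> \<phi> x) \<le> (LINT y|lborel. norm (\<rho> (x - y) *\<^sub>R \<phi> y))"
    unfolding mollify_def by (rule integral_norm_bound)
  also have "\<dots> \<le> (LINT y|lborel. \<rho> (x - y))"
  proof (intro integral_mono mollifier_integrable_reflect[OF \<rho>])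
    show "integrable lborel (\<lambda>y. norm (\<rho> (x - y) *\<^sub>R \<phi> y))"
      by (intro integrable_norm integrable_mollify mollifier_lip_cs \<rho> lip_cs_integrable \<phi>)
    show "norm (\<rho> (x - y) *\<^sub>R \<phi> y) \<le> \<rho> (x - y)" for y
      using \<phi>(2)[of y] mollifier_nonneg[OF \<rho>, of "x - y"] by (simp add: mult_left_le)
  qed
  finally show ?thesis by (simp add: mollifier_integral_reflect[OF \<rho>])
qed

text \<open>The divergence is linear and commutes with translations, and mollification averages
  translates. Fubini exchanges the two integrals, with the product of \<open>frac_ker\<close> in
  \<open>h\<close> and the kernel in \<open>z\<close> as integrable majorant.\<close>

lemma frac_div_mollify:
  fixes \<phi> :: "real^'n \<Rightarrow> real^'n"
  assumes \<phi>: "\<phi> \<in> Cc_inf_vec"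
  shows "frac_div \<alpha> (mollify \<rho> \<phi>) y = (LINT z|lborel. \<rho> z * frac_div \<alpha> \<phi> (y + z))"
proof -
  note l\<phi> = Cc_inf_vec_lip_cs[OF \<phi>]
  note [measurable] = mollifier_measurable[OF \<rho>] lip_cs_measurable[OF l\<phi>]
  let ?s = "real CARD('n) + \<alpha>" and ?\<mu> = "mu_const CARD('n) \<alpha>"
  let ?F = "\<lambda>h z. \<rho> z * ((h \<bullet> (\<phi> (y + z + h) - \<phi> (y + z))) / norm h powr (?s + 1))"
  obtain C where C: "C > 0" "\<And>x h. norm (\<phi> (x + h) - \<phi> x) / norm h powr (real DIM(real^'n) + \<alpha>) \<le> C * frac_ker \<alpha> h"
    by (rule lip_cs_ker_bound[OF \<alpha> l\<phi>]) blast
  have "integrable (lborel \<Otimes>\<^sub>M lborel) (\<lambda>(h, z). (C * frac_ker \<alpha> h) * \<rho> z)"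
    by (intro integrable_product_mult integrable_mult_right integrable_frac_ker \<alpha> mollifier_integrable \<rho>)
  then have P: "integrable (lborel \<Otimes>\<^sub>M lborel) (\<lambda>(h, z). ?F h z)"
  proof (rule Bochner_Integration.integrable_bound)
    have "\<bar>?F h z\<bar> \<le> \<bar>C * frac_ker \<alpha> h * \<rho> z\<bar>" for h z
    proof -
      have "\<bar>(h \<bullet> (\<phi> (y + z + h) - \<phi> (y + z))) / norm h powr (?s + 1)\<bar> \<le> C * frac_ker \<alpha> h"
        using abs_inner_div_powr_le[of h "\<phi> (y + z + h) - \<phi> (y + z)" ?s] C(2)[of "y + z" h] by simp
      then have "\<rho> z * \<bar>(h \<bullet> (\<phi> (y + z + h) - \<phi> (y + z))) / norm h powr (?s + 1)\<bar> \<le> \<rho> z * (C * frac_ker \<alpha> h)"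
        by (intro mult_left_mono mollifier_nonneg[OF \<rho>])
      then show ?thesis
        using mollifier_nonneg[OF \<rho>, of z] C(1) frac_ker_nonneg[of \<alpha> h]
        by (simp add: abs_mult mult_ac)
    qed
    then show "AE p in lborel \<Otimes>\<^sub>M lborel. norm (case p of (h, z) \<Rightarrow> ?F h z) \<le> norm (case p of (h, z) \<Rightarrow> C * frac_ker \<alpha> h * \<rho> z)"
      by (auto simp: case_prod_beta)
  qed measurable
  have int: "integrable lborel (\<lambda>z. \<rho> z *\<^sub>R \<phi> (x + z))" for x
    using integrable_lborel_translate[OF integrable_mollify[OF mollifier_lip_cs[OF \<rho>] lip_cs_integrable[OF l\<phi>], of x], of x]
      mollifier_minus_commute[OF \<rho>, of 0] by simp
  have mm: "mollify \<rho> \<phi> \<in> borel_measurable borel"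
    by (intro lip_cs_measurable Cc_inf_vec_lip_cs Cc_inf_vec_mollify \<phi>)
  have "frac_div \<alpha> (mollify \<rho> \<phi>) y = ?\<mu> * (LINT h|lborel. (h \<bullet> (mollify \<rho> \<phi> (y + h) - mollify \<rho> \<phi> y)) / norm h powr (?s + 1))"
    by (rule frac_div_lborel[OF mm])
  also have "\<dots> = ?\<mu> * (LINT h|lborel. LINT z|lborel. ?F h z)"
  proof (intro arg_cong2[of _ _ _ _ "(*)"] refl Bochner_Integration.integral_cong)
    fix h :: "real^'n"
    have "mollify \<rho> \<phi> (y + h) - mollify \<rho> \<phi> y = (LINT z|lborel. \<rho> z *\<^sub>R \<phi> (y + h + z) - \<rho> z *\<^sub>R \<phi> (y + z))"
      unfolding mollify_alt[OF \<rho> lip_cs_measurable[OF l\<phi>]]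
      by (rule Bochner_Integration.integral_diff[OF int int, symmetric])
    then have "(h \<bullet> (mollify \<rho> \<phi> (y + h) - mollify \<rho> \<phi> y)) / norm h powr (?s + 1)
        = (LINT z|lborel. h \<bullet> (\<rho> z *\<^sub>R \<phi> (y + h + z) - \<rho> z *\<^sub>R \<phi> (y + z))) / norm h powr (?s + 1)"
      using int[of "y + h"] int[of y] by simp
    also have "\<dots> = (LINT z|lborel. (h \<bullet> (\<rho> z *\<^sub>R \<phi> (y + h + z) - \<rho> z *\<^sub>R \<phi> (y + z))) / norm h powr (?s + 1))"
      by simp
    also have "\<dots> = (LINT z|lborel. ?F h z)"
      by (intro Bochner_Integration.integral_cong refl) (simp add: inner_diff_right right_diff_distrib add_ac)
    finally show "(h \<bullet> (mollify \<rho> \<phi> (y + h) - mollify \<rho> \<phi> y)) / norm h powr (?s + 1) = (LINT z|lborel. ?F h z)" .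
  qed
  also have "(LINT h|lborel. LINT z|lborel. ?F h z) = (LINT z|lborel. LINT h|lborel. ?F h z)"
    by (rule lborel_pair.Fubini_integral[OF P, symmetric])
  also have "?\<mu> * \<dots> = (LINT z|lborel. \<rho> z * frac_div \<alpha> \<phi> (y + z))"
    unfolding frac_div_lborel[OF lip_cs_measurable[OF l\<phi>]] integral_mult_right_zero[symmetric]
    by (simp only: mult.left_commute)
  finally show ?thesis .
qed

text \<open>After Fubini the inner integral averages the divergence of \<phi> over translates of
  \<open>y\<close>, which \<open>frac_div_mollify\<close> recognises as the divergence of the
  mollified field.\<close>

lemma integral_mollify_frac_div:
  fixes u :: "real^'n \<Rightarrow> real" and \<phi> :: "real^'n \<Rightarrow> real^'n"
  assumes u: "integrable lborel u" and \<phi>: "\<phi> \<in> Cc_inf_vec"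
  shows "(LINT x|lborel. mollify \<rho> u x * frac_div \<alpha> \<phi> x) = (LINT y|lborel. u y * frac_div \<alpha> (mollify \<rho> \<phi>) y)"
proof -
  note l\<phi> = Cc_inf_vec_lip_cs[OF \<phi>]
  note [measurable] = frac_div_measurable[OF \<alpha> l\<phi>] mollifier_measurable[OF \<rho>]
  obtain K where K: "K > 0" "\<And>x. \<bar>frac_div \<alpha> \<phi> x\<bar> \<le> K"
    by (rule frac_div_bounded[OF \<alpha> l\<phi>]) blast
  have P: "integrable (lborel \<Otimes>\<^sub>M lborel) (\<lambda>(y, x). \<rho> (x - y) * u y * frac_div \<alpha> \<phi> x)"
    by (rule mollify_pair_integrable[OF \<rho> u _ K(2)]) measurable
  have "(LINT x|lborel. mollify \<rho> u x * frac_div \<alpha> \<phi> x)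
      = (LINT x|lborel. LINT y|lborel. \<rho> (x - y) * u y * frac_div \<alpha> \<phi> x)"
    by (simp add: mollify_def)
  also have "\<dots> = (LINT y|lborel. LINT x|lborel. \<rho> (x - y) * u y * frac_div \<alpha> \<phi> x)"
    by (rule lborel_pair.Fubini_integral[OF P])
  also have "\<dots> = (LINT y|lborel. u y * (LINT x|lborel. \<rho> (x - y) * frac_div \<alpha> \<phi> x))"
    unfolding integral_mult_right_zero[symmetric] by (simp only: mult_ac)
  also have "\<dots> = (LINT y|lborel. u y * frac_div \<alpha> (mollify \<rho> \<phi>) y)"
  proof (intro Bochner_Integration.integral_cong refl arg_cong2[of _ _ _ _ "(*)"])
    fix y
    have "(LINT x|lborel. \<rho> (x - y) * frac_div \<alpha> \<phi> x) = (LINT z|lborel. \<rho> ((y + z) - y) * frac_div \<alpha> \<phi> (y + z))"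
      by (rule integral_lborel_translate[symmetric]) measurable
    then show "(LINT x|lborel. \<rho> (x - y) * frac_div \<alpha> \<phi> x) = frac_div \<alpha> (mollify \<rho> \<phi>) y"
      by (simp add: frac_div_mollify[OF \<phi>])
  qed
  finally show ?thesis .
qed

lemma frac_var_mollify_le:
  fixes u :: "real^'n \<Rightarrow> real"
  assumes u: "integrable lborel u"
  shows "frac_var \<alpha> (mollify \<rho> u) \<le> frac_var \<alpha> u"
proof -
  have um: "u \<in> borel_measurable borel" using borel_measurable_integrable[OF u] by simp
  have m: "mollify \<rho> u \<in> borel_measurable borel"
    using borel_measurable_integrable[OF mollify_integrable_lborel(1)[OF \<rho> u]] by simp
  show ?thesis
    unfolding frac_var_lborel[OF \<alpha> m]
  proof (rule SUP_least)
    fix \<phi> :: "real^'n \<Rightarrow> real^'n"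
    assume "\<phi> \<in> {\<phi>\<in>Cc_inf_vec. \<forall>x. norm (\<phi> x) \<le> 1}"
    then have \<phi>: "\<phi> \<in> Cc_inf_vec" "\<And>x. norm (\<phi> x) \<le> 1" by auto
    show "ereal (LINT x|lborel. mollify \<rho> u x * frac_div \<alpha> \<phi> x) \<le> frac_var \<alpha> u"
      unfolding integral_mollify_frac_div[OF u \<phi>(1)]
      by (intro frac_var_ge \<alpha> um Cc_inf_vec_mollify norm_mollify_le_1 Cc_inf_vec_lip_cs \<phi>)
  qed
qed

end

section \<open>Approximation in \<open>L\<^sup>p\<close>\<close>

text \<open>A crude substitute for Minkowski's inequality, from |a + b| <= 2 max(|a|, |b|). Only
  convergence to 0 is at stake, so the constant is harmless.\<close>

lemma abs_add_powr_le:
  fixes a b p :: real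
  assumes "0 \<le> p"
  shows "\<bar>a + b\<bar> powr p \<le> 2 powr p * (\<bar>a\<bar> powr p + \<bar>b\<bar> powr p)"
proof -
  have "\<bar>a + b\<bar> powr p \<le> (2 * max \<bar>a\<bar> \<bar>b\<bar>) powr p"
    using assms by (intro powr_mono2) auto
  also have "\<dots> = 2 powr p * max \<bar>a\<bar> \<bar>b\<bar> powr p"
    by (simp add: powr_mult)
  also have "\<dots> \<le> 2 powr p * (\<bar>a\<bar> powr p + \<bar>b\<bar> powr p)"
    by (intro mult_left_mono) (auto simp: max_def)
  finally show ?thesis .
qed

lemma
  fixes f g :: "'a \<Rightarrow> real"
  assumes [measurable]: "f \<in> borel_measurable M" "g \<in> borel_measurable M"
    and f: "integrable M (\<lambda>x. \<bar>f x\<bar> powr p)" and g: "integrable M (\<lambda>x. \<bar>g x\<bar> powr p)" and p: "0 \<le> p"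
  shows integrable_Lp_add: "integrable M (\<lambda>x. \<bar>f x + g x\<bar> powr p)"
    and integral_Lp_add_le: "(LINT x|M. \<bar>f x + g x\<bar> powr p) \<le>
      2 powr p * ((LINT x|M. \<bar>f x\<bar> powr p) + (LINT x|M. \<bar>g x\<bar> powr p))"
proof -
  have b: "integrable M (\<lambda>x. 2 powr p * (\<bar>f x\<bar> powr p + \<bar>g x\<bar> powr p))"
    using f g by simp
  then show i: "integrable M (\<lambda>x. \<bar>f x + g x\<bar> powr p)"
  proof (rule Bochner_Integration.integrable_bound)
    show "AE x in M. norm (\<bar>f x + g x\<bar> powr p) \<le> norm (2 powr p * (\<bar>f x\<bar> powr p + \<bar>g x\<bar> powr p))"
      using abs_add_powr_le[OF p] by (auto simp: abs_mult)
  qed measurable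
  have "(LINT x|M. \<bar>f x + g x\<bar> powr p) \<le> (LINT x|M. 2 powr p * (\<bar>f x\<bar> powr p + \<bar>g x\<bar> powr p))"
    by (intro integral_mono i b abs_add_powr_le p)
  then show "(LINT x|M. \<bar>f x + g x\<bar> powr p) \<le>
      2 powr p * ((LINT x|M. \<bar>f x\<bar> powr p) + (LINT x|M. \<bar>g x\<bar> powr p))"
    using f g by simp
qed

text \<open>Here \<open>w\<close> need not be integrable, but |w| <= |w|^p + 1, and the kernel is
  integrable against both summands. Linearity of mollification on L^p rests on this.\<close>

lemma integrable_mollify_Lp:
  fixes w :: "'a::euclidean_space \<Rightarrow> real"
  assumes \<rho>: "mollifier \<rho>" and w[measurable]: "w \<in> borel_measurable borel"
    and wp: "integrable lborel (\<lambda>x. \<bar>w x\<bar> powr p)" and p: "1 \<le> p"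
  shows "integrable lborel (\<lambda>y. \<rho> (x - y) * w y)"
proof -
  note [measurable] = mollifier_measurable[OF \<rho>]
  have "integrable lborel (\<lambda>y. \<rho> (x - y) * \<bar>w y\<bar> powr p + \<rho> (x - y))"
    using mollifier_integrable_reflect[OF \<rho>, of x] integrable_mollify[OF mollifier_lip_cs[OF \<rho>] wp, of x]
    by simp
  then show ?thesis
  proof (rule Bochner_Integration.integrable_bound)
    have "\<bar>\<rho> (x - y) * w y\<bar> \<le> \<rho> (x - y) * \<bar>w y\<bar> powr p + \<rho> (x - y)" for y
    proof -
      have "\<bar>w y\<bar> * 1 \<le> 1 * 1 powr (1 - p) * \<bar>w y\<bar> powr p + 1 * 1"
        using p by (intro mult_le_powr_split) auto
      then have "\<rho> (x - y) * \<bar>w y\<bar> \<le> \<rho> (x - y) * (\<bar>w y\<bar> powr p + 1)"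
        using mollifier_nonneg[OF \<rho>] by (intro mult_left_mono) auto
      then show ?thesis
        using mollifier_nonneg[OF \<rho>] by (simp add: abs_mult distrib_left)
    qed
    then show "AE y in lborel. norm (\<rho> (x - y) * w y) \<le> norm (\<rho> (x - y) * \<bar>w y\<bar> powr p + \<rho> (x - y))"
      by (intro AE_I2) (simp add: order.trans[OF _ abs_ge_self])
  qed measurable
qed

text \<open>The constant \<open>2 powr p\<close> could be \<open>1\<close> by Jensen's inequality, but a constant independent of
  \<open>\<rho>\<close> suffices, and it follows from mult_le_powr_split by optimising the level \<open>l\<close>.\<close>

lemma mollify_powr_le:
  fixes w :: "'a::euclidean_space \<Rightarrow> real"
  assumes \<rho>: "mollifier \<rho>" and w[measurable]: "w \<in> borel_measurable borel"
    and wp: "integrable lborel (\<lambda>x. \<bar>w x\<bar> powr p)" and p: "1 \<le> p"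
  shows "\<bar>mollify \<rho> w x\<bar> powr p \<le> 2 powr p * mollify \<rho> (\<lambda>x. \<bar>w x\<bar> powr p) x"
proof -
  define T where "T = mollify \<rho> (\<lambda>x. \<bar>w x\<bar> powr p) x"
  have T0: "T \<ge> 0"
    unfolding T_def mollify_def using mollifier_nonneg[OF \<rho>]
    by (intro Bochner_Integration.integral_nonneg) simp
  have le: "\<bar>mollify \<rho> w x\<bar> \<le> l + l powr (1 - p) * T" if l: "l > 0" for l
  proof -
    have "\<bar>mollify \<rho> w x\<bar> \<le> (LINT y|lborel. \<bar>\<rho> (x - y) * w y\<bar>)"
      using integral_abs_bound[of lborel "\<lambda>y. \<rho> (x - y) * w y"] by (simp add: mollify_def)
    also have "\<dots> \<le> (LINT y|lborel. l * \<rho> (x - y) + l powr (1 - p) * (\<rho> (x - y) * \<bar>w y\<bar> powr p))"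
    proof (rule integral_mono)
      show "integrable lborel (\<lambda>y. \<bar>\<rho> (x - y) * w y\<bar>)"
        by (intro integrable_abs integrable_mollify_Lp[OF \<rho> w wp p])
      show "integrable lborel (\<lambda>y. l * \<rho> (x - y) + l powr (1 - p) * (\<rho> (x - y) * \<bar>w y\<bar> powr p))"
        using mollifier_integrable_reflect[OF \<rho>, of x] integrable_mollify[OF mollifier_lip_cs[OF \<rho>] wp, of x]
        by simp
      fix y
      have "\<bar>w y\<bar> * 1 \<le> 1 * l powr (1 - p) * \<bar>w y\<bar> powr p + l * 1"
        using p l by (intro mult_le_powr_split) auto
      then have "\<rho> (x - y) * \<bar>w y\<bar> \<le> \<rho> (x - y) * (l powr (1 - p) * \<bar>w y\<bar> powr p + l)"
        using mollifier_nonneg[OF \<rho>] by (intro mult_left_mono) auto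
      then show "\<bar>\<rho> (x - y) * w y\<bar> \<le> l * \<rho> (x - y) + l powr (1 - p) * (\<rho> (x - y) * \<bar>w y\<bar> powr p)"
        using mollifier_nonneg[OF \<rho>] by (simp add: abs_mult algebra_simps)
    qed
    also have "\<dots> = l + l powr (1 - p) * T"
      using mollifier_integrable_reflect[OF \<rho>, of x] integrable_mollify[OF mollifier_lip_cs[OF \<rho>] wp, of x]
      by (simp add: mollifier_integral_reflect[OF \<rho>] T_def mollify_def)
    finally show ?thesis .
  qed
  \<comment> \<open>The level \<open>T powr (1 / p)\<close> makes the two terms of \<open>le\<close>
    equal. For \<open>T = 0\<close> it is not positive; then all positive levels are used and tend
    to 0.\<close>
  have "\<bar>mollify \<rho> w x\<bar> \<le> 2 * T powr (1 / p)"
  proof (cases "T = 0")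
    case True
    then have "\<bar>mollify \<rho> w x\<bar> \<le> l" if "l > 0" for l using le[OF that] by simp
    then have "\<bar>mollify \<rho> w x\<bar> \<le> 0" by (rule dense_ge)
    then show ?thesis by simp
  next
    case False
    then have T: "T > 0" using T0 by simp
    have "(T powr (1 / p)) powr (1 - p) * T = T powr ((1 / p) * (1 - p) + 1)"
      using T by (simp add: powr_powr powr_add)
    also have "(1 / p) * (1 - p) + 1 = 1 / p" using p by (simp add: field_simps)
    finally show ?thesis using le[of "T powr (1 / p)"] T by simp
  qed
  then have "\<bar>mollify \<rho> w x\<bar> powr p \<le> (2 * T powr (1 / p)) powr p"
    using p by (intro powr_mono2) auto
  also have "\<dots> = 2 powr p * T"
    using p T0 by (simp add: powr_mult powr_powr)
  finally show ?thesis by (simp add: T_def)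
qed

text \<open>The pointwise bound is integrated, and mollification preserves the integral of |w|^p.
  The resulting bound is uniform over all mollifiers.\<close>

lemma
  fixes w :: "'a::euclidean_space \<Rightarrow> real"
  assumes \<rho>: "mollifier \<rho>" and w[measurable]: "w \<in> borel_measurable borel"
    and wp: "integrable lborel (\<lambda>x. \<bar>w x\<bar> powr p)" and p: "1 \<le> p"
  shows measurable_mollify: "mollify \<rho> w \<in> borel_measurable borel"
    and integrable_Lp_mollify: "integrable lborel (\<lambda>x. \<bar>mollify \<rho> w x\<bar> powr p)"
    and integral_Lp_mollify_le:
      "(LINT x|lborel. \<bar>mollify \<rho> w x\<bar> powr p) \<le> 2 powr p * (LINT x|lborel. \<bar>w x\<bar> powr p)"
proof -
  note [measurable] = mollifier_measurable[OF \<rho>]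
  have "(\<lambda>x. LINT y|lborel. \<rho> (x - y) *\<^sub>R w y) \<in> borel_measurable borel"
    by (rule lborel.borel_measurable_lebesgue_integral) measurable
  then show [measurable]: "mollify \<rho> w \<in> borel_measurable borel"
    by (simp add: mollify_def[abs_def])
  note T = mollify_integrable_lborel[OF \<rho> wp]
  have b: "integrable lborel (\<lambda>x. 2 powr p * mollify \<rho> (\<lambda>x. \<bar>w x\<bar> powr p) x)"
    using T(1) by simp
  then show i: "integrable lborel (\<lambda>x. \<bar>mollify \<rho> w x\<bar> powr p)"
  proof (rule Bochner_Integration.integrable_bound)
    show "AE x in lborel. norm (\<bar>mollify \<rho> w x\<bar> powr p) \<le> norm (2 powr p * mollify \<rho> (\<lambda>x. \<bar>w x\<bar> powr p) x)"
      using mollify_powr_le[OF \<rho> w wp p] by (intro AE_I2) (simp add: order.trans[OF _ abs_ge_self])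
  qed measurable
  have "(LINT x|lborel. \<bar>mollify \<rho> w x\<bar> powr p) \<le> (LINT x|lborel. 2 powr p * mollify \<rho> (\<lambda>x. \<bar>w x\<bar> powr p) x)"
    by (intro integral_mono i b mollify_powr_le[OF \<rho> w wp p])
  then show "(LINT x|lborel. \<bar>mollify \<rho> w x\<bar> powr p) \<le> 2 powr p * (LINT x|lborel. \<bar>w x\<bar> powr p)"
    using T(2) by simp
qed

section \<open>Density of continuous compactly supported functions\<close>

definition clamp_real :: "real \<Rightarrow> real \<Rightarrow> real" where
  "clamp_real N t = max (- N) (min N t)"

lemma continuous_on_clamp_real: "continuous_on S f \<Longrightarrow> continuous_on S (\<lambda>x. clamp_real N (f x))"
  unfolding clamp_real_def by (intro continuous_intros)

lemma abs_clamp_real_le: "N \<ge> 0 \<Longrightarrow> \<bar>clamp_real N t\<bar> \<le> N"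
  by (auto simp: clamp_real_def)

lemma clamp_real_id: "\<bar>t\<bar> \<le> N \<Longrightarrow> clamp_real N t = t"
  by (auto simp: clamp_real_def)

lemma abs_diff_clamp_real_le: "N \<ge> 0 \<Longrightarrow> \<bar>t - clamp_real N t\<bar> \<le> \<bar>t\<bar>"
  by (auto simp: clamp_real_def)

text \<open>Truncation is in height and in radius with the same \<open>N\<close>. At each point the
  difference is eventually exactly 0, and |u|^p dominates.\<close>

lemma Lp_truncate:
  fixes u :: "'a::euclidean_space \<Rightarrow> real"
  assumes [measurable]: "u \<in> borel_measurable borel" and up: "integrable lborel (\<lambda>x. \<bar>u x\<bar> powr p)"
    and p: "1 \<le> p"
  shows "(\<lambda>N. LINT x|lborel. \<bar>u x - indicator (cball 0 (real N)) x * clamp_real (real N) (u x)\<bar> powr p) \<longlonglongrightarrow> 0"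
proof -
  have m: "(\<lambda>x. \<bar>u x - indicator (cball 0 (real N)) x * clamp_real (real N) (u x)\<bar> powr p) \<in> borel_measurable lborel" for N
    unfolding clamp_real_def by measurable
  have "(\<lambda>N. LINT x|lborel. \<bar>u x - indicator (cball 0 (real N)) x * clamp_real (real N) (u x)\<bar> powr p)
      \<longlonglongrightarrow> (LINT x|(lborel::'a measure). 0)"
  proof (rule integral_dominated_convergence[OF _ m up])
    have "(\<lambda>N. \<bar>u x - indicator (cball 0 (real N)) x * clamp_real (real N) (u x)\<bar> powr p) \<longlonglongrightarrow> 0" for x
    proof (rule tendsto_eventually)
      obtain N0 :: nat where "max (norm x) \<bar>u x\<bar> \<le> real N0" using real_arch_simple by blast
      then have "\<bar>u x - indicator (cball 0 (real N)) x * clamp_real (real N) (u x)\<bar> powr p = 0" if "N \<ge> N0" for N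
        using that by (subst clamp_real_id) auto
      then show "\<forall>\<^sub>F N in sequentially. \<bar>u x - indicator (cball 0 (real N)) x * clamp_real (real N) (u x)\<bar> powr p = 0"
        unfolding eventually_sequentially by blast
    qed
    then show "AE x in lborel. (\<lambda>N. \<bar>u x - indicator (cball 0 (real N)) x * clamp_real (real N) (u x)\<bar> powr p) \<longlonglongrightarrow> 0"
      by simp
    show "AE x in lborel. norm (\<bar>u x - indicator (cball 0 (real N)) x * clamp_real (real N) (u x)\<bar> powr p) \<le> \<bar>u x\<bar> powr p" for N
      using p abs_diff_clamp_real_le[of "real N"]
      by (intro AE_I2) (auto simp: indicator_def intro!: powr_mono2)
  qed simp
  then show ?thesis by simp
qed

text \<open>A measurable function is almost everywhere a limit of continuous functions, but without
  any common bound. Clamping their values and multiplying by a continuous radial cutoff provides one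
  without changing the limit; dominated convergence then applies.\<close>

lemma Lp_approx_bounded:
  fixes v :: "'a::euclidean_space \<Rightarrow> real"
  assumes [measurable]: "v \<in> borel_measurable borel" and p: "1 \<le> p"
    and v: "\<And>x. \<bar>v x\<bar> \<le> N" "\<And>x. norm x > N \<Longrightarrow> v x = 0" and e: "e > 0"
  obtains g where "continuous_on UNIV g" "compact_support g"
    "integrable lborel (\<lambda>x. \<bar>v x - g x\<bar> powr p)" "(LINT x|lborel. \<bar>v x - g x\<bar> powr p) < e"
proof -
  have N: "N \<ge> 0" using v(1)[of 0] by linarith
  have "v measurable_on UNIV"
    by (rule lebesgue_measurable_imp_measurable_on) (auto intro: measurable_completion)
  then obtain Z g where Z: "negligible Z" and g: "\<And>n. continuous_on UNIV (g n)"
    "\<And>x. x \<notin> Z \<Longrightarrow> (\<lambda>n::nat. g n x) \<longlonglongrightarrow> v x"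
    unfolding measurable_on_def by auto
  \<comment> \<open>Equal to 1 on the ball of radius \<open>N\<close>, which contains all points
    where \<open>v\<close> is nonzero, and 0 outside radius \<open>N + 1\<close>.\<close>
  define \<theta> :: "'a \<Rightarrow> real" where "\<theta> x = max 0 (min 1 (N + 1 - norm x))" for x
  define k where "k n x = \<theta> x * clamp_real N (g n x)" for n x
  have kc: "continuous_on UNIV (k n)" for n
    unfolding k_def \<theta>_def by (intro continuous_intros continuous_on_clamp_real g)
  have [measurable]: "k n \<in> borel_measurable borel" for n
    by (rule borel_measurable_continuous_onI[OF kc])
  have k0: "k n x = 0" if "norm x > N + 1" for n x
    using that by (simp add: k_def \<theta>_def)
  have kN: "\<bar>k n x\<bar> \<le> N" for n x
  proof -
    have "\<bar>\<theta> x\<bar> \<le> 1" by (auto simp: \<theta>_def)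
    then have "\<bar>\<theta> x\<bar> * \<bar>clamp_real N (g n x)\<bar> \<le> 1 * N"
      using abs_clamp_real_le[OF N] by (intro mult_mono) auto
    then show ?thesis by (simp add: k_def abs_mult)
  qed
  have kl: "(\<lambda>n. k n x) \<longlonglongrightarrow> v x" if "x \<notin> Z" for x
  proof -
    have "(\<lambda>n. k n x) \<longlonglongrightarrow> \<theta> x * clamp_real N (v x)"
      unfolding k_def clamp_real_def by (intro tendsto_intros g that)
    moreover have "\<theta> x * clamp_real N (v x) = v x"
      using v(2)[of x] clamp_real_id[OF v(1)[of x]] by (cases "norm x > N") (auto simp: \<theta>_def)
    ultimately show ?thesis by simp
  qed
  \<comment> \<open>Both \<open>v\<close> and the approximants are bounded by \<open>N\<close> and
    vanish outside this ball.\<close>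
  define w where "w x = (2 * N) powr p * indicator (cball 0 (N + 1)) x" for x :: 'a
  have w: "integrable lborel w"
    unfolding w_def using emeasure_bounded_finite[of "cball (0::'a) (N + 1)"] by simp
  have bd: "\<bar>v x - k n x\<bar> powr p \<le> w x" for n x
  proof (cases "norm x \<le> N + 1")
    case True
    have "\<bar>v x - k n x\<bar> \<le> 2 * N" using v(1)[of x] kN[of n x] by linarith
    then show ?thesis using True p by (simp add: w_def powr_mono2)
  next
    case False
    then show ?thesis using k0[of x n] v(2)[of x] by (simp add: w_def)
  qed
  have m: "(\<lambda>x. \<bar>v x - k n x\<bar> powr p) \<in> borel_measurable lborel" for n by measurable
  have "(\<lambda>n. LINT x|lborel. \<bar>v x - k n x\<bar> powr p) \<longlonglongrightarrow> (LINT x|(lborel::'a measure). 0)"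
  proof (rule integral_dominated_convergence[OF _ m w])
    have "AE x in lebesgue. x \<notin> Z"
      using Z by (intro AE_not_in) (simp add: negligible_iff_null_sets)
    then have "AE x in lborel. x \<notin> Z"
      by (simp add: AE_completion_iff)
    then show "AE x in lborel. (\<lambda>n. \<bar>v x - k n x\<bar> powr p) \<longlonglongrightarrow> 0"
    proof eventually_elim
      case (elim x)
      have "(\<lambda>n. \<bar>v x - k n x\<bar>) \<longlonglongrightarrow> \<bar>v x - v x\<bar>"
        by (intro tendsto_intros kl elim)
      then have "(\<lambda>n. \<bar>v x - k n x\<bar> powr p) \<longlonglongrightarrow> 0 powr p"
        using p by (intro tendsto_powr') auto
      then show ?case by simp
    qed
    show "AE x in lborel. norm (\<bar>v x - k n x\<bar> powr p) \<le> w x" for n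
      using bd by simp
  qed simp
  then have "\<forall>\<^sub>F n in sequentially. (LINT x|lborel. \<bar>v x - k n x\<bar> powr p) < e"
    using e by (intro order_tendstoD(2)) auto
  then obtain n where n: "(LINT x|lborel. \<bar>v x - k n x\<bar> powr p) < e"
    using eventually_happens'[OF sequentially_bot] by blast
  have "compact_support (k n)"
    unfolding compact_support_iff using k0 N
    by (intro exI[of _ "N + 1"]) (auto simp: not_less[symmetric])
  moreover have "integrable lborel (\<lambda>x. \<bar>v x - k n x\<bar> powr p)"
    by (rule Bochner_Integration.integrable_bound[OF w m])
      (intro AE_I2, simp add: order.trans[OF bd abs_ge_self])
  ultimately show ?thesis using that kc n by blast
qed

lemma Lp_approx_continuous:
  fixes u :: "'a::euclidean_space \<Rightarrow> real"
  assumes [measurable]: "u \<in> borel_measurable borel" and up: "integrable lborel (\<lambda>x. \<bar>u x\<bar> powr p)"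
    and p: "1 \<le> p" and e: "e > 0"
  obtains g where "continuous_on UNIV g" "compact_support g"
    "integrable lborel (\<lambda>x. \<bar>u x - g x\<bar> powr p)" "(LINT x|lborel. \<bar>u x - g x\<bar> powr p) < e"
proof -
  \<comment> \<open>Two errors of this size, summed and multiplied by the constant
    \<open>2 powr p\<close> of the quasi-triangle inequality, give \<open>e\<close>.\<close>
  define e' where "e' = e / (2 powr p * 2)"
  have e': "e' > 0" using e by (simp add: e'_def)
  define v where "v N x = indicator (cball 0 (real N)) x * clamp_real (real N) (u x)" for N :: nat and x
  have "\<forall>\<^sub>F N in sequentially. (LINT x|lborel. \<bar>u x - v N x\<bar> powr p) < e'"
    using Lp_truncate[of u p] assms e' unfolding v_def by (intro order_tendstoD(2)) auto
  then obtain N where N: "(LINT x|lborel. \<bar>u x - v N x\<bar> powr p) < e'"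
    using eventually_happens'[OF sequentially_bot] by blast
  have [measurable]: "v N \<in> borel_measurable borel"
    unfolding v_def clamp_real_def by measurable
  have iv: "integrable lborel (\<lambda>x. \<bar>u x - v N x\<bar> powr p)"
  proof (rule Bochner_Integration.integrable_bound[OF up])
    show "AE x in lborel. norm (\<bar>u x - v N x\<bar> powr p) \<le> norm (\<bar>u x\<bar> powr p)"
      using p abs_diff_clamp_real_le[of "real N"]
      by (intro AE_I2) (auto simp: v_def indicator_def intro!: powr_mono2)
  qed measurable
  obtain g where g: "continuous_on UNIV g" "compact_support g"
    "integrable lborel (\<lambda>x. \<bar>v N x - g x\<bar> powr p)" "(LINT x|lborel. \<bar>v N x - g x\<bar> powr p) < e'"
  proof (rule Lp_approx_bounded[of "v N" p "real N" e'])
    show "\<bar>v N x\<bar> \<le> real N" for x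
      using abs_clamp_real_le[of "real N" "u x"] by (simp add: v_def indicator_def)
    show "v N x = 0" if "real N < norm x" for x
      using that by (simp add: v_def)
  qed (use p e' in auto)
  have [measurable]: "g \<in> borel_measurable borel"
    by (rule borel_measurable_continuous_onI[OF g(1)])
  have "integrable lborel (\<lambda>x. \<bar>(u x - v N x) + (v N x - g x)\<bar> powr p)"
    using p by (intro integrable_Lp_add iv g(3)) auto
  moreover have "(LINT x|lborel. \<bar>(u x - v N x) + (v N x - g x)\<bar> powr p) < e"
  proof -
    have "(LINT x|lborel. \<bar>(u x - v N x) + (v N x - g x)\<bar> powr p) \<le>
        2 powr p * ((LINT x|lborel. \<bar>u x - v N x\<bar> powr p) + (LINT x|lborel. \<bar>v N x - g x\<bar> powr p))"
      using p by (intro integral_Lp_add_le iv g(3)) auto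
    also have "\<dots> < 2 powr p * (e' + e')"
      using N g(4) by (intro mult_strict_left_mono add_strict_mono) auto
    also have "\<dots> = e" by (simp add: e'_def)
    finally show ?thesis .
  qed
  ultimately show ?thesis using that g(1,2) by simp
qed

text \<open>Uniform continuity makes the error at most \<open>t\<close> on one fixed ball, and
  outside that ball both functions vanish. Hence the error integral is at most t^p times the
  volume.\<close>

lemma mollify_continuous_Lp:
  fixes g :: "'a::euclidean_space \<Rightarrow> real"
  assumes g: "continuous_on UNIV g" "compact_support g" and p: "1 \<le> p" and e: "e > 0"
  obtains \<delta> where "\<delta> > 0" "\<And>\<rho>. mollifier \<rho> \<Longrightarrow> (\<And>x. \<rho> x \<noteq> 0 \<Longrightarrow> norm x \<le> \<delta>) \<Longrightarrow>
    integrable lborel (\<lambda>x. \<bar>mollify \<rho> g x - g x\<bar> powr p) \<and> (LINT x|lborel. \<bar>mollify \<rho> g x - g x\<bar> powr p) < e"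
proof -
  have gm[measurable]: "g \<in> borel_measurable borel"
    by (rule borel_measurable_continuous_onI[OF g(1)])
  obtain R where R: "R > 0" "\<And>x. g x \<noteq> 0 \<Longrightarrow> norm x \<le> R"
    using g(2) unfolding compact_support_iff by blast
  obtain M where M: "M > 0" "\<And>x. norm (g x) \<le> M"
    by (rule compact_support_bounded_range[OF g]) blast
  define V where "V = measure lborel (cball (0::'a) (R + 2))"
  have V: "V \<ge> 0" by (simp add: V_def)
  \<comment> \<open>Chosen so that \<open>t powr p * V\<close> is below \<open>e\<close>; the
    denominator \<open>V + 1\<close> is positive even if \<open>V\<close> is not and makes the
    inequality strict.\<close>
  define t where "t = (e / (V + 1)) powr (1 / p) / 2"
  have t: "t > 0" using e V by (simp add: t_def)
  have tp: "t powr p * V < e"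
  proof -
    have "t powr p \<le> ((e / (V + 1)) powr (1 / p)) powr p"
      using p by (intro powr_mono2) (auto simp: t_def)
    also have "\<dots> = e / (V + 1)" using p e V by (simp add: powr_powr)
    finally have "t powr p * V \<le> e / (V + 1) * V" using V by (intro mult_right_mono)
    also have "\<dots> < e" using e V by (simp add: field_simps)
    finally show ?thesis .
  qed
  have "uniformly_continuous_on (cball 0 (R + 2)) g"
    by (rule compact_uniformly_continuous) (auto intro: continuous_on_subset[OF g(1)])
  then obtain d where d: "d > 0"
    "\<And>x y. x \<in> cball 0 (R + 2) \<Longrightarrow> y \<in> cball 0 (R + 2) \<Longrightarrow> dist y x < d \<Longrightarrow> dist (g y) (g x) < t"
    unfolding uniformly_continuous_on_def using t by metis
  \<comment> \<open>\<open>d / 2\<close> turns the strict inequality of uniform continuity into one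
    for distances up to \<open>\<delta>\<close>; the bound 1 keeps the points compared inside radius
    \<open>R + 2\<close>.\<close>
  define \<delta> where "\<delta> = min (d / 2) 1"
  have \<delta>: "\<delta> > 0" "\<delta> < d" "\<delta> \<le> 1" using d(1) by (auto simp: \<delta>_def)
  show ?thesis
  proof (rule that[OF \<delta>(1)])
    fix \<rho> :: "'a \<Rightarrow> real"
    assume \<rho>: "mollifier \<rho>" and supp: "\<And>x. \<rho> x \<noteq> 0 \<Longrightarrow> norm x \<le> \<delta>"
    note [measurable] = mollifier_measurable[OF \<rho>]
    have small: "\<bar>g y - g x\<bar> \<le> t" if xy: "norm (x - y) \<le> \<delta>" for x y
    proof (cases "norm x \<le> R + 1")
      case True
      then have "norm y \<le> R + 2"
        using xy \<delta> norm_triangle_sub[of y x] by (simp add: norm_minus_commute)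
      then show ?thesis
        using d(2)[of x y] True xy \<delta> by (simp add: dist_norm norm_minus_commute dist_real_def less_imp_le)
    next
      case False
      then have "norm y > R" using xy \<delta> norm_triangle_sub[of x y] by linarith
      then have "g y = 0" "g x = 0" using R(2)[of y] R(2)[of x] False by auto
      then show ?thesis using t by simp
    qed
    have int: "integrable lborel (\<lambda>y. \<rho> (x - y) * g y)" for x
    proof (rule Bochner_Integration.integrable_bound)
      show "integrable lborel (\<lambda>y. \<rho> (x - y) * M)"
        using mollifier_integrable_reflect[OF \<rho>, of x] by simp
      show "AE y in lborel. norm (\<rho> (x - y) * g y) \<le> norm (\<rho> (x - y) * M)"
        using M by (intro AE_I2) (auto simp: abs_mult intro!: mult_left_mono)
    qed measurable
    have close: "\<bar>mollify \<rho> g x - g x\<bar> \<le> t" for x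
    proof -
      have "mollify \<rho> g x - g x = (LINT y|lborel. \<rho> (x - y) * g y - \<rho> (x - y) * g x)"
        using int[of x] mollifier_integrable_reflect[OF \<rho>, of x]
        by (simp add: mollify_def mollifier_integral_reflect[OF \<rho>])
      then have "\<bar>mollify \<rho> g x - g x\<bar> \<le> (LINT y|lborel. \<bar>\<rho> (x - y) * g y - \<rho> (x - y) * g x\<bar>)"
        using integral_abs_bound[of lborel "\<lambda>y. \<rho> (x - y) * g y - \<rho> (x - y) * g x"] by simp
      also have "\<dots> \<le> (LINT y|lborel. \<rho> (x - y) * t)"
      proof (rule integral_mono)
        show "integrable lborel (\<lambda>y. \<bar>\<rho> (x - y) * g y - \<rho> (x - y) * g x\<bar>)"
          using int[of x] mollifier_integrable_reflect[OF \<rho>, of x] by simp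
        show "integrable lborel (\<lambda>y. \<rho> (x - y) * t)"
          using mollifier_integrable_reflect[OF \<rho>, of x] by simp
        fix y
        show "\<bar>\<rho> (x - y) * g y - \<rho> (x - y) * g x\<bar> \<le> \<rho> (x - y) * t"
        proof (cases "\<rho> (x - y) = 0")
          case False
          then have "\<bar>g y - g x\<bar> \<le> t" using supp small by blast
          then show ?thesis
            using mollifier_nonneg[OF \<rho>, of "x - y"]
            by (simp add: abs_mult mult_left_mono flip: right_diff_distrib)
        qed simp
      qed
      also have "\<dots> = t" by (simp add: mollifier_integral_reflect[OF \<rho>])
      finally show ?thesis .
    qed
    have zero: "mollify \<rho> g x = 0" "g x = 0" if "norm x > R + 2" for x
      using mollify_eq_0[of \<rho> \<delta> g R x] supp R that \<delta> by force+
    have bd: "\<bar>mollify \<rho> g x - g x\<bar> powr p \<le> t powr p * indicator (cball 0 (R + 2)) x" for x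
    proof (cases "norm x \<le> R + 2")
      case True
      then show ?thesis using close[of x] p by (simp add: powr_mono2)
    next
      case False
      then show ?thesis using zero[of x] by simp
    qed
    have w: "integrable lborel (\<lambda>x. t powr p * indicator (cball (0::'a) (R + 2)) x)"
      using emeasure_bounded_finite[of "cball (0::'a) (R + 2)"] by simp
    have [measurable]: "mollify \<rho> g \<in> borel_measurable borel"
    proof -
      have "(\<lambda>x. LINT y|lborel. \<rho> (x - y) *\<^sub>R g y) \<in> borel_measurable borel"
        by (rule lborel.borel_measurable_lebesgue_integral) measurable
      then show ?thesis by (simp add: mollify_def[abs_def])
    qed
    have i: "integrable lborel (\<lambda>x. \<bar>mollify \<rho> g x - g x\<bar> powr p)"
      by (rule Bochner_Integration.integrable_bound[OF w]) (use bd order.trans[OF _ abs_ge_self] in auto)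
    have "(LINT x|lborel. \<bar>mollify \<rho> g x - g x\<bar> powr p) \<le> (LINT x|lborel. t powr p * indicator (cball (0::'a) (R + 2)) x)"
      by (intro integral_mono i w bd)
    also have "\<dots> = t powr p * V"
      using emeasure_bounded_finite[of "cball (0::'a) (R + 2)"] by (simp add: V_def)
    also have "\<dots> < e" by (rule tp)
    finally show "integrable lborel (\<lambda>x. \<bar>mollify \<rho> g x - g x\<bar> powr p) \<and> (LINT x|lborel. \<bar>mollify \<rho> g x - g x\<bar> powr p) < e"
      using i by simp
  qed
qed

text \<open>The usual density argument: mollification is bounded on L^p uniformly in the kernel, so
  the continuous approximant \<open>g\<close> transfers its convergence to \<open>u\<close>.\<close>

lemma Lp_mollify_approx:
  fixes u :: "'a::euclidean_space \<Rightarrow> real"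
  assumes u[measurable]: "u \<in> borel_measurable borel" and up: "integrable lborel (\<lambda>x. \<bar>u x\<bar> powr p)"
    and p: "1 \<le> p" and e: "e > 0"
  obtains \<delta> where "\<delta> > 0" "\<And>\<rho>. mollifier \<rho> \<Longrightarrow> (\<And>x. \<rho> x \<noteq> 0 \<Longrightarrow> norm x \<le> \<delta>) \<Longrightarrow>
    (LINT x|lborel. \<bar>mollify \<rho> u x - u x\<bar> powr p) < e"
proof -
  define c where "c = 2 powr p"
  have c: "c \<ge> 1" unfolding c_def using p by (simp add: ge_one_powr_ge_zero)
  \<comment> \<open>Three errors are combined by two uses of the quasi-triangle inequality, and one
    of them already carries the factor \<open>c\<close> of the mollification bound. The total is at
    most \<open>3 * (c * c * c) * e1\<close>, which is less than \<open>e\<close>.\<close>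
  define e1 where "e1 = e / (4 * c * c * c)"
  have e1: "e1 > 0" using e c by (simp add: e1_def)
  obtain g where g: "continuous_on UNIV g" "compact_support g"
    "integrable lborel (\<lambda>x. \<bar>u x - g x\<bar> powr p)" "(LINT x|lborel. \<bar>u x - g x\<bar> powr p) < e1"
    by (rule Lp_approx_continuous[OF u up p e1]) blast
  obtain \<delta> where \<delta>: "\<delta> > 0" "\<And>\<rho>. mollifier \<rho> \<Longrightarrow> (\<And>x. \<rho> x \<noteq> 0 \<Longrightarrow> norm x \<le> \<delta>) \<Longrightarrow>
    integrable lborel (\<lambda>x. \<bar>mollify \<rho> g x - g x\<bar> powr p) \<and> (LINT x|lborel. \<bar>mollify \<rho> g x - g x\<bar> powr p) < e1"
    by (rule mollify_continuous_Lp[OF g(1,2) p e1]) blast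
  have [measurable]: "g \<in> borel_measurable borel"
    by (rule borel_measurable_continuous_onI[OF g(1)])
  have gp: "integrable lborel (\<lambda>x. \<bar>g x\<bar> powr p)"
  proof -
    have "integrable lborel (\<lambda>x. \<bar>(g x - u x) + u x\<bar> powr p)"
      using p g(3) up by (intro integrable_Lp_add) (auto simp: abs_minus_commute)
    then show ?thesis by simp
  qed
  show ?thesis
  proof (rule that[OF \<delta>(1)])
    fix \<rho> :: "'a \<Rightarrow> real"
    assume \<rho>: "mollifier \<rho>" and supp: "\<And>x. \<rho> x \<noteq> 0 \<Longrightarrow> norm x \<le> \<delta>"
    have dm: "(\<lambda>x. u x - g x) \<in> borel_measurable borel" by measurable
    note w = measurable_mollify[OF \<rho> dm g(3) p] integrable_Lp_mollify[OF \<rho> dm g(3) p]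
      integral_Lp_mollify_le[OF \<rho> dm g(3) p]
    note h = \<delta>(2)[OF \<rho> supp]
    have [measurable]: "mollify \<rho> g \<in> borel_measurable borel"
      using gp by (intro measurable_mollify[OF \<rho> _ _ p]) auto
    note [measurable] = w(1)
    have split: "mollify \<rho> u x - u x = (mollify \<rho> (\<lambda>x. u x - g x) x + (mollify \<rho> g x - g x)) + (g x - u x)" for x
      using integrable_mollify_Lp[OF \<rho> u up p, of x] integrable_mollify_Lp[OF \<rho> _ gp p, of x]
      by (simp add: mollify_def right_diff_distrib)
    let ?I = "\<lambda>f. LINT x|lborel. \<bar>f x\<bar> powr p"
    have i1: "integrable lborel (\<lambda>x. \<bar>mollify \<rho> (\<lambda>x. u x - g x) x + (mollify \<rho> g x - g x)\<bar> powr p)"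
      using p h by (intro integrable_Lp_add w) auto
    have "?I (\<lambda>x. mollify \<rho> u x - u x) \<le> c * (?I (\<lambda>x. mollify \<rho> (\<lambda>x. u x - g x) x + (mollify \<rho> g x - g x)) + ?I (\<lambda>x. g x - u x))"
      unfolding split c_def using p g(3) by (intro integral_Lp_add_le i1) (auto simp: abs_minus_commute)
    also have "\<dots> \<le> c * (c * (c * e1 + e1) + e1)"
    proof (intro mult_left_mono add_mono)
      have "?I (\<lambda>x. mollify \<rho> (\<lambda>x. u x - g x) x + (mollify \<rho> g x - g x))
        \<le> c * (?I (mollify \<rho> (\<lambda>x. u x - g x)) + ?I (\<lambda>x. mollify \<rho> g x - g x))"
        unfolding c_def using p h by (intro integral_Lp_add_le w) auto
      also have "\<dots> \<le> c * (c * e1 + e1)"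
      proof (intro mult_left_mono add_mono)
        show "?I (mollify \<rho> (\<lambda>x. u x - g x)) \<le> c * e1"
          using w(3) mult_left_mono[OF less_imp_le[OF g(4)], of c] c unfolding c_def by linarith
      qed (use h c in auto)
      finally show "?I (\<lambda>x. mollify \<rho> (\<lambda>x. u x - g x) x + (mollify \<rho> g x - g x)) \<le> c * (c * e1 + e1)" .
      show "?I (\<lambda>x. g x - u x) \<le> e1"
        using g(4) by (simp add: abs_minus_commute)
    qed (use c in auto)
    also have "\<dots> \<le> 3 * (c * c * c) * e1"
    proof -
      have "c \<le> c * c" "c * c \<le> c * c * c" using c by auto
      then have "c * c * e1 \<le> c * c * c * e1" "c * e1 \<le> c * c * c * e1"
        using e1 by (auto intro!: mult_right_mono)
      then show ?thesis by (simp add: algebra_simps)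
    qed
    also have "\<dots> < e" using c e by (simp add: e1_def field_simps)
    finally show "?I (\<lambda>x. mollify \<rho> u x - u x) < e" .
  qed
qed

text \<open>A rescaled bump divided by its integral. The integral is not 0 because the bump is
  positive on an open ball, which has positive measure.\<close>

lemma ex_mollifier:
  assumes d: "\<delta> > 0"
  obtains \<rho> :: "'a::euclidean_space \<Rightarrow> real" where "mollifier \<rho>" "\<And>x. \<rho> x \<noteq> 0 \<Longrightarrow> norm x \<le> \<delta>"
proof -
  define b :: "'a \<Rightarrow> real" where "b x = bump ((1 / \<delta>) *\<^sub>R x)" for x
  have b: "(\<lambda>x. a * b x) \<in> Cc_inf" for a
    unfolding b_def using d by (intro Cc_inf_bump_scale) simp
  have ib: "integrable lborel b"
    using lip_cs_integrable[OF Cc_inf_lip_cs[OF b[of 1]]] by simp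
  define I where "I = (LINT x|lborel. b x)"
  have pos: "b x > 0" if "norm x < \<delta>" for x
  proof -
    have "norm ((1 / \<delta>) *\<^sub>R x) < 1" using that d by simp
    then have "((1 / \<delta>) *\<^sub>R x) \<bullet> ((1 / \<delta>) *\<^sub>R x) < 1"
      by (simp only: dot_square_norm abs_square_less_1) simp
    then show ?thesis by (simp add: b_def bump_def flat_exp_def)
  qed
  have I0: "I \<ge> 0"
    unfolding I_def b_def by (intro Bochner_Integration.integral_nonneg bump_nonneg)
  have "I \<noteq> 0"
  proof
    assume "I = 0"
    then have "AE x in lborel. b x = 0"
      using integral_nonneg_eq_0_iff_AE[OF ib] by (simp add: I_def b_def[abs_def] bump_nonneg)
    then have "AE x in lborel. x \<notin> ball (0::'a) \<delta>"
      by eventually_elim (use pos in force)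
    then have "ball (0::'a) \<delta> \<in> null_sets lborel"
      by (subst (asm) AE_iff_null_sets[symmetric]) auto
    then have "emeasure lborel (ball (0::'a) \<delta>) = 0" by blast
    then show False using d unit_ball_vol_pos[of "real DIM('a)"] by (simp add: emeasure_ball)
  qed
  then have I: "I > 0" using I0 by simp
  define \<rho> where "\<rho> x = (1 / I) * b x" for x
  show ?thesis
  proof (rule that)
    show "mollifier \<rho>"
      unfolding mollifier_def
    proof (intro conjI allI)
      show "\<rho> \<in> Cc_inf" using b[of "1 / I"] by (simp add: \<rho>_def[abs_def])
      show "\<rho> x \<ge> 0" for x using I by (simp add: \<rho>_def b_def bump_nonneg)
      show "\<rho> (- x) = \<rho> x" for x by (simp add: \<rho>_def b_def bump_minus)
      show "(LINT x|lborel. \<rho> x) = 1" unfolding \<rho>_def using I by (simp add: I_def[symmetric])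
    qed
    show "norm x \<le> \<delta>" if "\<rho> x \<noteq> 0" for x
      using that bump_eq_0[of "(1 / \<delta>) *\<^sub>R x"] d by (force simp: \<rho>_def b_def field_simps)
  qed
qed

section \<open>Cutting off\<close>

text \<open>By homogeneity \<open>E\<close> has supremum at most M R^(-\<alpha>) and integral
  R^(n-\<alpha>) times that of \<open>D\<close>. These two norms are interpolated by splitting at a
  level depending on \<open>R\<close>.\<close>

lemma cutoff_error_le:
  fixes f :: "'a::euclidean_space \<Rightarrow> real"
  assumes \<alpha>: "0 < \<alpha>" "\<alpha> < 1" and p: "1 \<le> p"
    and f[measurable]: "f \<in> borel_measurable borel" and fp: "integrable lborel (\<lambda>x. \<bar>f x\<bar> powr p)"
    and \<eta>: "lip_cs (\<eta> :: 'a \<Rightarrow> real)"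
  obtains C where "\<And>R. R > 0 \<Longrightarrow> (LINT x|lborel. \<bar>f x\<bar> * frac_abs \<alpha> (\<lambda>x. \<eta> ((1 / R) *\<^sub>R x)) x)
      \<le> C * R powr (real DIM('a) - real DIM('a) / p - \<alpha>)"
proof -
  define D where "D = frac_abs \<alpha> \<eta>"
  define n where "n = real DIM('a)"
  have iD: "integrable lborel D" unfolding D_def by (rule frac_abs_integrable[OF \<alpha> \<eta>])
  have [measurable]: "D \<in> borel_measurable borel" using borel_measurable_integrable[OF iD] by simp
  have D0: "D x \<ge> 0" for x by (simp add: D_def frac_abs_nonneg)
  obtain M where M: "M > 0" "\<And>x. D x \<le> M"
    unfolding D_def by (rule frac_abs_bounded[OF \<alpha> \<eta>]) blast
  define C where "C = M * (LINT x|lborel. \<bar>f x\<bar> powr p) + (LINT x|lborel. D x)"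
  have "(LINT x|lborel. \<bar>f x\<bar> * frac_abs \<alpha> (\<lambda>x. \<eta> ((1 / R) *\<^sub>R x)) x) \<le> C * R powr (n - n / p - \<alpha>)"
    if R: "R > 0" for R
  proof -
    define E where "E x = (1 / R) powr \<alpha> * D ((1 / R) *\<^sub>R x)" for x
    have E: "frac_abs \<alpha> (\<lambda>x. \<eta> ((1 / R) *\<^sub>R x)) x = E x" for x
      unfolding E_def D_def using R by (intro frac_abs_scale[OF \<alpha> \<eta>]) simp
    have E0: "E x \<ge> 0" for x by (simp add: E_def D0)
    have Rm: "(1 / R) powr \<alpha> = R powr - \<alpha>" using R by (simp add: powr_divide powr_minus_divide)
    have iE: "integrable lborel E"
      unfolding E_def using integrable_lborel_affine[OF iD, of "1 / R" 0] R by simp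
    have IE: "(LINT x|lborel. E x) = R powr (n - \<alpha>) * (LINT x|lborel. D x)"
    proof -
      have "(LINT x|lborel. D x) = (1 / R) ^ DIM('a) * (LINT x|lborel. D ((1 / R) *\<^sub>R x))"
        using R integral_lborel_affine[of D "1 / R" 0] by simp
      then have "(LINT x|lborel. D ((1 / R) *\<^sub>R x)) = R powr n * (LINT x|lborel. D x)"
        using R by (simp add: n_def powr_realpow power_divide)
      then have "(LINT x|lborel. E x) = R powr - \<alpha> * (R powr n * (LINT x|lborel. D x))"
        unfolding E_def Rm by simp
      then show ?thesis using R by (simp add: powr_add[symmetric] mult.assoc[symmetric])
    qed
    \<comment> \<open>The level \<open>R powr (- n / p)\<close> is the one for which both terms
      scale as \<open>R powr (n - n / p - \<alpha>)\<close>.\<close>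
    have "(LINT x|lborel. \<bar>f x\<bar> * \<bar>E x\<bar>)
        \<le> (M * R powr - \<alpha>) * (R powr (- n / p)) powr (1 - p) * (LINT x|lborel. \<bar>f x\<bar> powr p)
          + R powr (- n / p) * (LINT x|lborel. \<bar>E x\<bar>)"
    proof (rule integral_mult_Lp_le[OF _ fp iE _ p])
      show "\<bar>E x\<bar> \<le> M * R powr - \<alpha>" for x
        using mult_left_mono[OF M(2)[of "(1 / R) *\<^sub>R x"], of "R powr - \<alpha>"] D0
        by (simp add: E_def Rm abs_mult mult.commute)
    qed (use R in auto)
    also have "\<dots> = M * (R powr - \<alpha> * (R powr (- n / p)) powr (1 - p)) * (LINT x|lborel. \<bar>f x\<bar> powr p)
          + (R powr (- n / p) * R powr (n - \<alpha>)) * (LINT x|lborel. D x)"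
      using E0 by (simp add: IE mult.assoc)
    also have "R powr - \<alpha> * (R powr (- n / p)) powr (1 - p) = R powr (n - n / p - \<alpha>)"
      unfolding powr_powr powr_add[symmetric] using p by (intro arg_cong[of _ _ "(powr) R"]) (simp add: field_simps)
    also have "R powr (- n / p) * R powr (n - \<alpha>) = R powr (n - n / p - \<alpha>)"
      unfolding powr_add[symmetric] by (intro arg_cong[of _ _ "(powr) R"]) simp
    finally show ?thesis
      using E0 by (simp add: E C_def algebra_simps)
  qed
  then show ?thesis using that unfolding n_def by blast
qed

lemma cutoff_error_tendsto_0:
  fixes f :: "'a::euclidean_space \<Rightarrow> real"
  assumes \<alpha>: "0 < \<alpha>" "\<alpha> < 1" and p: "1 \<le> p" "p < real DIM('a) / (real DIM('a) - \<alpha>)"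
    and f: "f \<in> borel_measurable borel" and fp: "integrable lborel (\<lambda>x. \<bar>f x\<bar> powr p)"
    and \<eta>: "lip_cs (\<eta> :: 'a \<Rightarrow> real)"
  shows "(\<lambda>k. LINT x|lborel. \<bar>f x\<bar> * frac_abs \<alpha> (\<lambda>x. \<eta> ((1 / real (Suc k)) *\<^sub>R x)) x) \<longlonglongrightarrow> 0"
proof -
  define n where "n = real DIM('a)"
  have n: "n \<ge> 1" unfolding n_def by (simp add: Suc_leI)
  obtain C where C: "\<And>R. R > 0 \<Longrightarrow> (LINT x|lborel. \<bar>f x\<bar> * frac_abs \<alpha> (\<lambda>x. \<eta> ((1 / R) *\<^sub>R x)) x)
      \<le> C * R powr (n - n / p - \<alpha>)"
    unfolding n_def by (rule cutoff_error_le[OF \<alpha> p(1) f fp \<eta>]) blast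
  have "p * (n - \<alpha>) < n"
    using p(2) n \<alpha> by (simp add: n_def[symmetric] pos_less_divide_eq)
  then have s: "n - n / p - \<alpha> < 0"
    using p(1) by (simp add: field_simps)
  have "filterlim (\<lambda>k. real (Suc k)) at_top sequentially"
    by (rule filterlim_compose[OF filterlim_real_sequentially filterlim_Suc])
  then have "(\<lambda>k. real (Suc k) powr (n - n / p - \<alpha>)) \<longlonglongrightarrow> 0"
    by (rule tendsto_neg_powr[OF s])
  then have "(\<lambda>k. C * real (Suc k) powr (n - n / p - \<alpha>)) \<longlonglongrightarrow> 0"
    by (rule tendsto_mult_right_zero)
  then show ?thesis
  proof (rule tendsto_sandwich[rotated 3])
    show "\<forall>\<^sub>F k in sequentially. 0 \<le> (LINT x|lborel. \<bar>f x\<bar> * frac_abs \<alpha> (\<lambda>x. \<eta> ((1 / real (Suc k)) *\<^sub>R x)) x)"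
      by (intro always_eventually allI Bochner_Integration.integral_nonneg mult_nonneg_nonneg frac_abs_nonneg) simp
    show "\<forall>\<^sub>F k in sequentially. (LINT x|lborel. \<bar>f x\<bar> * frac_abs \<alpha> (\<lambda>x. \<eta> ((1 / real (Suc k)) *\<^sub>R x)) x)
        \<le> C * real (Suc k) powr (n - n / p - \<alpha>)"
      by (intro always_eventually allI C) simp
  qed simp
qed

text \<open>The bump equals 1 only at the origin, so the cutoffs are not constant on large balls.
  Continuity at the origin still gives pointwise convergence, and values in [0,1] give the majorant
  |f|^p.\<close>

lemma cutoff_Lp_tendsto_0:
  fixes f :: "'a::euclidean_space \<Rightarrow> real"
  assumes p: "1 \<le> p" and f[measurable]: "f \<in> borel_measurable borel"
    and fp: "integrable lborel (\<lambda>x. \<bar>f x\<bar> powr p)"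
  shows "(\<lambda>k. LINT x|lborel. \<bar>bump ((1 / real (Suc k)) *\<^sub>R x) * f x - f x\<bar> powr p) \<longlonglongrightarrow> 0"
proof -
  have bc: "continuous_on UNIV (bump :: 'a \<Rightarrow> real)"
    by (rule smooth_real_continuous_on[OF smooth_real_bump])
  have [measurable]: "bump \<in> borel_measurable (borel :: 'a measure)"
    by (rule borel_measurable_continuous_onI[OF bc])
  have m: "(\<lambda>x. \<bar>bump ((1 / real (Suc k)) *\<^sub>R x) * f x - f x\<bar> powr p) \<in> borel_measurable lborel" for k
    by measurable
  have "(\<lambda>k. LINT x|lborel. \<bar>bump ((1 / real (Suc k)) *\<^sub>R x) * f x - f x\<bar> powr p) \<longlonglongrightarrow> (LINT x|(lborel::'a measure). 0)"
  proof (rule integral_dominated_convergence[OF _ m fp])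
    have "(\<lambda>k. \<bar>bump ((1 / real (Suc k)) *\<^sub>R x) * f x - f x\<bar> powr p) \<longlonglongrightarrow> 0" for x
    proof -
      have "(\<lambda>k. inverse (real (Suc k))) \<longlonglongrightarrow> 0" by (rule LIMSEQ_inverse_real_of_nat)
      then have "(\<lambda>k. (1 / real (Suc k)) *\<^sub>R x) \<longlonglongrightarrow> 0 *\<^sub>R x"
        unfolding inverse_eq_divide by (rule tendsto_scaleR[OF _ tendsto_const])
      then have "(\<lambda>k. bump ((1 / real (Suc k)) *\<^sub>R x)) \<longlonglongrightarrow> bump (0 *\<^sub>R x)"
        by (intro continuous_on_tendsto_compose[OF bc]) auto
      then have "(\<lambda>k. \<bar>bump ((1 / real (Suc k)) *\<^sub>R x) * f x - f x\<bar>) \<longlonglongrightarrow> \<bar>bump (0 *\<^sub>R x) * f x - f x\<bar>"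
        by (intro tendsto_intros)
      then have "(\<lambda>k. \<bar>bump ((1 / real (Suc k)) *\<^sub>R x) * f x - f x\<bar> powr p) \<longlonglongrightarrow> \<bar>bump (0 *\<^sub>R x) * f x - f x\<bar> powr p"
        using p by (intro tendsto_powr') auto
      then show ?thesis by (simp add: bump_0)
    qed
    then show "AE x in lborel. (\<lambda>k. \<bar>bump ((1 / real (Suc k)) *\<^sub>R x) * f x - f x\<bar> powr p) \<longlonglongrightarrow> 0" by simp
    have "\<bar>bump y * f x - f x\<bar> powr p \<le> \<bar>f x\<bar> powr p" for x y :: 'a
    proof -
      have "\<bar>bump y * f x - f x\<bar> = \<bar>1 - bump y\<bar> * \<bar>f x\<bar>"
        by (simp add: abs_mult[symmetric] left_diff_distrib abs_minus_commute)
      also have "\<dots> \<le> 1 * \<bar>f x\<bar>"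
        using bump_nonneg[of y] bump_le_1[of y] by (intro mult_right_mono) auto
      finally show ?thesis using p by (intro powr_mono2) auto
    qed
    then show "AE x in lborel. norm (\<bar>bump ((1 / real (Suc k)) *\<^sub>R x) * f x - f x\<bar> powr p) \<le> \<bar>f x\<bar> powr p" for k
      by simp
  qed simp
  then show ?thesis by simp
qed

section \<open>Approximation in energy\<close>

text \<open>The cutoff radius is fixed before the mollifier, since how fine the mollifier must be
  depends on the truncated function. Only the cutoff adds to the bound on the variation.\<close>

lemma ex_Cc_inf_approx:
  fixes f :: "real^'n \<Rightarrow> real"
  assumes \<alpha>: "0 < \<alpha>" "\<alpha> < 1" and p: "1 \<le> p" "p < real CARD('n) / (real CARD('n) - \<alpha>)"
    and f[measurable]: "f \<in> borel_measurable borel" and fp: "integrable lborel (\<lambda>x. \<bar>f x\<bar> powr p)"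
    and e: "e > 0"
  obtains g where "g \<in> Cc_inf" "integrable lborel (\<lambda>x. \<bar>g x - f x\<bar> powr p)"
    "(LINT x|lborel. \<bar>g x - f x\<bar> powr p) < e" "frac_var \<alpha> g \<le> frac_var \<alpha> f + ereal e"
proof -
  define \<mu> where "\<mu> = \<bar>mu_const CARD('n) \<alpha>\<bar>"
  define \<eta> :: "nat \<Rightarrow> real^'n \<Rightarrow> real" where "\<eta> k x = bump ((1 / real (Suc k)) *\<^sub>R x)" for k x
  define e' where "e' = e / (2 powr p * 2)"
  have e': "e' > 0" using e by (simp add: e'_def)
  have \<eta>C: "\<eta> k \<in> Cc_inf" for k
    using Cc_inf_bump_scale[of "1 / real (Suc k)" 1] by (simp add: \<eta>_def[abs_def])
  have lb: "lip_cs (bump :: real^'n \<Rightarrow> real)"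
    using Cc_inf_lip_cs[OF Cc_inf_bump_scale[of 1 1]] by simp
  have "(\<lambda>k. LINT x|lborel. \<bar>f x\<bar> * frac_abs \<alpha> (\<eta> k) x) \<longlonglongrightarrow> 0"
    unfolding \<eta>_def using p by (intro cutoff_error_tendsto_0[OF \<alpha> p(1) _ f fp lb]) simp
  then have "(\<lambda>k. \<mu> * (LINT x|lborel. \<bar>f x\<bar> * frac_abs \<alpha> (\<eta> k) x)) \<longlonglongrightarrow> 0"
    by (rule tendsto_mult_right_zero)
  then have "\<forall>\<^sub>F k in sequentially. \<mu> * (LINT x|lborel. \<bar>f x\<bar> * frac_abs \<alpha> (\<eta> k) x) < e"
    using e by (rule order_tendstoD(2))
  moreover have "\<forall>\<^sub>F k in sequentially. (LINT x|lborel. \<bar>\<eta> k x * f x - f x\<bar> powr p) < e'"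
    using cutoff_Lp_tendsto_0[OF p(1) f fp] e' unfolding \<eta>_def by (rule order_tendstoD(2))
  ultimately have "\<forall>\<^sub>F k in sequentially. \<mu> * (LINT x|lborel. \<bar>f x\<bar> * frac_abs \<alpha> (\<eta> k) x) < e \<and>
      (LINT x|lborel. \<bar>\<eta> k x * f x - f x\<bar> powr p) < e'"
    by (rule eventually_conj)
  then obtain k where k: "\<mu> * (LINT x|lborel. \<bar>f x\<bar> * frac_abs \<alpha> (\<eta> k) x) < e"
      "(LINT x|lborel. \<bar>\<eta> k x * f x - f x\<bar> powr p) < e'"
    using eventually_happens'[OF sequentially_bot] by blast
  define u where "u x = \<eta> k x * f x" for x
  have \<eta>01: "0 \<le> \<eta> k x" "\<eta> k x \<le> 1" for x
    by (simp_all add: \<eta>_def bump_nonneg bump_le_1)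
  have [measurable]: "\<eta> k \<in> borel_measurable borel"
    by (rule lip_cs_measurable[OF Cc_inf_lip_cs[OF \<eta>C]])
  have um[measurable]: "u \<in> borel_measurable borel"
    unfolding u_def by measurable
  have u_le: "\<bar>u x\<bar> \<le> \<bar>f x\<bar>" for x
    using \<eta>01[of x] by (simp add: u_def abs_mult mult_left_le_one_le)
  have up: "integrable lborel (\<lambda>x. \<bar>u x\<bar> powr p)"
  proof (rule Bochner_Integration.integrable_bound[OF fp])
    show "AE x in lborel. norm (\<bar>u x\<bar> powr p) \<le> norm (\<bar>f x\<bar> powr p)"
      using u_le p by (intro AE_I2) (simp add: powr_mono2)
  qed measurable
  obtain R where R: "R > 0" "\<And>x. \<eta> k x \<noteq> 0 \<Longrightarrow> norm x \<le> R"
    using \<eta>C[of k] unfolding Cc_inf_def compact_support_iff by blast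
  have uR: "norm x \<le> R" if "u x \<noteq> 0" for x
    using that R(2)[of x] by (auto simp: u_def)
  then have ucs: "compact_support u"
    unfolding compact_support_iff using R(1) by blast
  \<comment> \<open>On the bounded support, |u| <= |u|^p + 1 by the split at level 1; mollification
    needs an integrable function to yield a smooth one.\<close>
  have ui: "integrable lborel u"
  proof (rule Bochner_Integration.integrable_bound)
    show "integrable lborel (\<lambda>x. \<bar>u x\<bar> powr p + indicator (cball 0 R) x)"
      using up emeasure_bounded_finite[of "cball (0::real^'n) R"] by simp
    have "\<bar>u x\<bar> \<le> \<bar>u x\<bar> powr p + indicator (cball 0 R) x" for x
    proof (cases "u x = 0")
      case False
      have "\<bar>u x\<bar> * 1 \<le> 1 * 1 powr (1 - p) * \<bar>u x\<bar> powr p + 1 * 1"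
        using p by (intro mult_le_powr_split) auto
      then show ?thesis using uR[OF False] by simp
    qed simp
    then show "AE x in lborel. norm (u x) \<le> norm (\<bar>u x\<bar> powr p + indicator (cball 0 R) x)"
      by (intro AE_I2) (simp add: order.trans[OF _ abs_ge_self])
  qed measurable
  obtain \<delta> where \<delta>: "\<delta> > 0" "\<And>\<rho>. mollifier \<rho> \<Longrightarrow> (\<And>x. \<rho> x \<noteq> 0 \<Longrightarrow> norm x \<le> \<delta>) \<Longrightarrow>
    (LINT x|lborel. \<bar>mollify \<rho> u x - u x\<bar> powr p) < e'"
    by (rule Lp_mollify_approx[OF um up p(1) e']) blast
  obtain \<rho> :: "real^'n \<Rightarrow> real" where \<rho>: "mollifier \<rho>" "\<And>x. \<rho> x \<noteq> 0 \<Longrightarrow> norm x \<le> \<delta>"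
    by (rule ex_mollifier[OF \<delta>(1)]) blast
  define g where "g = mollify \<rho> u"
  note gm[measurable] = measurable_mollify[OF \<rho>(1) um up p(1), folded g_def]
  have gp: "integrable lborel (\<lambda>x. \<bar>g x\<bar> powr p)"
    unfolding g_def by (rule integrable_Lp_mollify[OF \<rho>(1) um up p(1)])
  have i1: "integrable lborel (\<lambda>x. \<bar>g x - u x\<bar> powr p)"
    using integrable_Lp_add[of g lborel "\<lambda>x. - u x" p] gp up p by simp
  have i2: "integrable lborel (\<lambda>x. \<bar>u x - f x\<bar> powr p)"
    using integrable_Lp_add[of u lborel "\<lambda>x. - f x" p] fp up p by simp
  show ?thesis
  proof (rule that)
    show "g \<in> Cc_inf"
      unfolding g_def by (intro Cc_inf_mollify mollifier_Cc_inf \<rho> ui ucs)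
    show "integrable lborel (\<lambda>x. \<bar>g x - f x\<bar> powr p)"
      using integrable_Lp_add[of g lborel "\<lambda>x. - f x" p] gp fp p by simp
    have "(LINT x|lborel. \<bar>(g x - u x) + (u x - f x)\<bar> powr p) \<le>
        2 powr p * ((LINT x|lborel. \<bar>g x - u x\<bar> powr p) + (LINT x|lborel. \<bar>u x - f x\<bar> powr p))"
      using p by (intro integral_Lp_add_le i1 i2) auto
    also have "\<dots> < 2 powr p * (e' + e')"
      using \<delta>(2)[OF \<rho>] k(2) by (intro mult_strict_left_mono add_strict_mono) (auto simp: g_def u_def)
    also have "\<dots> = e" by (simp add: e'_def)
    finally show "(LINT x|lborel. \<bar>g x - f x\<bar> powr p) < e" by simp
    have "frac_var \<alpha> g \<le> frac_var \<alpha> u"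
      unfolding g_def by (rule frac_var_mollify_le[OF \<alpha> \<rho>(1) ui])
    also have "\<dots> \<le> frac_var \<alpha> f + ereal (\<mu> * (LINT x|lborel. \<bar>f x\<bar> * frac_abs \<alpha> (\<eta> k) x))"
      unfolding u_def \<mu>_def by (rule frac_var_cutoff[OF \<alpha> p(1) f fp \<eta>C \<eta>01])
    also have "\<dots> \<le> frac_var \<alpha> f + ereal e"
      using k(1) by (intro add_left_mono) simp
    finally show "frac_var \<alpha> g \<le> frac_var \<alpha> f + ereal e" .
  qed
qed

text \<open>A bounded integrable function defines a continuous functional on L^p. This is applied to
  fractional divergences and is what makes the variation lower semicontinuous.\<close>

lemma integral_mult_tendsto_Lp:
  fixes f d :: "'a \<Rightarrow> real" and g :: "nat \<Rightarrow> 'a \<Rightarrow> real"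
  assumes f[measurable]: "f \<in> borel_measurable M" and fp: "integrable M (\<lambda>x. \<bar>f x\<bar> powr p)"
    and g[measurable]: "\<And>k. g k \<in> borel_measurable M"
    and gp: "\<And>k. integrable M (\<lambda>x. \<bar>g k x - f x\<bar> powr p)"
    and lim: "(\<lambda>k. LINT x|M. \<bar>g k x - f x\<bar> powr p) \<longlonglongrightarrow> 0"
    and d: "integrable M d" "\<And>x. \<bar>d x\<bar> \<le> K" and p: "1 \<le> p"
  shows "(\<lambda>k. LINT x|M. g k x * d x) \<longlonglongrightarrow> (LINT x|M. f x * d x)"
proof (rule LIMSEQ_I)
  fix e :: real assume e: "e > 0"
  define N where "N = (LINT x|M. \<bar>d x\<bar>)"
  have N: "N \<ge> 0" unfolding N_def by (intro Bochner_Integration.integral_nonneg) simp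
  \<comment> \<open>The level is fixed first, so that the part of the error carried by
    \<open>d\<close> is below \<open>e / 2\<close> for every \<open>k\<close>; only then is
    \<open>k\<close> taken large.\<close>
  define l where "l = e / (2 * (N + 1))"
  have l: "l > 0" using e N by (simp add: l_def)
  have lN: "l * N < e / 2" using e N by (simp add: l_def field_simps)
  have "(\<lambda>k. K * l powr (1 - p) * (LINT x|M. \<bar>g k x - f x\<bar> powr p)) \<longlonglongrightarrow> 0"
    by (rule tendsto_mult_right_zero[OF lim])
  then have "\<forall>\<^sub>F k in sequentially. K * l powr (1 - p) * (LINT x|M. \<bar>g k x - f x\<bar> powr p) < e / 2"
    using e by (intro order_tendstoD(2)) auto
  then obtain k0 where k0: "\<And>k. k \<ge> k0 \<Longrightarrow> K * l powr (1 - p) * (LINT x|M. \<bar>g k x - f x\<bar> powr p) < e / 2"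
    unfolding eventually_sequentially by blast
  have "norm ((LINT x|M. g k x * d x) - (LINT x|M. f x * d x)) < e" if "k \<ge> k0" for k
  proof -
    have dm: "(\<lambda>x. g k x - f x) \<in> borel_measurable M" by measurable
    have i1: "integrable M (\<lambda>x. f x * d x)"
      by (rule integrable_mult_Lp[OF f fp d p])
    have i2: "integrable M (\<lambda>x. (g k x - f x) * d x)"
      by (rule integrable_mult_Lp[OF dm gp d p])
    have "integrable M (\<lambda>x. (g k x - f x) * d x + f x * d x)"
      using i1 i2 by (rule Bochner_Integration.integrable_add[rotated])
    then have i3: "integrable M (\<lambda>x. g k x * d x)" by (simp add: algebra_simps)
    have "\<bar>(LINT x|M. g k x * d x) - (LINT x|M. f x * d x)\<bar> = \<bar>LINT x|M. (g k x - f x) * d x\<bar>"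
      by (simp add: left_diff_distrib Bochner_Integration.integral_diff[OF i3 i1])
    also have "\<dots> \<le> (LINT x|M. \<bar>(g k x - f x) * d x\<bar>)"
      by (rule integral_abs_bound)
    also have "\<dots> = (LINT x|M. \<bar>g k x - f x\<bar> * \<bar>d x\<bar>)"
      by (simp add: abs_mult)
    also have "\<dots> \<le> K * l powr (1 - p) * (LINT x|M. \<bar>g k x - f x\<bar> powr p) + l * N"
      unfolding N_def by (rule integral_mult_Lp_le[OF dm gp d p l])
    also have "\<dots> < e" using k0[OF that] lN by linarith
    finally show ?thesis by simp
  qed
  then show "\<exists>k0. \<forall>k\<ge>k0. norm ((LINT x|M. g k x * d x) - (LINT x|M. f x * d x)) < e" by blast
qed

text \<open>This permits passing to a Borel representative.\<close>

lemma frac_var_cong_AE: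
  fixes f g :: "real^'n \<Rightarrow> real"
  assumes \<alpha>: "0 < \<alpha>" "\<alpha> < 1"
    and [measurable]: "f \<in> borel_measurable lebesgue" "g \<in> borel_measurable lebesgue"
    and ae: "AE x in lebesgue. f x = g x"
  shows "frac_var \<alpha> f = frac_var \<alpha> g"
  unfolding frac_var_def
proof (intro SUP_cong refl arg_cong[of _ _ ereal] integral_cong_AE)
  fix \<phi> :: "real^'n \<Rightarrow> real^'n"
  assume "\<phi> \<in> {\<phi>\<in>Cc_inf_vec. \<forall>x. norm (\<phi> x) \<le> 1}"
  then have "frac_div \<alpha> \<phi> \<in> borel_measurable lborel"
    using frac_div_measurable[OF \<alpha> Cc_inf_vec_lip_cs] by auto
  then have [measurable]: "frac_div \<alpha> \<phi> \<in> borel_measurable lebesgue"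
    by (rule measurable_completion)
  show "(\<lambda>x. f x * frac_div \<alpha> \<phi> x) \<in> borel_measurable lebesgue"
    "(\<lambda>x. g x * frac_div \<alpha> \<phi> x) \<in> borel_measurable lebesgue" by measurable
  show "AE x in lebesgue. f x * frac_div \<alpha> \<phi> x = g x * frac_div \<alpha> \<phi> x"
    using ae by eventually_elim simp
qed

text \<open>From below, a single field that nearly realises the supremum for \<open>f\<close> has
  convergent pairings with \<open>g k\<close>. From above, the bound \<open>le\<close> is passed to
  the limit.\<close>

lemma frac_var_tendsto:
  fixes f :: "real^'n \<Rightarrow> real" and g :: "nat \<Rightarrow> real^'n \<Rightarrow> real"
  assumes \<alpha>: "0 < \<alpha>" "\<alpha> < 1" and p: "1 \<le> p"
    and f: "f \<in> borel_measurable borel" "integrable lborel (\<lambda>x. \<bar>f x\<bar> powr p)"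
    and g: "\<And>k. g k \<in> borel_measurable borel" "\<And>k. integrable lborel (\<lambda>x. \<bar>g k x - f x\<bar> powr p)"
    and lim: "(\<lambda>k. LINT x|lborel. \<bar>g k x - f x\<bar> powr p) \<longlonglongrightarrow> 0"
    and le: "\<And>k. frac_var \<alpha> (g k) \<le> frac_var \<alpha> f + ereal (1 / real (Suc k))"
  shows "(\<lambda>k. frac_var \<alpha> (g k)) \<longlonglongrightarrow> frac_var \<alpha> f"
proof (rule order_tendstoI)
  fix a assume "a < frac_var \<alpha> f"
  then obtain \<phi> where \<phi>: "\<phi> \<in> Cc_inf_vec" "\<And>x. norm (\<phi> x) \<le> 1"
    and a: "a < ereal (LINT x|lborel. f x * frac_div \<alpha> \<phi> x)"
    unfolding frac_var_lborel[OF \<alpha> f(1)] less_SUP_iff by blast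
  note l = Cc_inf_vec_lip_cs[OF \<phi>(1)]
  obtain K where K: "K > 0" "\<And>x. \<bar>frac_div \<alpha> \<phi> x\<bar> \<le> K"
    by (rule frac_div_bounded[OF \<alpha> l]) blast
  have "(\<lambda>k. LINT x|lborel. g k x * frac_div \<alpha> \<phi> x) \<longlonglongrightarrow> (LINT x|lborel. f x * frac_div \<alpha> \<phi> x)"
    using f g by (intro integral_mult_tendsto_Lp[OF _ _ _ _ lim frac_div_integrable[OF \<alpha> l] K(2) p]) auto
  then have "(\<lambda>k. ereal (LINT x|lborel. g k x * frac_div \<alpha> \<phi> x)) \<longlonglongrightarrow> ereal (LINT x|lborel. f x * frac_div \<alpha> \<phi> x)"
    by (rule tendsto_ereal)
  then have "\<forall>\<^sub>F k in sequentially. a < ereal (LINT x|lborel. g k x * frac_div \<alpha> \<phi> x)"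
    using a by (rule order_tendstoD(1))
  then show "\<forall>\<^sub>F k in sequentially. a < frac_var \<alpha> (g k)"
    by eventually_elim (rule less_le_trans[OF _ frac_var_ge[OF \<alpha> g(1) \<phi>]])
next
  fix a assume a: "frac_var \<alpha> f < a"
  have "(\<lambda>k. frac_var \<alpha> f + ereal (1 / real (Suc k))) \<longlonglongrightarrow> frac_var \<alpha> f + ereal 0"
  proof (rule tendsto_add_ereal_general)
    have "(\<lambda>k. inverse (real (Suc k))) \<longlonglongrightarrow> 0" by (rule LIMSEQ_inverse_real_of_nat)
    then show "(\<lambda>k. ereal (1 / real (Suc k))) \<longlonglongrightarrow> ereal 0"
      unfolding inverse_eq_divide by (rule tendsto_ereal)
  qed auto
  then have "\<forall>\<^sub>F k in sequentially. frac_var \<alpha> f + ereal (1 / real (Suc k)) < a"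
    using a by (intro order_tendstoD(2)) auto
  then show "\<forall>\<^sub>F k in sequentially. frac_var \<alpha> (g k) < a"
    by eventually_elim (rule le_less_trans[OF le])
qed

theorem theorem3p3:
  fixes f :: "real^'n \<Rightarrow> real" and \<alpha> p :: real
  assumes "0 < \<alpha>" "\<alpha> < 1"
    and "1 \<le> p" "p < real CARD('n) / (real CARD('n) - \<alpha>)"
    and "f \<in> BV_frac \<alpha> p"
  shows "\<exists>fk :: nat \<Rightarrow> real^'n \<Rightarrow> real.
           (\<forall>k. fk k \<in> Cc_inf) \<and>
           ((\<lambda>k. LINT x|lebesgue. \<bar>fk k x - f x\<bar> powr p) \<longlonglongrightarrow> 0) \<and>
           ((\<lambda>k. frac_var \<alpha> (fk k)) \<longlonglongrightarrow> frac_var \<alpha> f)"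
proof -
  have fm[measurable]: "f \<in> borel_measurable lebesgue" and fp: "integrable lebesgue (\<lambda>x. \<bar>f x\<bar> powr p)"
    using assms(5) by (auto simp: BV_frac_def Lp_def)
  \<comment> \<open>\<open>f\<close> is only Lebesgue measurable, whereas convolution and Fubini are
    carried out over the Borel measure; the two agree on a Borel representative.\<close>
  obtain F where Fm: "F \<in> borel_measurable lborel" and "AE x in lborel. f x = F x"
    using completion_ex_borel_measurable_real[OF fm] by blast
  then have ae: "AE x in lebesgue. f x = F x"
    by (simp add: AE_completion)
  have [measurable]: "F \<in> borel_measurable borel" using Fm by simp
  have Fl[measurable]: "F \<in> borel_measurable lebesgue"
    by (rule measurable_completion[OF Fm])
  have "integrable lebesgue (\<lambda>x. \<bar>F x\<bar> powr p)"
    using fp ae by (subst integrable_cong_AE[of _ _ "\<lambda>x. \<bar>f x\<bar> powr p"]) auto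
  then have Fp: "integrable lborel (\<lambda>x. \<bar>F x\<bar> powr p)"
    by (simp add: integrable_completion)
  have "\<forall>k. \<exists>g. g \<in> Cc_inf \<and> integrable lborel (\<lambda>x. \<bar>g x - F x\<bar> powr p) \<and>
      (LINT x|lborel. \<bar>g x - F x\<bar> powr p) < 1 / real (Suc k) \<and>
      frac_var \<alpha> g \<le> frac_var \<alpha> F + ereal (1 / real (Suc k))"
    by (rule allI, rule ex_Cc_inf_approx[OF assms(1-4) _ Fp, of "1 / real (Suc _)"]) auto
  from choice[OF this] obtain g where g: "\<And>k. g k \<in> Cc_inf" "\<And>k. integrable lborel (\<lambda>x. \<bar>g k x - F x\<bar> powr p)"
      "\<And>k. (LINT x|lborel. \<bar>g k x - F x\<bar> powr p) < 1 / real (Suc k)"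
      "\<And>k. frac_var \<alpha> (g k) \<le> frac_var \<alpha> F + ereal (1 / real (Suc k))"
    by blast
  have gm[measurable]: "g k \<in> borel_measurable borel" for k
    by (rule lip_cs_measurable[OF Cc_inf_lip_cs[OF g(1)]])
  have gl[measurable]: "g k \<in> borel_measurable lebesgue" for k
    by (rule measurable_completion) simp
  have lim: "(\<lambda>k. LINT x|lborel. \<bar>g k x - F x\<bar> powr p) \<longlonglongrightarrow> 0"
  proof (rule tendsto_sandwich[OF _ _ tendsto_const])
    show "(\<lambda>k. 1 / real (Suc k)) \<longlonglongrightarrow> 0"
      using LIMSEQ_inverse_real_of_nat by (simp add: inverse_eq_divide)
    show "\<forall>\<^sub>F k in sequentially. 0 \<le> (LINT x|lborel. \<bar>g k x - F x\<bar> powr p)"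
      by (intro always_eventually allI Bochner_Integration.integral_nonneg) simp
    show "\<forall>\<^sub>F k in sequentially. (LINT x|lborel. \<bar>g k x - F x\<bar> powr p) \<le> 1 / real (Suc k)"
      by (intro always_eventually allI less_imp_le g(3))
  qed
  have eq: "(LINT x|lebesgue. \<bar>g k x - f x\<bar> powr p) = (LINT x|lborel. \<bar>g k x - F x\<bar> powr p)" for k
  proof -
    have "(LINT x|lebesgue. \<bar>g k x - f x\<bar> powr p) = (LINT x|lebesgue. \<bar>g k x - F x\<bar> powr p)"
      using ae by (intro integral_cong_AE) auto
    also have "\<dots> = (LINT x|lborel. \<bar>g k x - F x\<bar> powr p)"
      by (rule integral_completion) measurable
    finally show ?thesis .
  qed
  have "(\<lambda>k. frac_var \<alpha> (g k)) \<longlonglongrightarrow> frac_var \<alpha> F"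
    by (rule frac_var_tendsto[OF assms(1-3) _ Fp gm g(2) lim g(4)]) simp
  moreover have "frac_var \<alpha> f = frac_var \<alpha> F"
    by (rule frac_var_cong_AE[OF assms(1,2) fm Fl ae])
  ultimately show ?thesis
    using g(1) lim by (intro exI[of _ g]) (simp add: eq)
qed

end
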